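(* Let $\ell$ and $p$ be distinct primes, $A\in\Gamma_{\ell,p}^n$, $Q\in\mathcal{Q}$ and $v\in\mathbf{Q}^n$. Then for every $P\in\mathcal{P}$, $$\Psi_\ell(A,P,Q,v)=\int_{\mathbf{X}_v}P(x)\,d\mu_\ell(A,Q,v)(x).$$
   Context: Notation: $\mathcal{P}=\mathbf{Q}[X_1,\dots,X_n]$. $\mathcal{Q}$: tuples $Q=(Q_1,\dots,Q_m)$ of real linear forms $Q_i(x)=\sum_jQ_{ij}x_j$, each nonvanishing on $\mathbf{Q}^n\setminus0$; $(\sigma^{-1}Q)(x)=Q(x\sigma^{-1})$. $\Gamma_\ell$ is the group of $A\in\mathrm{GL}_n(\mathbf{Z}_{(\ell)})$ whose first column has all entries but the first divisible by $\ell$; $\Gamma_{\ell,p}=\Gamma_\ell\cap\mathrm{GL}_n(\mathbf{Z}[1/p])$; $\pi_\ell=\mathrm{diag}(\ell,1,\dots,1)$. Bernoulli: $B_k(y)=b_k(\{y\})$ for $k\ne1$ ($b_k$ Bernoulli polynomials), $B_1(y)=\{y\}-\frac12$ for $y\notin\mathbf{Z}$, $0$ for $y\in\mathbf{Z}$; for a positive $n$-tuple $e$, $\underline e=\sum e_j$, $w\in\mathbf{R}^n$, $J=\{j:e_j=1,w_j\in\mathbf{Z}\}$: $\mathbf{B}_e(w,Q)=\frac1m\sum_i\prod_{j\in J}\frac{\mathrm{sgn}Q_{ij}}2\prod_{j\notin J}B_{e_j}(w_j)$. For $A\in\Gamma_\ell^n$, let $\sigma$ be the matrix whose $i$-th column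 is the first column of $A_i$, $\sigma_\ell=\ell^{-1}\pi_\ell\sigma$, $\mathbf{D}_\ell(\sigma,e,Q,v)=\sum_{x\in\mathbf{Z}^n/\sigma_\ell\mathbf{Z}^n}\mathbf{B}_e(\sigma_\ell^{-1}(x+\pi_\ell v),\sigma^{-1}Q)-\ell^{1-n+\underline e}\sum_{x\in\mathbf{Z}^n/\sigma\mathbf{Z}^n}\mathbf{B}_e(\sigma^{-1}(x+v),\sigma^{-1}Q)$ ($0$ if $\det\sigma=0$); for homogeneous $P$, with $P_r(\sigma)$ defined by $P(X\sigma^t)=\sum_rP_r(\sigma)X^r/r!$ ($r$ over $n$-tuples of nonnegative integers summing to $\deg P$, $r!=\prod r_j!$), $\Psi_\ell(A,P,Q,v)=(-1)^n\mathrm{sgn}(\det\sigma)\sum_r\frac{P_r(\sigma)}{(r+\mathbf{1})!\ell^{\underline r}}\mathbf{D}_\ell(\sigma,\mathbf{1}+r,Q,v)$, extended linearly in $P$ ($\mathbf{1}=(1,\dots,1)$, $(r+\mathbf{1})!=\prod(r_j+1)!$). Measures: $\mathbf{X}=\mathbf{Z}_p^n$ and $\mathbf{X}_v=v+\mathbf{X}\subset\mathbf{Q}_p^n$. The measure $\mu_\ell(A,Q,v)$ on $\mathbf{X}_v$ is $0$ if $\det\sigma=0$, and otherwise is the ($\frac1m\mathbf{Z}_p$-valued) measure determined by $\mu_\ell(A,Q,v)(v+a+p^k\mathbf{X})=\Psi_\ell(A,1,Q,\frac{v+a}{p^k})$ for $a\in\mathbf{Z}^n$, $k\ge0$.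
   Formalization: The sums over Z^n/σZ^n and Z^n/σ_ℓZ^n are undefined when σ has p-power denominators (e.g. n=1, σ=1/p); there σ is replaced throughout Ψ_ℓ by its least positive integer multiple with integral entries, which leaves integral σ unchanged. *)

theory Defs
  imports
    "HOL-Analysis.Analysis"
    "HOL-Library.Poly_Mapping"
    "HOL-Computational_Algebra.Computational_Algebra"
begin

section \<open>The field of p-adic numbers\<close>

text \<open>
  The prime \<open>p\<close> is carried by a type: \<open>p = CARD('p)\<close>. The field \<open>\<rat>\<^sub>p\<close> is the completion of the
  rationals for the p-adic absolute value, built from Cauchy sequences modulo null sequences.
\<close>

class prime_card =
  assumes prime_card: "prime CARD('a)"

definition padic_abs :: "nat \<Rightarrow> rat \<Rightarrow> real" where
  "padic_abs p x = (if x = 0 then 0 else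
     real p powi (int (multiplicity (int p) (snd (quotient_of x)))
                  - int (multiplicity (int p) (fst (quotient_of x)))))"

context
  fixes p :: nat
  assumes p: "prime p"
begin

lemma padic_abs_Fract:
  assumes "a \<noteq> 0" "b \<noteq> 0"
  shows "padic_abs p (of_int a / of_int b)
    = real p powi (int (multiplicity (int p) b) - int (multiplicity (int p) a))"
proof -
  let ?x = "of_int a / of_int b :: rat"
  obtain c d where cd: "quotient_of ?x = (c, d)" by (cases "quotient_of ?x")
  have d: "d > 0" using quotient_of_denom_pos[OF cd] .
  have x: "?x = of_int c / of_int d" using quotient_of_div[OF cd] .
  have "of_int (a * d) = (of_int (c * b) :: rat)"
    using x assms d by (simp add: field_simps)
  then have eq: "a * d = c * b" by (simp only: of_int_eq_iff)
  have c: "c \<noteq> 0" using eq assms d by auto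
  have pe: "prime_elem (int p)" using p by simp
  have "multiplicity (int p) a + multiplicity (int p) d = multiplicity (int p) c + multiplicity (int p) b"
    using eq prime_elem_multiplicity_mult_distrib[OF pe] assms c d by (metis less_irrefl)
  then have "int (multiplicity (int p) d) - int (multiplicity (int p) c)
     = int (multiplicity (int p) b) - int (multiplicity (int p) a)" by linarith
  moreover have "?x \<noteq> 0" using assms by simp
  ultimately show ?thesis by (simp add: padic_abs_def cd)
qed

lemma padic_abs_0 [simp]: "padic_abs p 0 = 0"
  by (simp add: padic_abs_def)

lemma padic_abs_nonneg [simp]: "0 \<le> padic_abs p x"
  by (simp add: padic_abs_def)

lemma padic_abs_pos [simp]: "0 < padic_abs p x \<longleftrightarrow> x \<noteq> 0"
  using prime_gt_0_nat[OF p] by (simp add: padic_abs_def)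

lemma padic_abs_eq_0 [simp]: "padic_abs p x = 0 \<longleftrightarrow> x = 0"
  using padic_abs_pos[of x] by fastforce

lemma rat_as_fraction:
  obtains a b where "b \<noteq> 0" "x = of_int a / (of_int b :: rat)"
  by (metis quotient_of_div quotient_of_denom_pos less_irrefl surj_pair)

lemma padic_abs_mult: "padic_abs p (x * y) = padic_abs p x * padic_abs p y"
proof (cases "x = 0 \<or> y = 0")
  case False
  obtain a b where ab: "b \<noteq> 0" "x = of_int a / of_int b" by (rule rat_as_fraction)
  obtain c d where cd: "d \<noteq> 0" "y = of_int c / of_int d" by (rule rat_as_fraction)
  have nz: "a \<noteq> 0" "c \<noteq> 0" using False ab cd by auto
  have pe: "prime_elem (int p)" using p by simp
  have "x * y = of_int (a * c) / of_int (b * d)" using ab cd by simp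
  then have "padic_abs p (x * y) = real p powi (int (multiplicity (int p) (b * d)) - int (multiplicity (int p) (a * c)))"
    using nz ab(1) cd(1) by (simp only: padic_abs_Fract mult_eq_0_iff not_False_eq_True simp_thms)
  also have "int (multiplicity (int p) (b * d)) - int (multiplicity (int p) (a * c))
     = (int (multiplicity (int p) b) - int (multiplicity (int p) a))
       + (int (multiplicity (int p) d) - int (multiplicity (int p) c))"
    using nz ab(1) cd(1) by (simp add: prime_elem_multiplicity_mult_distrib[OF pe])
  also have "real p powi \<dots> = padic_abs p x * padic_abs p y"
    using nz ab cd prime_gt_0_nat[OF p] by (simp add: padic_abs_Fract power_int_add)
  finally show ?thesis .
qed auto

lemma padic_abs_1 [simp]: "padic_abs p 1 = 1"
  using padic_abs_mult[of 1 1] padic_abs_eq_0[of 1] by simp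

lemma padic_abs_minus [simp]: "padic_abs p (- x) = padic_abs p x"
proof -
  have "padic_abs p (-1) * padic_abs p (-1) = 1"
    by (simp flip: padic_abs_mult)
  then have "padic_abs p (-1) = 1"
    using padic_abs_nonneg[of "-1"] by (metis abs_of_nonneg abs_mult_self_eq mult_cancel_right2
        power2_eq_1_iff power2_eq_square neg_0_le_iff_le not_one_le_zero)
  then show ?thesis using padic_abs_mult[of "-1" x] by simp
qed

lemma padic_abs_diff_commute: "padic_abs p (x - y) = padic_abs p (y - x)"
  using padic_abs_minus[of "x - y"] by simp

lemma padic_abs_inverse: "padic_abs p (inverse x) = inverse (padic_abs p x)"
proof (cases "x = 0")
  case False
  then have "padic_abs p x * padic_abs p (inverse x) = 1"
    by (simp flip: padic_abs_mult)
  then show ?thesis by (simp add: inverse_unique)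
qed auto

lemma padic_abs_le_1I: "padic_abs p (of_int a / of_int b) \<le> 1" if "\<not> int p dvd b"
proof (cases "a = 0")
  case False
  have "b \<noteq> 0" using that by auto
  have "multiplicity (int p) b = 0" using that by (rule not_dvd_imp_multiplicity_0)
  then have "padic_abs p (of_int a / of_int b) = real p powi (- int (multiplicity (int p) a))"
    using False \<open>b \<noteq> 0\<close> by (simp add: padic_abs_Fract)
  also have "\<dots> = inverse (real p ^ multiplicity (int p) a)"
    by (simp add: power_int_minus)
  also have "\<dots> \<le> 1"
    using prime_gt_0_nat[OF p] by (simp add: inverse_le_1_iff)
  finally show ?thesis .
qed auto

lemma padic_abs_le_1D:
  assumes "padic_abs p x \<le> 1"
  obtains a b where "\<not> int p dvd b" "x = of_int a / of_int b"
proof -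
  obtain c d where cd: "quotient_of x = (c, d)" by (cases "quotient_of x")
  have d: "d > 0" using quotient_of_denom_pos[OF cd] .
  have cop: "coprime c d" using quotient_of_coprime[OF cd] .
  have x: "x = of_int c / of_int d" using quotient_of_div[OF cd] .
  have "\<not> int p dvd d"
  proof
    assume dvd: "int p dvd d"
    have nu: "\<not> is_unit (int p)" using p by auto
    have "\<not> int p dvd c" using cop dvd nu by (meson coprime_common_divisor)
    then have c: "multiplicity (int p) c = 0" "c \<noteq> 0"
      by (auto intro: not_dvd_imp_multiplicity_0)
    have "multiplicity (int p) d > 0"
      using dvd d nu by (metis multiplicity_eq_zero_iff less_irrefl neq0_conv)
    then have "1 < real p powi int (multiplicity (int p) d)"
      using prime_gt_1_nat[OF p] by (simp add: one_less_power)
    also have "\<dots> = padic_abs p x"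
      using c d by (simp add: x padic_abs_Fract)
    finally show False using assms by simp
  qed
  then show ?thesis using x that by blast
qed

lemma padic_abs_add: "padic_abs p (x + y) \<le> max (padic_abs p x) (padic_abs p y)"
proof -
  have *: "padic_abs p (x + y) \<le> max (padic_abs p x) (padic_abs p y)"
    if le: "padic_abs p x \<le> padic_abs p y" for x y
  proof (cases "y = 0")
    case True
    then show ?thesis using le by simp
  next
    case False
    have "padic_abs p (x * inverse y) = padic_abs p x / padic_abs p y"
      by (simp only: padic_abs_mult padic_abs_inverse divide_inverse)
    also have "\<dots> \<le> 1"
      using le False by (simp add: pos_divide_le_eq)
    finally have "padic_abs p (x * inverse y) \<le> 1" .
    then obtain a b where ab: "\<not> int p dvd b" "x * inverse y = of_int a / of_int b"
      by (rule padic_abs_le_1D)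
    have "b \<noteq> 0" using ab by auto
    then have "x * inverse y + 1 = of_int (a + b) / of_int b"
      by (simp only: ab(2)) (simp add: field_simps)
    then have "padic_abs p (x * inverse y + 1) \<le> 1"
      using ab(1) padic_abs_le_1I by metis
    moreover have "x + y = (x * inverse y + 1) * y"
      using False by (simp add: field_simps)
    ultimately have "padic_abs p (x + y) \<le> 1 * padic_abs p y"
      by (metis padic_abs_mult mult_right_mono padic_abs_nonneg)
    then show ?thesis by simp
  qed
  show ?thesis
    using *[of x y] *[of y x] by (cases "padic_abs p x \<le> padic_abs p y") (auto simp: add.commute max.commute)
qed

lemma padic_abs_triangle: "padic_abs p (x + y) \<le> padic_abs p x + padic_abs p y"
  using padic_abs_add[of x y] padic_abs_nonneg[of x] padic_abs_nonneg[of y] by linarith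

lemma padic_abs_triangle_diff: "\<bar>padic_abs p x - padic_abs p y\<bar> \<le> padic_abs p (x - y)"
  using padic_abs_triangle[of "x - y" y] padic_abs_triangle[of "y - x" x] padic_abs_diff_commute[of x y]
  by simp

end

definition padic_cauchy :: "nat \<Rightarrow> (nat \<Rightarrow> rat) \<Rightarrow> bool" where
  "padic_cauchy p X \<longleftrightarrow> (\<forall>e>0. \<exists>k. \<forall>m\<ge>k. \<forall>n\<ge>k. padic_abs p (X m - X n) < e)"

definition padic_null :: "nat \<Rightarrow> (nat \<Rightarrow> rat) \<Rightarrow> bool" where
  "padic_null p X \<longleftrightarrow> (\<lambda>n. padic_abs p (X n)) \<longlonglongrightarrow> 0"

definition padic_rel :: "nat \<Rightarrow> ((nat \<Rightarrow> rat) \<times> (nat \<Rightarrow> rat)) set" where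
  "padic_rel p = {(X, Y). padic_cauchy p X \<and> padic_cauchy p Y \<and> padic_null p (\<lambda>n. X n - Y n)}"

context
  fixes p :: nat
  assumes p: "prime p"
begin

lemma padic_null_const [simp]: "padic_null p (\<lambda>n. c) \<longleftrightarrow> c = 0"
  by (simp add: padic_null_def LIMSEQ_const_iff padic_abs_eq_0[OF p])

lemma padic_null_minus: "padic_null p X \<Longrightarrow> padic_null p (\<lambda>n. - X n)"
  by (simp add: padic_null_def padic_abs_minus[OF p])

lemma padic_null_add:
  assumes "padic_null p X" "padic_null p Y"
  shows "padic_null p (\<lambda>n. X n + Y n)"
proof -
  have "(\<lambda>n. padic_abs p (X n) + padic_abs p (Y n)) \<longlonglongrightarrow> 0"
    using tendsto_add[OF assms[unfolded padic_null_def]] by simp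
  then show ?thesis unfolding padic_null_def
    by (rule Lim_null_comparison[rotated])
       (simp add: padic_abs_nonneg[OF p] padic_abs_triangle[OF p])
qed

lemma padic_null_diff:
  assumes "padic_null p X" "padic_null p Y"
  shows "padic_null p (\<lambda>n. X n - Y n)"
  using padic_null_add[OF assms(1) padic_null_minus[OF assms(2)]] by simp

lemma padic_cauchy_const [simp]: "padic_cauchy p (\<lambda>n. c)"
  by (auto simp: padic_cauchy_def padic_abs_0[OF p])

lemma padic_cauchy_minus: "padic_cauchy p X \<Longrightarrow> padic_cauchy p (\<lambda>n. - X n)"
  unfolding padic_cauchy_def
  using padic_abs_minus[OF p] by (metis minus_diff_minus)

lemma padic_cauchy_add:
  assumes "padic_cauchy p X" "padic_cauchy p Y"
  shows "padic_cauchy p (\<lambda>n. X n + Y n)"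
  unfolding padic_cauchy_def
proof (intro allI impI)
  fix e :: real assume e: "e > 0"
  obtain k where k: "\<And>m n. m \<ge> k \<Longrightarrow> n \<ge> k \<Longrightarrow> padic_abs p (X m - X n) < e"
    using assms(1) e unfolding padic_cauchy_def by meson
  obtain l where l: "\<And>m n. m \<ge> l \<Longrightarrow> n \<ge> l \<Longrightarrow> padic_abs p (Y m - Y n) < e"
    using assms(2) e unfolding padic_cauchy_def by meson
  have "padic_abs p ((X m + Y m) - (X n + Y n)) < e" if "m \<ge> max k l" "n \<ge> max k l" for m n
    using padic_abs_add[OF p, of "X m - X n" "Y m - Y n"] k[of m n] l[of m n] that
    by (simp add: add_diff_add)
  then show "\<exists>k. \<forall>m\<ge>k. \<forall>n\<ge>k. padic_abs p ((X m + Y m) - (X n + Y n)) < e" by blast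
qed

lemma padic_cauchy_convergent:
  assumes "padic_cauchy p X"
  shows "convergent (\<lambda>n. padic_abs p (X n))"
proof (rule real_Cauchy_convergent, rule metric_CauchyI)
  fix e :: real assume e: "e > 0"
  obtain k where k: "\<forall>m\<ge>k. \<forall>n\<ge>k. padic_abs p (X m - X n) < e"
    using assms e unfolding padic_cauchy_def by meson
  then show "\<exists>k. \<forall>m\<ge>k. \<forall>n\<ge>k. dist (padic_abs p (X m)) (padic_abs p (X n)) < e"
    using padic_abs_triangle_diff[OF p] unfolding dist_real_def by (meson order_le_less_trans)
qed

lemma padic_cauchy_bounded:
  assumes "padic_cauchy p X"
  obtains B where "B > 0" "\<And>n. padic_abs p (X n) \<le> B"
proof -
  have "Bseq (\<lambda>n. padic_abs p (X n))"
    using padic_cauchy_convergent[OF assms] by (rule convergent_imp_Bseq)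
  then obtain B where "B > 0" "\<forall>n. norm (padic_abs p (X n)) \<le> B"
    by (rule BseqE)
  then show ?thesis using that by (auto simp: padic_abs_nonneg[OF p])
qed

lemma padic_null_mult:
  assumes "padic_cauchy p X" "padic_null p Y"
  shows "padic_null p (\<lambda>n. X n * Y n)"
proof -
  obtain B where B: "B > 0" "\<And>n. padic_abs p (X n) \<le> B"
    using assms(1) by (rule padic_cauchy_bounded) blast
  have "(\<lambda>n. B * padic_abs p (Y n)) \<longlonglongrightarrow> 0"
    using tendsto_mult_left[OF assms(2)[unfolded padic_null_def], of B] by simp
  then show ?thesis unfolding padic_null_def
    by (rule Lim_null_comparison[rotated])
       (simp add: padic_abs_mult[OF p] B mult_right_mono padic_abs_nonneg[OF p])
qed

lemma padic_cauchy_mult: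
  assumes "padic_cauchy p X" "padic_cauchy p Y"
  shows "padic_cauchy p (\<lambda>n. X n * Y n)"
  unfolding padic_cauchy_def
proof (intro allI impI)
  fix e :: real assume e: "e > 0"
  obtain A where A: "A > 0" "\<And>n. padic_abs p (X n) \<le> A"
    using assms(1) by (rule padic_cauchy_bounded) blast
  obtain B where B: "B > 0" "\<And>n. padic_abs p (Y n) \<le> B"
    using assms(2) by (rule padic_cauchy_bounded) blast
  obtain k where k: "\<And>m n. m \<ge> k \<Longrightarrow> n \<ge> k \<Longrightarrow> padic_abs p (X m - X n) < e / B"
    using assms(1) e B(1) unfolding padic_cauchy_def by (meson divide_pos_pos)
  obtain l where l: "\<And>m n. m \<ge> l \<Longrightarrow> n \<ge> l \<Longrightarrow> padic_abs p (Y m - Y n) < e / A"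
    using assms(2) e A(1) unfolding padic_cauchy_def by (meson divide_pos_pos)
  have "padic_abs p (X m * Y m - X n * Y n) < e" if "m \<ge> max k l" "n \<ge> max k l" for m n
  proof -
    have "padic_abs p (X m * (Y m - Y n)) \<le> A * padic_abs p (Y m - Y n)"
      by (simp add: padic_abs_mult[OF p] A mult_right_mono padic_abs_nonneg[OF p])
    also have "\<dots> < e" using l[of m n] that A(1) by (simp add: field_simps)
    finally have 1: "padic_abs p (X m * (Y m - Y n)) < e" .
    have "padic_abs p ((X m - X n) * Y n) \<le> padic_abs p (X m - X n) * B"
      by (simp add: padic_abs_mult[OF p] B mult_left_mono padic_abs_nonneg[OF p])
    also have "\<dots> < e" using k[of m n] that B(1) by (simp add: field_simps)
    finally have 2: "padic_abs p ((X m - X n) * Y n) < e" .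
    show ?thesis
      using padic_abs_add[OF p, of "X m * (Y m - Y n)" "(X m - X n) * Y n"] 1 2
      by (simp add: mult_diff_mult)
  qed
  then show "\<exists>k. \<forall>m\<ge>k. \<forall>n\<ge>k. padic_abs p (X m * Y m - X n * Y n) < e" by blast
qed

lemma padic_cauchy_away_from_0:
  assumes "padic_cauchy p X" "\<not> padic_null p X"
  obtains b k where "b > 0" "\<And>n. n \<ge> k \<Longrightarrow> b < padic_abs p (X n)"
proof -
  obtain L where L: "(\<lambda>n. padic_abs p (X n)) \<longlonglongrightarrow> L"
    using padic_cauchy_convergent[OF assms(1)] by (auto simp: convergent_def)
  have "L \<ge> 0" using L by (rule LIMSEQ_le_const) (simp add: padic_abs_nonneg[OF p])
  moreover have "L \<noteq> 0" using L assms(2) by (auto simp: padic_null_def)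
  ultimately have "L > 0" by simp
  then have "eventually (\<lambda>n. L / 2 < padic_abs p (X n)) sequentially"
    using L by (intro order_tendstoD) auto
  then show ?thesis using \<open>L > 0\<close> that[of "L / 2"] by (auto simp: eventually_sequentially)
qed

lemma padic_cauchy_inverse:
  assumes "padic_cauchy p X" "\<not> padic_null p X"
  shows "padic_cauchy p (\<lambda>n. inverse (X n))"
  unfolding padic_cauchy_def
proof (intro allI impI)
  fix e :: real assume e: "e > 0"
  obtain b l where b: "b > 0" "\<And>n. n \<ge> l \<Longrightarrow> b < padic_abs p (X n)"
    using assms by (rule padic_cauchy_away_from_0) blast
  have "e * b\<^sup>2 > 0" using e b(1) by simp
  then obtain k where k: "\<And>m n. m \<ge> k \<Longrightarrow> n \<ge> k \<Longrightarrow> padic_abs p (X m - X n) < e * b\<^sup>2"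
    using assms(1) unfolding padic_cauchy_def by meson
  have "padic_abs p (inverse (X m) - inverse (X n)) < e" if "m \<ge> max k l" "n \<ge> max k l" for m n
  proof -
    have mn: "b < padic_abs p (X m)" "b < padic_abs p (X n)" using b that by auto
    then have nz: "X m \<noteq> 0" "X n \<noteq> 0" using b(1) padic_abs_0[OF p] by auto
    have "padic_abs p (inverse (X m) - inverse (X n))
       = padic_abs p (X m - X n) / (padic_abs p (X m) * padic_abs p (X n))"
      by (simp only: inverse_diff_inverse[OF nz] padic_abs_minus[OF p] padic_abs_mult[OF p]
          padic_abs_inverse[OF p]) (simp add: divide_inverse)
    also have "\<dots> \<le> padic_abs p (X m - X n) / (b * b)"
      using mn b(1) by (intro divide_left_mono mult_mono) (auto simp: padic_abs_nonneg[OF p])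
    also have "\<dots> < e" using k[of m n] that b(1) by (simp add: field_simps power2_eq_square)
    finally show ?thesis .
  qed
  then show "\<exists>k. \<forall>m\<ge>k. \<forall>n\<ge>k. padic_abs p (inverse (X m) - inverse (X n)) < e" by blast
qed

lemma padic_null_inverse_mult:
  assumes "padic_cauchy p X" "\<not> padic_null p X"
  shows "padic_null p (\<lambda>n. inverse (X n) * X n - 1)"
proof -
  obtain b k where b: "b > 0" "\<And>n. n \<ge> k \<Longrightarrow> b < padic_abs p (X n)"
    using assms by (rule padic_cauchy_away_from_0) blast
  then have "X n \<noteq> 0" if "n \<ge> k" for n
    using that padic_abs_0[OF p] by (metis less_asym)
  then have "eventually (\<lambda>n. padic_abs p (inverse (X n) * X n - 1) = 0) sequentially"
    by (auto simp: eventually_sequentially padic_abs_0[OF p] intro!: exI[of _ k])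
  then show ?thesis unfolding padic_null_def by (rule tendsto_eventually)
qed

lemma padic_rel_refl: "padic_cauchy p X \<Longrightarrow> (X, X) \<in> padic_rel p"
  by (simp add: padic_rel_def)

lemma equiv_padic_rel: "equiv {X. padic_cauchy p X} (padic_rel p)"
proof (rule equivI)
  show "padic_rel p \<subseteq> {X. padic_cauchy p X} \<times> {X. padic_cauchy p X}"
    by (auto simp: padic_rel_def)
  show "refl_on {X. padic_cauchy p X} (padic_rel p)"
    by (auto simp: refl_on_def padic_rel_def)
  show "sym (padic_rel p)"
    unfolding sym_def padic_rel_def using padic_null_minus by fastforce
  show "trans (padic_rel p)"
    unfolding trans_def padic_rel_def using padic_null_add by fastforce
qed

end

typedef ('p::prime_card) padic = "{X. padic_cauchy CARD('p) X} // padic_rel CARD('p)"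
  using quotientI[of "\<lambda>_. 0" "{X. padic_cauchy CARD('p) X}"] padic_cauchy_const[OF prime_card] by blast

definition Padic :: "(nat \<Rightarrow> rat) \<Rightarrow> 'p::prime_card padic" where
  "Padic X = Abs_padic (padic_rel CARD('p) `` {X})"

definition rep_padic :: "'p::prime_card padic \<Rightarrow> nat \<Rightarrow> rat" where
  "rep_padic x = (SOME X. X \<in> Rep_padic x)"

lemma
  fixes x :: "'p::prime_card padic"
  shows padic_cauchy_rep [simp]: "padic_cauchy CARD('p) (rep_padic x)"
    and Padic_rep [simp]: "Padic (rep_padic x) = x"
proof -
  note eq = equiv_padic_rel[OF prime_card[where 'a = 'p]]
  have "Rep_padic x \<in> {X. padic_cauchy CARD('p) X} // padic_rel CARD('p)"
    by (rule Rep_padic)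
  then obtain X where X: "padic_cauchy CARD('p) X" "Rep_padic x = padic_rel CARD('p) `` {X}"
    by (auto elim: quotientE)
  have "X \<in> Rep_padic x" using X padic_rel_refl[OF prime_card] by auto
  then have "rep_padic x \<in> Rep_padic x" unfolding rep_padic_def by (rule someI[of "\<lambda>X. X \<in> Rep_padic x"])
  then have *: "(X, rep_padic x) \<in> padic_rel CARD('p)" using X by simp
  then show "padic_cauchy CARD('p) (rep_padic x)" by (simp add: padic_rel_def)
  have "padic_rel CARD('p) `` {rep_padic x} = Rep_padic x"
    using equiv_class_eq[OF eq *] X by simp
  then show "Padic (rep_padic x) = x" by (simp add: Padic_def Rep_padic_inverse)
qed

lemma Padic_eq_iff:
  assumes "padic_cauchy CARD('p::prime_card) X" "padic_cauchy CARD('p) Y"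
  shows "(Padic X :: 'p padic) = Padic Y \<longleftrightarrow> padic_null CARD('p) (\<lambda>n. X n - Y n)"
proof -
  note eq = equiv_padic_rel[OF prime_card[where 'a = 'p]]
  have "(Padic X :: 'p padic) = Padic Y \<longleftrightarrow> padic_rel CARD('p) `` {X} = padic_rel CARD('p) `` {Y}"
    unfolding Padic_def using assms by (intro Abs_padic_inject quotientI) auto
  also have "\<dots> \<longleftrightarrow> (X, Y) \<in> padic_rel CARD('p)"
    using eq assms by (simp add: eq_equiv_class_iff)
  finally show ?thesis using assms by (simp add: padic_rel_def)
qed

lemma Padic_cases:
  fixes x :: "'p::prime_card padic"
  obtains X where "padic_cauchy CARD('p) X" "x = Padic X"
  by (metis padic_cauchy_rep Padic_rep)

lemma padic_null_rep_Padic: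
  assumes "padic_cauchy CARD('p::prime_card) X"
  shows "padic_null CARD('p) (\<lambda>n. rep_padic (Padic X :: 'p padic) n - X n)"
  using assms by (simp flip: Padic_eq_iff[where 'p = 'p])

instantiation padic :: (prime_card) field
begin

definition zero_padic :: "'a padic" where "0 = Padic (\<lambda>_. 0)"
definition one_padic :: "'a padic" where "1 = Padic (\<lambda>_. 1)"
definition plus_padic :: "'a padic \<Rightarrow> 'a padic \<Rightarrow> 'a padic" where
  "x + y = Padic (\<lambda>n. rep_padic x n + rep_padic y n)"
definition uminus_padic :: "'a padic \<Rightarrow> 'a padic" where
  "- x = Padic (\<lambda>n. - rep_padic x n)"
definition minus_padic :: "'a padic \<Rightarrow> 'a padic \<Rightarrow> 'a padic" where
  "minus_padic x y = x + - y"
definition times_padic :: "'a padic \<Rightarrow> 'a padic \<Rightarrow> 'a padic" where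
  "x * y = Padic (\<lambda>n. rep_padic x n * rep_padic y n)"
definition inverse_padic :: "'a padic \<Rightarrow> 'a padic" where
  "inverse x = (if x = 0 then 0 else Padic (\<lambda>n. inverse (rep_padic x n)))"
definition divide_padic :: "'a padic \<Rightarrow> 'a padic \<Rightarrow> 'a padic" where
  "x div y = x * inverse y" for x y :: "'a padic"

lemma add_Padic:
  assumes "padic_cauchy CARD('a) X" "padic_cauchy CARD('a) Y"
  shows "(Padic X + Padic Y :: 'a padic) = Padic (\<lambda>n. X n + Y n)"
proof -
  have "padic_null CARD('a) (\<lambda>n. (rep_padic (Padic X :: 'a padic) n - X n)
          + (rep_padic (Padic Y :: 'a padic) n - Y n))"
    using assms by (intro padic_null_add[OF prime_card] padic_null_rep_Padic)
  then show ?thesis unfolding plus_padic_def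
    using assms by (subst Padic_eq_iff) (auto intro!: padic_cauchy_add[OF prime_card] simp: add_diff_add)
qed

lemma minus_Padic:
  assumes "padic_cauchy CARD('a) X"
  shows "(- Padic X :: 'a padic) = Padic (\<lambda>n. - X n)"
proof -
  have "padic_null CARD('a) (\<lambda>n. - (rep_padic (Padic X :: 'a padic) n - X n))"
    using assms by (intro padic_null_minus[OF prime_card] padic_null_rep_Padic)
  then show ?thesis unfolding uminus_padic_def
    using assms by (subst Padic_eq_iff) (auto intro!: padic_cauchy_minus[OF prime_card])
qed

lemma mult_Padic:
  assumes "padic_cauchy CARD('a) X" "padic_cauchy CARD('a) Y"
  shows "(Padic X * Padic Y :: 'a padic) = Padic (\<lambda>n. X n * Y n)"
proof -
  let ?X = "rep_padic (Padic X :: 'a padic)" and ?Y = "rep_padic (Padic Y :: 'a padic)"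
  have "padic_null CARD('a) (\<lambda>n. ?X n * (?Y n - Y n) + Y n * (?X n - X n))"
    using assms
    by (intro padic_null_add[OF prime_card] padic_null_mult[OF prime_card] padic_null_rep_Padic) auto
  then have "padic_null CARD('a) (\<lambda>n. ?X n * ?Y n - X n * Y n)"
    by (simp add: algebra_simps)
  then show ?thesis unfolding times_padic_def
    using assms by (subst Padic_eq_iff) (auto intro!: padic_cauchy_mult[OF prime_card])
qed

lemma Padic_eq_0_iff:
  "padic_cauchy CARD('a) X \<Longrightarrow> (Padic X :: 'a padic) = 0 \<longleftrightarrow> padic_null CARD('a) X"
  unfolding zero_padic_def using padic_cauchy_const[OF prime_card]
  by (subst Padic_eq_iff) auto

instance
proof
  note cauchy [intro!] = padic_cauchy_const[OF prime_card] padic_cauchy_add[OF prime_card]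
    padic_cauchy_minus[OF prime_card] padic_cauchy_mult[OF prime_card]
  fix a b c :: "'a padic"
  obtain X where X [simp]: "padic_cauchy CARD('a) X" "a = Padic X" by (rule Padic_cases)
  obtain Y where Y [simp]: "padic_cauchy CARD('a) Y" "b = Padic Y" by (rule Padic_cases)
  obtain Z where Z [simp]: "padic_cauchy CARD('a) Z" "c = Padic Z" by (rule Padic_cases)
  have [simp]: "padic_cauchy CARD('a) (\<lambda>n. X n + Y n)" "padic_cauchy CARD('a) (\<lambda>n. Y n + Z n)"
    "padic_cauchy CARD('a) (\<lambda>n. X n * Y n)" "padic_cauchy CARD('a) (\<lambda>n. Y n * Z n)"
    "padic_cauchy CARD('a) (\<lambda>n. X n * Z n)" "padic_cauchy CARD('a) (\<lambda>n. - X n)"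
    "padic_cauchy CARD('a) (\<lambda>_. 0)" "padic_cauchy CARD('a) (\<lambda>_. 1)"
    by auto
  show "a + b = b + a" by (simp add: add_Padic add.commute)
  show "(a + b) + c = a + (b + c)" by (simp add: add_Padic add.assoc)
  show "0 + a = a" by (simp add: zero_padic_def add_Padic)
  show "- a + a = 0" by (simp add: zero_padic_def add_Padic minus_Padic)
  show "a - b = a + - b" by (rule minus_padic_def)
  show "(a * b) * c = a * (b * c)" by (simp add: mult_Padic mult.assoc)
  show "a * b = b * a" by (simp add: mult_Padic mult.commute)
  show "1 * a = a" by (simp add: one_padic_def mult_Padic)
  show "(a + b) * c = a * c + b * c" by (simp add: add_Padic mult_Padic distrib_right)
  show "(0 :: 'a padic) \<noteq> 1"
    using Padic_eq_0_iff[of "\<lambda>_. 1"] padic_null_const[OF prime_card[where 'a = 'a], of 1]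
    by (simp add: one_padic_def)
  show "a div b = a * inverse b" by (rule divide_padic_def)
  show "inverse (0 :: 'a padic) = 0" by (simp add: inverse_padic_def)
  show "inverse a * a = 1" if "a \<noteq> 0"
  proof -
    let ?X = "rep_padic a"
    have nn: "\<not> padic_null CARD('a) ?X"
      using that Padic_eq_0_iff[of ?X] by simp
    have c: "padic_cauchy CARD('a) (\<lambda>n. inverse (?X n))"
      using padic_cauchy_inverse[OF prime_card _ nn] by simp
    have "inverse a * Padic ?X = Padic (\<lambda>n. inverse (?X n) * ?X n)"
      unfolding inverse_padic_def using that c by (simp only: if_False padic_cauchy_rep mult_Padic)
    also have "\<dots> = 1"
      unfolding one_padic_def
      using c padic_null_inverse_mult[OF prime_card _ nn]
      by (subst Padic_eq_iff) auto
    finally show ?thesis by simp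
  qed
qed

end

lemma of_nat_padic: "(of_nat n :: 'p::prime_card padic) = Padic (\<lambda>_. of_nat n)"
  using padic_cauchy_const[OF prime_card[where 'a = 'p]]
  by (induction n) (auto simp: zero_padic_def one_padic_def add_Padic)

instance padic :: (prime_card) field_char_0
proof
  show "inj (of_nat :: nat \<Rightarrow> 'a padic)"
    using padic_cauchy_const[OF prime_card[where 'a = 'a]] padic_null_const[OF prime_card[where 'a = 'a]]
    by (intro injI) (simp add: of_nat_padic Padic_eq_iff)
qed

lemma of_rat_padic: "(of_rat q :: 'p::prime_card padic) = Padic (\<lambda>_. q)"
proof -
  note [simp] = padic_cauchy_const[OF prime_card[where 'a = 'p]]
  have int: "(of_int a :: 'p padic) = Padic (\<lambda>_. of_int a)" for a
  proof (cases a rule: int_cases2)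
    case (nonneg n)
    then show ?thesis by (simp add: of_nat_padic)
  next
    case (nonpos n)
    then show ?thesis by (simp add: of_nat_padic minus_Padic)
  qed
  obtain a b where ab: "b \<noteq> 0" "q = of_int a / (of_int b :: rat)"
    by (metis quotient_of_div quotient_of_denom_pos less_irrefl surj_pair)
  have "Padic (\<lambda>_. q) * of_int b = (of_int a :: 'p padic)"
    using ab by (simp add: int mult_Padic)
  then have "Padic (\<lambda>_. q) = (of_int a / of_int b :: 'p padic)"
    using ab(1) by (simp add: eq_divide_eq)
  then show ?thesis using ab(2) by (simp add: of_rat_divide)
qed

definition padic_norm :: "'p::prime_card padic \<Rightarrow> real" where
  "padic_norm x = lim (\<lambda>n. padic_abs CARD('p) (rep_padic x n))"

instantiation padic :: (prime_card) metric_space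
begin

definition dist_padic :: "'a padic \<Rightarrow> 'a padic \<Rightarrow> real" where
  "dist x y = padic_norm (x - y)" for x y :: "'a padic"

definition uniformity_padic :: "('a padic \<times> 'a padic) filter" where
  "uniformity_padic = (INF e\<in>{0 <..}. principal {(x, y). dist x y < e})"

definition open_padic :: "'a padic set \<Rightarrow> bool" where
  "open_padic U = (\<forall>x\<in>U. eventually (\<lambda>(x', y). x' = x \<longrightarrow> y \<in> U) uniformity)"

lemma padic_norm_Padic:
  assumes "padic_cauchy CARD('a) X"
  shows "(\<lambda>n. padic_abs CARD('a) (X n)) \<longlonglongrightarrow> padic_norm (Padic X :: 'a padic)"
proof -
  let ?Y = "rep_padic (Padic X :: 'a padic)"
  have lim: "(\<lambda>n. padic_abs CARD('a) (?Y n)) \<longlonglongrightarrow> padic_norm (Padic X :: 'a padic)"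
    using padic_cauchy_convergent[OF prime_card[where 'a = 'a], of ?Y]
    by (simp add: padic_norm_def convergent_LIMSEQ_iff)
  have "(\<lambda>n. padic_abs CARD('a) (?Y n - X n)) \<longlonglongrightarrow> 0"
    using padic_null_rep_Padic[OF assms] by (simp add: padic_null_def)
  then have "(\<lambda>n. padic_abs CARD('a) (?Y n) - padic_abs CARD('a) (X n)) \<longlonglongrightarrow> 0"
    by (rule Lim_null_comparison[rotated])
       (simp add: padic_abs_triangle_diff[OF prime_card])
  from tendsto_diff[OF lim this] show ?thesis by simp
qed

lemma padic_norm_eq_0_iff: "padic_norm x = 0 \<longleftrightarrow> x = 0" for x :: "'a padic"
proof -
  obtain X where X: "padic_cauchy CARD('a) X" "x = Padic X" by (rule Padic_cases)
  have "padic_norm x = 0 \<longleftrightarrow> padic_null CARD('a) X"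
    using padic_norm_Padic[OF X(1)] X(2) LIMSEQ_unique by (auto simp: padic_null_def)
  then show ?thesis using Padic_eq_0_iff[OF X(1)] X(2) by simp
qed

lemma padic_norm_minus: "padic_norm (- x) = padic_norm x" for x :: "'a padic"
proof -
  obtain X where X: "padic_cauchy CARD('a) X" "x = Padic X" by (rule Padic_cases)
  have "(\<lambda>n. padic_abs CARD('a) (X n)) \<longlonglongrightarrow> padic_norm (- x)"
    using padic_norm_Padic[OF padic_cauchy_minus[OF prime_card X(1)]] X
    by (simp add: minus_Padic padic_abs_minus[OF prime_card])
  then show ?thesis using padic_norm_Padic[OF X(1)] X(2) LIMSEQ_unique by blast
qed

lemma padic_norm_add: "padic_norm (x + y) \<le> max (padic_norm x) (padic_norm y)" for x y :: "'a padic"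
proof -
  obtain X where X: "padic_cauchy CARD('a) X" "x = Padic X" by (rule Padic_cases)
  obtain Y where Y: "padic_cauchy CARD('a) Y" "y = Padic Y" by (rule Padic_cases)
  have "(\<lambda>n. padic_abs CARD('a) (X n + Y n)) \<longlonglongrightarrow> padic_norm (x + y)"
    using padic_norm_Padic[OF padic_cauchy_add[OF prime_card X(1) Y(1)]] X Y by (simp add: add_Padic)
  moreover have "(\<lambda>n. max (padic_abs CARD('a) (X n)) (padic_abs CARD('a) (Y n))) \<longlonglongrightarrow> max (padic_norm x) (padic_norm y)"
    using padic_norm_Padic[OF X(1)] padic_norm_Padic[OF Y(1)] X(2) Y(2) by (auto intro: tendsto_max)
  ultimately show ?thesis
    by (rule LIMSEQ_le) (simp add: padic_abs_add[OF prime_card])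
qed

lemma padic_norm_nonneg: "padic_norm x \<ge> 0" for x :: "'a padic"
proof -
  obtain X where X: "padic_cauchy CARD('a) X" "x = Padic X" by (rule Padic_cases)
  show ?thesis
    using padic_norm_Padic[OF X(1)] X(2)
    by (auto intro!: LIMSEQ_le_const simp: padic_abs_nonneg[OF prime_card])
qed

instance
proof
  fix x y z :: "'a padic" and U :: "'a padic set"
  show "(uniformity :: ('a padic \<times> 'a padic) filter) = (INF e\<in>{0 <..}. principal {(x, y). dist x y < e})"
    by (rule uniformity_padic_def)
  show "open U \<longleftrightarrow> (\<forall>x\<in>U. eventually (\<lambda>(x', y). x' = x \<longrightarrow> y \<in> U) uniformity)"
    by (rule open_padic_def)
  show "dist x y = 0 \<longleftrightarrow> x = y" by (simp add: dist_padic_def padic_norm_eq_0_iff)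
  have "padic_norm ((x - z) + - (y - z)) \<le> max (padic_norm (x - z)) (padic_norm (y - z))"
    using padic_norm_add[of "x - z" "- (y - z)"] by (simp only: padic_norm_minus)
  then show "dist x y \<le> dist x z + dist y z"
    using padic_norm_nonneg[of "x - z"] padic_norm_nonneg[of "y - z"] by (simp add: dist_padic_def)
qed

end

lemma padic_norm_of_rat: "padic_norm (of_rat q :: 'p::prime_card padic) = padic_abs CARD('p) q"
  using padic_norm_Padic[where 'a = 'p, OF padic_cauchy_const[OF prime_card]]
  by (simp add: of_rat_padic LIMSEQ_const_iff)

definition padic_ints :: "'p::prime_card padic set" where
  "padic_ints = {x. padic_norm x \<le> 1}"


section \<open>p-adic measures and integration\<close>

definition compact_opens :: "'a::topological_space set \<Rightarrow> 'a set set" where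
  "compact_opens X = {U. compact U \<and> open U \<and> U \<subseteq> X}"

text \<open>
  \<open>R\<close>-valued measures on \<open>X\<close>: finitely additive functions on the compact open subsets of \<open>X\<close>. The
  value on any other set is fixed to \<open>0\<close>, so that equal measures are equal functions.
\<close>

definition padic_measure :: "'a::topological_space set \<Rightarrow> 'p::prime_card padic set \<Rightarrow> ('a set \<Rightarrow> 'p padic) \<Rightarrow> bool" where
  "padic_measure X R \<mu> \<longleftrightarrow>
     (\<forall>U\<in>compact_opens X. \<forall>V\<in>compact_opens X. U \<inter> V = {} \<longrightarrow> \<mu> (U \<union> V) = \<mu> U + \<mu> V) \<and>
     (\<forall>U\<in>compact_opens X. \<mu> U \<in> R) \<and>
     (\<forall>U. U \<notin> compact_opens X \<longrightarrow> \<mu> U = 0)"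

text \<open>
  The integral is the limit of Riemann sums over finite partitions of \<open>X\<close> into compact open sets of
  small diameter, with arbitrary sample points.
\<close>

definition has_padic_integral ::
    "('a::metric_space \<Rightarrow> 'p::prime_card padic) \<Rightarrow> 'p padic \<Rightarrow> 'a set \<Rightarrow> ('a set \<Rightarrow> 'p padic) \<Rightarrow> bool" where
  "has_padic_integral f I X \<mu> \<longleftrightarrow>
     (\<forall>\<epsilon>>0. \<exists>\<delta>>0. \<forall>\<U> t.
        finite \<U> \<and> partition_on X \<U> \<and> \<U> \<subseteq> compact_opens X \<and> (\<forall>U\<in>\<U>. t U \<in> U \<and> diameter U < \<delta>) \<longrightarrow>
        dist (\<Sum>U\<in>\<U>. f (t U) * \<mu> U) I < \<epsilon>)"

definition padic_integral ::
    "'a::metric_space set \<Rightarrow> ('a \<Rightarrow> 'p::prime_card padic) \<Rightarrow> ('a set \<Rightarrow> 'p padic) \<Rightarrow> 'p padic" where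
  "padic_integral X f \<mu> = (THE I. has_padic_integral f I X \<mu>)"


section \<open>Polynomials in several variables\<close>

text \<open>
  \<open>'n qpoly\<close> is \<open>\<rat>[X\<^sub>j | j :: 'n]\<close>; exponent vectors are the functions \<open>'n \<Rightarrow>\<^sub>0 nat\<close>.
\<close>

type_synonym 'n qpoly = "('n \<Rightarrow>\<^sub>0 nat) \<Rightarrow>\<^sub>0 rat"

type_synonym 'n qvec = "rat^'n"

type_synonym 'n qmat = "rat^'n^'n"

definition total :: "('n::finite \<Rightarrow>\<^sub>0 nat) \<Rightarrow> nat" where
  "total r = (\<Sum>j\<in>UNIV. Poly_Mapping.lookup r j)"

text \<open>The image of \<open>P\<close> under the homomorphism that is \<open>h\<close> on constants and sends \<open>X\<^sub>j\<close> to \<open>x j\<close>.\<close>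

definition qpoly_insert :: "(rat \<Rightarrow> 'b::comm_semiring_1) \<Rightarrow> ('n::finite \<Rightarrow> 'b) \<Rightarrow> 'n qpoly \<Rightarrow> 'b" where
  "qpoly_insert h x P = (\<Sum>r\<in>Poly_Mapping.keys P. h (Poly_Mapping.lookup P r) * (\<Prod>j\<in>UNIV. x j ^ Poly_Mapping.lookup r j))"

abbreviation qpoly_const :: "rat \<Rightarrow> 'n qpoly" where
  "qpoly_const \<equiv> Poly_Mapping.single 0"

abbreviation qpoly_var :: "'n \<Rightarrow> 'n qpoly" where
  "qpoly_var j \<equiv> Poly_Mapping.single (Poly_Mapping.single j 1) 1"

definition homogeneous_part :: "nat \<Rightarrow> 'n::finite qpoly \<Rightarrow> 'n qpoly" where
  "homogeneous_part d P = (\<Sum>r\<in>{r\<in>Poly_Mapping.keys P. total r = d}. Poly_Mapping.single r (Poly_Mapping.lookup P r))"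

text \<open>
  \<open>P(X\<sigma>\<^sup>t)\<close> for the row vector \<open>X\<close>, i.e. \<open>X\<^sub>i\<close> is replaced by \<open>\<Sum>j. X\<^sub>j \<sigma>\<^sub>i\<^sub>j\<close>.
\<close>

definition qpoly_transform :: "'n qmat \<Rightarrow> 'n::finite qpoly \<Rightarrow> 'n qpoly" where
  "qpoly_transform \<sigma> P =
     qpoly_insert qpoly_const (\<lambda>i. \<Sum>j\<in>UNIV. qpoly_const (\<sigma> $ i $ j) * qpoly_var j) P"

definition transform_coeff :: "'n::finite qpoly \<Rightarrow> ('n \<Rightarrow>\<^sub>0 nat) \<Rightarrow> 'n qmat \<Rightarrow> rat" where
  "transform_coeff P r \<sigma> = (\<Prod>j\<in>UNIV. fact (Poly_Mapping.lookup r j)) * Poly_Mapping.lookup (qpoly_transform \<sigma> P) r"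


section \<open>Linear forms and matrix groups\<close>

text \<open>
  An \<open>m\<close>-tuple of linear forms is the \<open>m \<times> n\<close> matrix of coefficients \<open>Q\<^sub>i\<^sub>j\<close>, with \<open>m = CARD('m)\<close>
  and \<open>n = CARD('n)\<close>.
\<close>

type_synonym ('n, 'm) forms = "real^'n^'m"

definition linear_forms :: "('n::finite, 'm::finite) forms set" where
  "linear_forms = {Q. \<forall>i. \<forall>x :: 'n qvec. x \<noteq> 0 \<longrightarrow> (\<Sum>j\<in>UNIV. Q $ i $ j * of_rat (x $ j)) \<noteq> 0}"

text \<open>
  The forms \<open>x \<mapsto> Q\<^sub>i(xM)\<close>, where \<open>x\<close> is a row vector.
\<close>

definition forms_act :: "'n::finite qmat \<Rightarrow> ('n, 'm::finite) forms \<Rightarrow> ('n, 'm::finite) forms" where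
  "forms_act M Q = (\<chi> i k. \<Sum>j\<in>UNIV. Q $ i $ j * of_rat (M $ k $ j))"

definition Z_loc :: "nat \<Rightarrow> rat set" where
  "Z_loc l = {of_int a / of_int b | a b. \<not> int l dvd b}"

definition Z_inv :: "nat \<Rightarrow> rat set" where
  "Z_inv p = {of_int a / of_nat p ^ k | a k. True}"

definition GL_over :: "rat set \<Rightarrow> 'n::finite qmat set" where
  "GL_over R = {A. (\<forall>i j. A $ i $ j \<in> R) \<and>
     (\<exists>B. (\<forall>i j. B $ i $ j \<in> R) \<and> A ** B = mat 1 \<and> B ** A = mat 1)}"

text \<open>
  The index set \<open>{1..n}\<close> is a finite linearly ordered type, whose least element stands for \<open>1\<close>.
\<close>

definition first :: "'n::{finite,linorder}" where
  "first = Min UNIV"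

definition Gamma_l :: "nat \<Rightarrow> 'n::{finite,linorder} qmat set" where
  "Gamma_l l = {A \<in> GL_over (Z_loc l). \<forall>i. i \<noteq> first \<longrightarrow> (\<exists>c\<in>Z_loc l. A $ i $ first = of_nat l * c)}"

definition Gamma_lp :: "nat \<Rightarrow> nat \<Rightarrow> 'n::{finite,linorder} qmat set" where
  "Gamma_lp l p = Gamma_l l \<inter> GL_over (Z_inv p)"

definition pi_mat :: "nat \<Rightarrow> 'n::{finite,linorder} qmat" where
  "pi_mat l = (\<chi> i j. if i = j then (if i = first then of_nat l else 1) else 0)"

definition first_columns :: "('n \<Rightarrow> 'n qmat) \<Rightarrow> 'n::{finite,linorder} qmat" where
  "first_columns A = (\<chi> i j. A j $ i $ first)"

definition sigma_l :: "nat \<Rightarrow> 'n qmat \<Rightarrow> 'n::{finite,linorder} qmat" where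
  "sigma_l l \<sigma> = (\<chi> i j. (pi_mat l ** \<sigma>) $ i $ j / of_nat l)"

text \<open>
  The sums over \<open>\<int>\<^sup>n/\<sigma>\<int>\<^sup>n\<close> and \<open>\<int>\<^sup>n/\<sigma>\<^sub>l\<int>\<^sup>n\<close> below only make sense for integral matrices,
  whereas the entries of \<open>\<sigma>\<close> may have denominators prime to \<open>l\<close>. So \<open>\<sigma>\<close>
  is first multiplied by its least common denominator. This leaves an integral \<open>\<sigma>\<close> unchanged, and for
  integral \<open>\<sigma>\<close> the cocycle does not change when \<open>\<sigma>\<close> is multiplied by a positive integer prime to \<open>l\<close>.
\<close>

definition common_denom :: "'n::finite qmat \<Rightarrow> nat" where
  "common_denom M = (LEAST N. N > 0 \<and> (\<forall>i j. of_nat N * M $ i $ j \<in> \<int>))"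

definition clear_denoms :: "'n::finite qmat \<Rightarrow> 'n qmat" where
  "clear_denoms M = (\<chi> i j. of_nat (common_denom M) * M $ i $ j)"


section \<open>The smoothed cocycle\<close>

definition bernoulli_poly :: "nat \<Rightarrow> 'a::field_char_0 \<Rightarrow> 'a" where
  "bernoulli_poly k y = fact k * fps_nth (fps_X / (fps_exp 1 - 1) * fps_exp y) k"

definition periodic_bernoulli :: "nat \<Rightarrow> 'a::floor_ceiling \<Rightarrow> 'a" where
  "periodic_bernoulli k y =
     (if k = 1 then (if y \<in> \<int> then 0 else frac y - 1 / 2) else bernoulli_poly k (frac y))"

text \<open>The floor merely turns the real number \<open>sgn Q\<^sub>i\<^sub>j\<close> into an integer.\<close>

definition bernoulli_tuple :: "('n::finite \<Rightarrow> nat) \<Rightarrow> 'a::floor_ceiling^'n \<Rightarrow> ('n, 'm::finite) forms \<Rightarrow> 'a" where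
  "bernoulli_tuple e w Q =
     (let J = {j. e j = 1 \<and> w $ j \<in> \<int>} in
      (\<Sum>i\<in>UNIV. (\<Prod>j\<in>J. of_int \<lfloor>sgn (Q $ i $ j)\<rfloor> / 2) * (\<Prod>j\<in>- J. periodic_bernoulli (e j) (w $ j)))
      / of_nat CARD('m))"

definition of_int_vec :: "int^'n \<Rightarrow> 'a::ring_1^'n" where
  "of_int_vec x = (\<chi> i. of_int (x $ i))"

definition of_rat_vec :: "'n::finite qvec \<Rightarrow> 'a::field_char_0^'n" where
  "of_rat_vec x = (\<chi> i. of_rat (x $ i))"

definition lattice_rel :: "'n::finite qmat \<Rightarrow> ((int^'n) \<times> (int^'n)) set" where
  "lattice_rel M = {(x, y). \<exists>z :: int^'n. of_int_vec (x - y) = M *v of_int_vec z}"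

text \<open>
  The sum over \<open>\<int>\<^sup>n/M\<int>\<^sup>n\<close>, for \<open>f\<close> constant on cosets.
\<close>

definition coset_sum :: "'n::finite qmat \<Rightarrow> (int^'n \<Rightarrow> 'b::comm_monoid_add) \<Rightarrow> 'b" where
  "coset_sum M f = (\<Sum>C\<in>UNIV // lattice_rel M. f (SOME x. x \<in> C))"

definition D_l :: "nat \<Rightarrow> 'n qmat \<Rightarrow> ('n::{finite,linorder} \<Rightarrow> nat) \<Rightarrow> ('n, 'm::finite) forms \<Rightarrow> 'n qvec \<Rightarrow> rat" where
  "D_l l \<sigma> e Q v =
     (if det \<sigma> = 0 then 0 else
        coset_sum (sigma_l l \<sigma>) (\<lambda>x. bernoulli_tuple e
          (matrix_inv (sigma_l l \<sigma>) *v (of_int_vec x + pi_mat l *v v)) (forms_act (matrix_inv \<sigma>) Q))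
        - of_nat l powi (1 - int CARD('n) + int (\<Sum>j\<in>UNIV. e j)) *
          coset_sum \<sigma> (\<lambda>x. bernoulli_tuple e
            (matrix_inv \<sigma> *v (of_int_vec x + v)) (forms_act (matrix_inv \<sigma>) Q)))"

definition Psi_homogeneous ::
    "nat \<Rightarrow> 'n qmat \<Rightarrow> nat \<Rightarrow> 'n::{finite,linorder} qpoly \<Rightarrow> ('n, 'm::finite) forms \<Rightarrow> 'n qvec \<Rightarrow> rat" where
  "Psi_homogeneous l \<sigma> d P Q v =
     (- 1) ^ CARD('n) * sgn (det \<sigma>) *
     (\<Sum>r | total r = d. transform_coeff P r \<sigma>
        / ((\<Prod>j\<in>UNIV. fact (Poly_Mapping.lookup r j + 1)) * of_nat l ^ total r)
        * D_l l \<sigma> (\<lambda>j. 1 + Poly_Mapping.lookup r j) Q v)"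

definition Psi_l ::
    "nat \<Rightarrow> ('n::{finite,linorder} \<Rightarrow> 'n qmat) \<Rightarrow> 'n qpoly \<Rightarrow> ('n, 'm::finite) forms \<Rightarrow> 'n qvec \<Rightarrow> rat" where
  "Psi_l l A P Q v =
     (let \<sigma> = clear_denoms (first_columns A) in
      \<Sum>d\<in>total ` Poly_Mapping.keys P. Psi_homogeneous l \<sigma> d (homogeneous_part d P) Q v)"


section \<open>The measure\<close>

definition X_set :: "('p::prime_card padic^'n) set" where
  "X_set = {x. \<forall>i. x $ i \<in> padic_ints}"

definition X_coset :: "'n::finite qvec \<Rightarrow> ('p::prime_card padic^'n) set" where
  "X_coset v = (\<lambda>x. of_rat_vec v + x) ` X_set"

definition padic_ball :: "'n::finite qvec \<Rightarrow> int^'n \<Rightarrow> nat \<Rightarrow> ('p::prime_card padic^'n) set" where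
  "padic_ball v a k = (\<lambda>x. of_rat_vec v + of_int_vec a + of_nat CARD('p) ^ k *s x) ` X_set"

definition mu_l ::
    "nat \<Rightarrow> ('n::{finite,linorder} \<Rightarrow> 'n qmat) \<Rightarrow> ('n, 'm::finite) forms \<Rightarrow> 'n qvec
       \<Rightarrow> ('p::prime_card padic, 'n) vec set \<Rightarrow> 'p padic" where
  "mu_l l A Q v =
     (if det (first_columns A) = 0 then (\<lambda>_. 0) else
      (THE \<mu>. padic_measure (X_coset v) {x. of_nat CARD('m) * x \<in> padic_ints} \<mu> \<and>
         (\<forall>a k. \<mu> (padic_ball v a k) =
            of_rat (Psi_l l A 1 Q (\<chi> i. (v $ i + of_int (a $ i)) / of_nat CARD('p) ^ k)))))"

end

theory Submission
  imports Defs
begin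

text \<open>
  The signs of the coefficients of \<open>\<sigma>\<inverse>Q\<close> are never \<open>0\<close>, so \<open>\<^bold>B\<^sub>e(w, \<sigma>\<inverse>Q)\<close> is an average of
  products of Bernoulli polynomials in fractional parts, taken in \<open>[0, 1)\<close> or in \<open>(0, 1]\<close> depending on
  the sign. The distribution relation of the Bernoulli polynomials then writes \<open>\<^bold>D\<^sub>l\<close> as a single sum
  over \<open>\<int>\<^sup>n/\<pi>\<^sub>l\<sigma>\<int>\<^sup>n\<close> with the weight \<open>1 - l\<cdot>[l | x\<^sub>1]\<close>. Since the first row of \<open>\<sigma>\<close> is prime to
  \<open>l\<close>, this weight has mean zero in every coordinate direction of \<open>\<int>\<^sup>n/l\<int>\<^sup>n\<close>, which turns each factor
  \<open>B\<^sub>r\<^sub>+\<^sub>1((y + c)/l)\<close> into a difference \<open>B\<^sub>r\<^sub>+\<^sub>1((y + c)/l) - B\<^sub>r\<^sub>+\<^sub>1(y/l)\<close>. Up to normalisation this difference is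
  \<open>(c/l) y\<^sup>r\<close> plus terms of lower degree in \<open>y\<close>: for \<open>r = 0\<close> this gives the integrality of the measure, and in
  general the congruence \<open>p\<^sup>k\<^sup>d \<Psi>\<^sub>l(P, (v + a)/p\<^sup>k) \<equiv> P(v + a) \<Psi>\<^sub>l(1, (v + a)/p\<^sup>k)\<close> modulo a bounded multiple
  of \<open>p\<^sup>k\<close>, for \<open>P\<close> homogeneous of degree \<open>d\<close>. Summing over \<open>a\<close> and using the distribution relation for
  \<open>\<Psi>\<^sub>l(P, v)\<close> identifies the integral as the limit of its Riemann sums.
\<close>

text \<open>At w = (v + a)/p^k the fractional parts y can have denominators of size p^k. A factor
  B_{r+1} has degree r + 1 in y, but p^{kd} supplies only r powers of p^k for that coordinate, so
  without the smoothing each coordinate would lose a factor p^k. The weight lowers the degree by one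
  in all coordinates at once. That y is only a fractional part does no harm: it differs from a
  coordinate of sigma_l^{-1}(x + pi_l w) by an integer, so p^k y equals l times a coordinate of
  sigma^{-1}(v + a) up to a bounded multiple of p^k. The integers c of the leading coefficients do
  not depend on r, so their products add up to the sum that is D_l at r = 0. The bounds are uniform
  in k and a because x runs over the finitely many classes modulo sigma_l, and the ultrametric
  inequality preserves them in sums of p^{kn} terms. The condition l \<noteq> p enters twice: powers
  of l are p-adic units, and multiplication by p preserves divisibility by l and hence the
  weight.\<close>

no_notation fps_nth (infixl "$" 75)

section \<open>Bernoulli polynomials\<close>

text \<open>The generating function of the \<open>bernoulli_poly k y / fact k\<close>; identities
  are proved after multiplication by e^T - 1, which can be cancelled.\<close>

definition bernoulli_fps :: "'a::field_char_0 \<Rightarrow> 'a fps" where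
  "bernoulli_fps y = fps_X / (fps_exp 1 - 1) * fps_exp y"

lemma bernoulli_fps_nth: "fps_nth (bernoulli_fps y) k = bernoulli_poly k y / fact k"
  by (simp add: bernoulli_poly_def bernoulli_fps_def)

lemma fps_exp_minus_1_nz: "fps_exp c - 1 \<noteq> (0 :: 'a::field_char_0 fps)" if "c \<noteq> 0"
  using that by (metis fps_exp_0 fps_exp_eq_iff right_minus_eq)

text \<open>The quotient in the definition is exact: e^T - 1 has order 1, just like T, so it divides
  T as a power series.\<close>

lemma bernoulli_fps_times: "bernoulli_fps y * (fps_exp 1 - 1) = fps_X * fps_exp (y :: 'a::field_char_0)"
proof -
  let ?E = "fps_exp 1 - 1 :: 'a fps"
  have "subdegree ?E = 1" by (rule subdegreeI) auto
  then have "?E dvd fps_X"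
    using fps_exp_minus_1_nz[of "1::'a"] by (simp add: fps_dvd_iff)
  then have "fps_X / ?E * ?E = fps_X" by simp
  then show ?thesis unfolding bernoulli_fps_def
    by (metis (no_types, lifting) mult.assoc mult.commute)
qed

lemma bernoulli_poly_0 [simp]: "bernoulli_poly 0 (y :: 'a::field_char_0) = 1"
proof -
  have "fps_nth (bernoulli_fps y * (fps_exp 1 - 1)) 1 = 1"
    unfolding bernoulli_fps_times by simp
  then show ?thesis by (simp add: fps_mult_nth bernoulli_fps_nth)
qed

lemma bernoulli_fps_add: "bernoulli_fps (x + y) = bernoulli_fps x * fps_exp (y :: 'a::field_char_0)"
  by (simp add: bernoulli_fps_def fps_exp_add_mult mult.assoc)

lemma bernoulli_poly_add:
  "bernoulli_poly k (x + y :: 'a::field_char_0)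
     = (\<Sum>i\<le>k. of_nat (k choose i) * bernoulli_poly (k - i) x * y ^ i)"
proof -
  have "bernoulli_poly k (x + y) = fact k * fps_nth (fps_exp y * bernoulli_fps x) k"
    by (simp add: bernoulli_fps_add[symmetric] bernoulli_fps_nth mult.commute[of "fps_exp y"])
  also have "\<dots> = (\<Sum>i\<le>k. fact k * (y ^ i / fact i * (bernoulli_poly (k - i) x / fact (k - i))))"
    by (simp add: fps_mult_nth bernoulli_fps_nth sum_distrib_left atLeast0AtMost)
  also have "\<dots> = (\<Sum>i\<le>k. of_nat (k choose i) * bernoulli_poly (k - i) x * y ^ i)"
    by (intro sum.cong) (auto simp: binomial_fact)
  finally show ?thesis .
qed

lemma bernoulli_poly_1: "bernoulli_poly 1 (y :: 'a::field_char_0) = y - 1 / 2"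
proof -
  have "fps_nth (bernoulli_fps y * (fps_exp 1 - 1)) 2 = y"
    unfolding bernoulli_fps_times by (simp add: numeral_2_eq_2)
  then have "2 + bernoulli_poly 1 y * 4 = y * 4"
    by (simp add: fps_mult_nth bernoulli_fps_nth numeral_2_eq_2 field_simps)
  then have "2 * (1 + bernoulli_poly 1 y * 2) = 2 * (y * 2)" by (simp add: algebra_simps)
  then have "1 + bernoulli_poly 1 y * 2 = y * 2" by (simp only: mult_cancel_left) simp
  then show ?thesis by (simp add: field_simps)
qed

text \<open>The generating functions at 1 and 0 differ by T, so only degree 1 can tell which end of
  the unit interval represents an integer.\<close>

lemma bernoulli_poly_at_1:
  assumes "k \<noteq> 1"
  shows "bernoulli_poly k (1 :: 'a::field_char_0) = bernoulli_poly k 0"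
proof -
  let ?E = "fps_exp 1 - 1 :: 'a fps"
  have "(bernoulli_fps 1 - bernoulli_fps 0) * ?E = fps_X * ?E"
    by (simp only: left_diff_distrib bernoulli_fps_times) (simp add: algebra_simps)
  then have "bernoulli_fps 1 - bernoulli_fps 0 = (fps_X :: 'a fps)"
    using fps_exp_minus_1_nz[of "1::'a"] by (metis mult_right_cancel zero_neq_one)
  then have "fps_nth (bernoulli_fps 1 - bernoulli_fps 0 :: 'a fps) k = 0"
    using assms by simp
  then show ?thesis by (simp add: bernoulli_fps_nth)
qed

text \<open>Substitute T/N into the generating function and factor e^T - 1 as e^{T/N} - 1 times the
  geometric sum of the e^{cT/N}, c < N.\<close>

lemma bernoulli_poly_multiplication:
  fixes y :: "'a::field_char_0"
  assumes "N > 0"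
  shows "of_nat N ^ k * (\<Sum>c<N. bernoulli_poly k ((y + of_nat c) / of_nat N)) = of_nat N * bernoulli_poly k y"
proof -
  define d where "d = (1 / of_nat N :: 'a)"
  have d: "of_nat N * d = 1" "d \<noteq> 0" using assms by (auto simp: d_def)
  let ?E = "fps_exp 1 - 1 :: 'a fps"
  let ?dX = "fps_const d * fps_X :: 'a fps"
  define G where "G = bernoulli_fps y oo ?dX"
  have G: "G * (fps_exp d - 1) = ?dX * fps_exp (y * d)"
  proof -
    have "(bernoulli_fps y * ?E) oo ?dX = (fps_X * fps_exp y) oo ?dX"
      by (simp only: bernoulli_fps_times)
    then show ?thesis
      by (simp add: fps_compose_mult_distrib fps_compose_sub_distrib G_def mult.commute[of y] del: fps_nth_compose_linear)
  qed
  have E: "?E = (fps_exp d - 1) * (\<Sum>c<N. fps_exp (of_nat c * d))"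
  proof -
    have *: "fps_exp 1 = (fps_exp d) ^ N" by (simp add: fps_exp_power_mult d)
    show ?thesis unfolding * power_diff_1_eq by (simp add: fps_exp_power_mult)
  qed
  have "(\<Sum>c<N. bernoulli_fps ((y + of_nat c) * d)) * ?E = (\<Sum>c<N. fps_X * fps_exp (y * d) * fps_exp (of_nat c * d))"
    by (simp add: sum_distrib_right bernoulli_fps_times distrib_right fps_exp_add_mult mult.assoc)
  also have "\<dots> = fps_const (of_nat N) * (fps_const d * fps_X) * fps_exp (y * d) * (\<Sum>c<N. fps_exp (of_nat c * d))"
    by (simp add: sum_distrib_left mult.assoc[symmetric] d)
  also have "\<dots> = fps_const (of_nat N) * G * ?E"
    unfolding E mult.assoc[of "fps_const (of_nat N)"] G[symmetric] by (simp only: mult.assoc)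
  finally have "(\<Sum>c<N. bernoulli_fps ((y + of_nat c) * d)) = fps_const (of_nat N) * G"
    using fps_exp_minus_1_nz[of "1::'a"] by (metis mult_right_cancel zero_neq_one)
  then have "fps_nth (\<Sum>c<N. bernoulli_fps ((y + of_nat c) * d)) k = fps_nth (fps_const (of_nat N) * G) k"
    by simp
  then have "(\<Sum>c<N. bernoulli_poly k ((y + of_nat c) * d)) = of_nat N * (d ^ k * bernoulli_poly k y)"
    by (simp add: fps_sum_nth bernoulli_fps_nth G_def fps_compose_linear
        flip: sum_divide_distrib)
  moreover have "of_nat N ^ k * d ^ k = 1" by (metis d(1) power_mult_distrib power_one)
  ultimately show ?thesis by (simp add: d_def algebra_simps)
qed

text \<open>The representative of t modulo 1 in (0,1] if \<open>b\<close> holds, in [0,1) otherwise.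
  With \<open>b\<close> the positivity of a coefficient, B_1 of this representative at an integer is
  sgn/2, which absorbs the exceptional set J of the definition.\<close>

definition frac_bi :: "bool \<Rightarrow> 'a::floor_ceiling \<Rightarrow> 'a" where
  "frac_bi b t = (if b then 1 - frac (- t) else frac t)"

definition unit_box :: "bool \<Rightarrow> 'a::floor_ceiling set" where
  "unit_box b = (if b then {0<..1} else {0..<1})"

lemma frac_bi_props: "frac_bi b t \<in> unit_box b" "t - frac_bi b t \<in> \<int>"
proof -
  show "frac_bi b t \<in> unit_box b"
    by (auto simp: frac_bi_def unit_box_def frac_lt_1 less_imp_le)
  have "t - (1 - frac (- t)) = of_int (- 1 - \<lfloor>- t\<rfloor>)" "t - frac t = of_int \<lfloor>t\<rfloor>"
    by (simp_all add: frac_def)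
  then show "t - frac_bi b t \<in> \<int>"
    unfolding frac_bi_def by (metis Ints_of_int)
qed

lemma frac_bi_unique: "frac_bi b t = s" if "s \<in> unit_box b" "t - s \<in> \<int>" for t s :: "'a::floor_ceiling"
proof -
  have "frac_bi b t - s \<in> \<int>"
    using Ints_diff[OF that(2) frac_bi_props(2)[of t b]] by simp
  then obtain k where k: "frac_bi b t - s = of_int k" by (auto elim: Ints_cases)
  have "- 1 < frac_bi b t - s" "frac_bi b t - s < 1"
    using frac_bi_props(1)[of b t] that(1) by (auto simp: unit_box_def split: if_splits)
  then have "of_int (-1) < (of_int k :: 'a)" "of_int k < (of_int 1 :: 'a)" unfolding k by auto
  then have "k = 0" unfolding of_int_less_iff by linarith
  then show ?thesis using k by simp
qed

definition bernoulli_bi :: "bool \<Rightarrow> nat \<Rightarrow> 'a::floor_ceiling \<Rightarrow> 'a" where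
  "bernoulli_bi b e t = bernoulli_poly e (frac_bi b t)"

lemma frac_bi_cong: "s - t \<in> \<int> \<Longrightarrow> frac_bi b s = frac_bi b t" for s t :: "'a::floor_ceiling"
  using frac_bi_props[where b=b and t=t] Ints_add[of "s - t" "t - frac_bi b t"]
  by (intro frac_bi_unique) auto

lemma bernoulli_bi_cong: "s - t \<in> \<int> \<Longrightarrow> bernoulli_bi b e s = bernoulli_bi b e t"
  by (simp add: bernoulli_bi_def frac_bi_cong)

lemma sum_residues_shift:
  fixes F :: "int \<Rightarrow> 'b::comm_monoid_add"
  assumes "N > 0"
  shows "(\<Sum>c\<in>{0..<int N}. F ((n + c) mod int N)) = (\<Sum>c\<in>{0..<int N}. F c)"
proof (rule sum.reindex_bij_witness[where i = "\<lambda>c. (c - n) mod int N" and j = "\<lambda>c. (n + c) mod int N"])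
  fix c assume "c \<in> {0..<int N}"
  then show "((n + c) mod int N - n) mod int N = c" "(n + (c - n) mod int N) mod int N = c"
    by (auto simp: mod_simps)
qed (use assms in auto)

text \<open>If y lies in one of the half-open unit intervals and m in {0..N-1}, then (y + m)/N lies
  in the same interval, whichever endpoint it contains.\<close>

lemma frac_bi_divide:
  assumes "N > 0" "t - frac_bi b t = of_int n"
  shows "frac_bi b ((t + of_int c) / of_nat N :: 'a::floor_ceiling)
    = (frac_bi b t + of_int ((n + c) mod int N)) / of_nat N"
proof (rule frac_bi_unique)
  let ?y = "frac_bi b t" and ?m = "(n + c) mod int N"
  have N: "of_nat N > (0::'a)" using assms by simp
  \<comment> \<open>The bound N - 1, not merely a strict bound by N, is what the closed end of (0,1]
    requires: there y may equal 1.\<close>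
  have m: "0 \<le> ?m" "?m \<le> int N - 1" using assms by (auto simp: zle_diff1_eq)
  have m': "0 \<le> (of_int ?m :: 'a)" "of_int ?m \<le> (of_nat N - 1 :: 'a)"
    using m(1) m(2)[folded of_int_le_iff[where 'a = 'a]] by simp_all
  show "(?y + of_int ?m) / of_nat N \<in> unit_box b"
    using frac_bi_props(1)[of b t] m' N
    by (cases b) (auto simp: unit_box_def divide_simps intro: add_pos_nonneg)
  have "t = ?y + of_int n" using assms(2) by (simp add: algebra_simps)
  then have "(t + of_int c) - (?y + of_int ?m) = of_int (n + c - ?m)" by simp
  also have "n + c - ?m = int N * ((n + c) div int N)" by (simp add: minus_mod_eq_mult_div)
  finally have "(t + of_int c) / of_nat N - (?y + of_int ?m) / of_nat N = of_int ((n + c) div int N)"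
    using N by (simp flip: diff_divide_distrib)
  then show "(t + of_int c) / of_nat N - (?y + of_int ?m) / of_nat N \<in> \<int>" by simp
qed

lemma bernoulli_bi_multiplication:
  fixes t :: "'a::floor_ceiling"
  assumes "N > 0"
  shows "of_nat N ^ e * (\<Sum>c\<in>{0..<int N}. bernoulli_bi b e ((t + of_int c) / of_nat N))
    = of_nat N * bernoulli_bi b e t"
proof -
  obtain n where n: "t - frac_bi b t = of_int n" using frac_bi_props(2)[of t b] by (auto elim: Ints_cases)
  have "(\<Sum>c\<in>{0..<int N}. bernoulli_bi b e ((t + of_int c) / of_nat N))
    = (\<Sum>c\<in>{0..<int N}. bernoulli_poly e ((frac_bi b t + of_int ((n + c) mod int N)) / of_nat N))"
    by (simp add: bernoulli_bi_def frac_bi_divide[OF assms n])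
  also have "\<dots> = (\<Sum>c\<in>{0..<int N}. bernoulli_poly e ((frac_bi b t + of_int c) / of_nat N))"
    by (rule sum_residues_shift[OF assms])
  also have "\<dots> = (\<Sum>c<N. bernoulli_poly e ((frac_bi b t + of_nat c) / of_nat N))"
    by (rule sum.reindex_bij_witness[where i = int and j = nat]) auto
  finally show ?thesis
    using bernoulli_poly_multiplication[OF assms, of e "frac_bi b t"] by (simp add: bernoulli_bi_def)
qed

text \<open>The two representatives differ only at integers, where they are 0 and 1; there Bernoulli
  polynomials of degree other than 1 agree, and B_1 gives -1/2 or 1/2.\<close>

lemma bernoulli_bi_eq:
  assumes "e \<noteq> 0"
  shows "bernoulli_bi b e t = (if e = 1 \<and> t \<in> \<int> then (if b then 1 / 2 else - 1 / 2) else periodic_bernoulli e t)"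
proof (cases "t \<in> \<int>")
  case True
  then have [simp]: "frac t = 0" "frac (- t) = 0" by (auto simp: frac_eq_0_iff)
  have "frac_bi b t = (if b then 1 else 0)" by (auto simp: frac_bi_def)
  then show ?thesis using True bernoulli_poly_at_1[of e]
    by (auto simp: bernoulli_bi_def bernoulli_poly_1[unfolded One_nat_def] periodic_bernoulli_def)
next
  case False
  then have "frac_bi b t = frac t" by (auto simp: frac_bi_def frac_neg)
  then show ?thesis using False
    by (auto simp: bernoulli_bi_def bernoulli_poly_1[unfolded One_nat_def] periodic_bernoulli_def)
qed

section \<open>Cosets of integer lattices\<close>

definition residue_vecs :: "nat \<Rightarrow> (int^'n) set" where
  "residue_vecs N = {c. \<forall>j. 0 \<le> c $ j \<and> c $ j < int N}"

lemma bij_betw_residue_vecs: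
  "bij_betw (\<lambda>g. \<chi> j::'n::finite. g j) (PiE UNIV (\<lambda>_. {0..<int N})) (residue_vecs N)"
  by (rule bij_betw_byWitness[where f' = "\<lambda>(c::int^'n) j. c $ j"]) (auto simp: residue_vecs_def PiE_iff)

lemma finite_residue_vecs [simp]: "finite (residue_vecs N :: (int^'n::finite) set)"
  using bij_betw_finite[OF bij_betw_residue_vecs[where 'n = 'n]] by (simp add: finite_PiE)

lemma sum_residue_vecs_prod:
  fixes h :: "'n::finite \<Rightarrow> int \<Rightarrow> 'b::comm_semiring_1"
  shows "(\<Sum>c\<in>residue_vecs N. \<Prod>j\<in>UNIV. h j (c $ j)) = (\<Prod>j\<in>UNIV. \<Sum>z\<in>{0..<int N}. h j z)"
  using sum.reindex_bij_betw[OF bij_betw_residue_vecs[where 'n = 'n], of "\<lambda>c. \<Prod>j\<in>UNIV. h j (c $ j)" N]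
  by (simp add: prod_sum_PiE)

section \<open>Integral matrices and the lattices spanned by their columns\<close>

definition of_int_mat :: "int^'n^'m \<Rightarrow> 'a::ring_1^'n^'m" where
  "of_int_mat S = (\<chi> i j. of_int (S $ i $ j))"

lemma of_int_mat_nth [simp]: "of_int_mat S $ i $ j = of_int (S $ i $ j)"
  by (simp add: of_int_mat_def)

lemma of_int_vec_nth [simp]: "of_int_vec x $ i = of_int (x $ i)"
  by (simp add: of_int_vec_def)

lemma of_int_vec_add: "of_int_vec (x + y) = of_int_vec x + of_int_vec y"
  by (simp add: vec_eq_iff)

lemma of_int_vec_eq_iff [simp]: "(of_int_vec x :: 'a::ring_char_0^'n) = of_int_vec y \<longleftrightarrow> x = y"
  by (simp add: vec_eq_iff)

lemma of_int_mat_vector: "of_int_mat S *v of_int_vec z = of_int_vec (S *v z)"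
  by (simp add: vec_eq_iff matrix_vector_mult_def)

lemma of_int_mat_mult: "of_int_mat (S ** R) = of_int_mat S ** of_int_mat R"
  by (simp add: vec_eq_iff matrix_matrix_mult_def)

lemma of_int_mat_mat: "of_int_mat (mat N) = mat (of_int N)"
  by (simp add: vec_eq_iff mat_def)

lemma mat_vector: "mat (k :: 'a::semiring_1) *v x = k *s x"
  by (simp add: vec_eq_iff matrix_vector_mult_def mat_def if_distrib[of "\<lambda>x. x * _"] cong: if_cong)

lemma mat_times_commute: "mat (k :: 'a::comm_semiring_1) ** S = S ** mat k"
  by (simp add: vec_eq_iff matrix_matrix_mult_def mat_def mult.commute if_distrib[of "\<lambda>x. x * _"] 
      if_distrib[of "\<lambda>x. _ * x"] cong: if_cong)

text \<open>The relation \<open>lattice_rel\<close> of an integral matrix, without the passage to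
  rational vectors.\<close>

definition column_rel :: "int^'n^'n \<Rightarrow> ((int^'n) \<times> (int^'n)) set" where
  "column_rel S = {(x, y). \<exists>z. x - y = S *v z}"

lemma lattice_rel_of_int_mat: "lattice_rel (of_int_mat S) = column_rel S"
  by (simp add: lattice_rel_def column_rel_def of_int_mat_vector)

lemma equiv_column_rel: "equiv UNIV (column_rel S)"
proof (rule equivI)
  show "refl (column_rel S)"
    by (auto simp: refl_on_def column_rel_def intro: exI[of _ 0])
  show "sym (column_rel S)"
  proof (rule symI)
    fix x y assume "(x, y) \<in> column_rel S"
    then obtain z where "x - y = S *v z" by (auto simp: column_rel_def)
    then have "y - x = S *v (0 - z)"
      by (simp only: matrix_vector_mult_diff_distrib) (simp add: algebra_simps)
    then show "(y, x) \<in> column_rel S" unfolding column_rel_def by blast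
  qed
  show "trans (column_rel S)"
  proof (rule transI)
    fix x y w assume "(x, y) \<in> column_rel S" "(y, w) \<in> column_rel S"
    then obtain z z' where "x - y = S *v z" "y - w = S *v z'" by (auto simp: column_rel_def)
    then have "x - w = S *v (z + z')"
      by (simp only: matrix_vector_right_distrib) (simp add: algebra_simps flip: \<open>x - y = S *v z\<close> \<open>y - w = S *v z'\<close>)
    then show "(x, w) \<in> column_rel S" unfolding column_rel_def by blast
  qed
qed simp

text \<open>A system of representatives given as a family \<open>h\<close> over an index set
  \<open>T\<close>, so that boxes of residues, sets of cosets and products of index sets can all
  serve as indices.\<close>

definition transversal :: "('a \<times> 'a) set \<Rightarrow> 's set \<Rightarrow> ('s \<Rightarrow> 'a) \<Rightarrow> bool" where
  "transversal r T h \<longleftrightarrow> finite T \<and> (\<forall>x. \<exists>!t. t \<in> T \<and> (h t, x) \<in> r)"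

text \<open>Each member of one family is matched with the unique member of the other in its
  class.\<close>

lemma sum_transversal:
  fixes F :: "'a \<Rightarrow> 'b::comm_monoid_add"
  assumes "equiv UNIV r" "transversal r T h" "transversal r T' h'"
    and F: "\<And>x y. (x, y) \<in> r \<Longrightarrow> F x = F y"
  shows "(\<Sum>t\<in>T. F (h t)) = (\<Sum>t\<in>T'. F (h' t))"
proof -
  have sym: "(y, x) \<in> r" if "(x, y) \<in> r" for x y
    using assms(1) that by (meson equiv_def symE)
  obtain i where i: "\<And>x. i x \<in> T \<and> (h (i x), x) \<in> r" "\<And>x t. t \<in> T \<Longrightarrow> (h t, x) \<in> r \<Longrightarrow> t = i x"
    using assms(2) unfolding transversal_def by metis
  obtain j where j: "\<And>x. j x \<in> T' \<and> (h' (j x), x) \<in> r" "\<And>x t. t \<in> T' \<Longrightarrow> (h' t, x) \<in> r \<Longrightarrow> t = j x"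
    using assms(3) unfolding transversal_def by metis
  show ?thesis
  proof (rule sum.reindex_bij_witness[where i = "\<lambda>t. i (h' t)" and j = "\<lambda>t. j (h t)"])
    fix t assume "t \<in> T"
    then show "i (h' (j (h t))) = t" "j (h t) \<in> T'" "F (h' (j (h t))) = F (h t)"
      using i(2) j(1) sym F by metis+
  next
    fix t assume "t \<in> T'"
    then show "j (h (i (h' t))) = t" "i (h' t) \<in> T"
      using j(2) i(1) sym by metis+
  qed
qed

text \<open>This is the system of representatives built into \<open>coset_sum\<close>.\<close>

lemma transversal_quotient:
  assumes r: "equiv UNIV r" and fin: "finite (UNIV // r)"
  shows "transversal r (UNIV // r) (\<lambda>C. SOME x. x \<in> C)"
  unfolding transversal_def
proof (rule conjI[OF fin], rule allI)
  fix x
  have *: "r `` {x} \<in> UNIV // r" "x \<in> r `` {x}"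
    using equiv_class_self[OF r] by (auto intro: quotientI)
  have "(SOME y. y \<in> r `` {x}) \<in> r `` {x}" using *(2) by (rule someI)
  then have **: "r `` {x} \<in> UNIV // r \<and> ((SOME y. y \<in> r `` {x}), x) \<in> r"
    using r *(1) by (metis Image_singleton_iff equiv_def symE)
  show "\<exists>!C. C \<in> UNIV // r \<and> ((SOME x. x \<in> C), x) \<in> r"
  proof (rule ex1I, rule **)
    fix C assume C: "C \<in> UNIV // r \<and> ((SOME x. x \<in> C), x) \<in> r"
    then obtain y where y: "C = r `` {y}" by (auto elim: quotientE)
    have "(SOME x. x \<in> C) \<in> C"
      using equiv_class_self[OF r] y by (intro someI[of "\<lambda>x. x \<in> C" y]) auto
    then have "(y, SOME x. x \<in> C) \<in> r" using y by auto
    then have "(y, x) \<in> r" using C r by (meson equiv_def transE)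
    then show "C = r `` {x}" unfolding y using r by (metis equiv_class_eq)
  qed
qed

lemma finite_quotient_transversal:
  assumes r: "equiv UNIV r" and T: "transversal r T h"
  shows "finite (UNIV // r)"
proof (rule finite_subset)
  show "finite ((\<lambda>t. r `` {h t}) ` T)" using T by (simp add: transversal_def)
  show "UNIV // r \<subseteq> (\<lambda>t. r `` {h t}) ` T"
  proof
    fix C assume "C \<in> UNIV // r"
    then obtain x where x: "C = r `` {x}" by (auto elim: quotientE)
    obtain t where "t \<in> T" "(h t, x) \<in> r" using T unfolding transversal_def by metis
    then show "C \<in> (\<lambda>t. r `` {h t}) ` T" using x equiv_class_eq[OF r] by blast
  qed
qed

lemma coset_sum_transversal:
  assumes T: "transversal (column_rel S) T h"
    and F: "\<And>x y. (x, y) \<in> column_rel S \<Longrightarrow> F x = F y"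
  shows "coset_sum (of_int_mat S) F = (\<Sum>t\<in>T. F (h t))"
proof -
  note r = equiv_column_rel[of S]
  note fin = finite_quotient_transversal[OF r T]
  show ?thesis unfolding coset_sum_def lattice_rel_of_int_mat
    by (rule sum_transversal[OF r transversal_quotient[OF r fin] T F])
qed

text \<open>Multiplication by the injective S identifies Z^n/RZ^n with SZ^n/SRZ^n, so the class of h
  t modulo S splits into the classes of h t + S (k u) modulo SR.\<close>

lemma transversal_mult:
  assumes T: "transversal (column_rel S) T h" and U: "transversal (column_rel R) U k"
    and inj: "inj ((*v) S)"
  shows "transversal (column_rel (S ** R)) (T \<times> U) (\<lambda>(t, u). h t + S *v k u)"
  unfolding transversal_def
proof (intro conjI allI)
  show "finite (T \<times> U)" using T U by (simp add: transversal_def)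
  fix x
  obtain t where t: "t \<in> T" "(h t, x) \<in> column_rel S" "\<And>t'. t' \<in> T \<Longrightarrow> (h t', x) \<in> column_rel S \<Longrightarrow> t' = t"
    using T unfolding transversal_def by metis
  obtain z where z: "h t - x = S *v z" using t(2) by (auto simp: column_rel_def)
  \<comment> \<open>The element u has to represent -z, since h t + S (k u) - x = S (k u + z) must
    lie in SRZ^n.\<close>
  obtain u where u: "u \<in> U" "(k u, - z) \<in> column_rel R" "\<And>u'. u' \<in> U \<Longrightarrow> (k u', - z) \<in> column_rel R \<Longrightarrow> u' = u"
    using U unfolding transversal_def by metis
  obtain z' where z': "k u + z = R *v z'" using u(2) by (auto simp: column_rel_def)
  show "\<exists>!tu. tu \<in> T \<times> U \<and> ((case tu of (t, u) \<Rightarrow> h t + S *v k u), x) \<in> column_rel (S ** R)"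
  proof (rule ex1I[of _ "(t, u)"])
    have "h t + S *v k u - x = S *v (k u + z)"
      by (simp only: matrix_vector_right_distrib z[symmetric]) simp
    also have "\<dots> = (S ** R) *v z'" by (simp add: z' matrix_vector_mul_assoc)
    finally have "(h t + S *v k u, x) \<in> column_rel (S ** R)"
      unfolding column_rel_def by blast
    then show "(t, u) \<in> T \<times> U \<and> ((case (t, u) of (t, u) \<Rightarrow> h t + S *v k u), x) \<in> column_rel (S ** R)"
      using t(1) u(1) by simp
  next
    fix tu assume "tu \<in> T \<times> U \<and> ((case tu of (t, u) \<Rightarrow> h t + S *v k u), x) \<in> column_rel (S ** R)"
    then obtain t' u' z'' where tu: "tu = (t', u')" "t' \<in> T" "u' \<in> U" "h t' + S *v k u' - x = (S ** R) *v z''"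
      by (cases tu) (auto simp: column_rel_def)
    have *: "h t' - x = S *v (R *v z'' - k u')"
      using tu(4) by (simp add: matrix_vector_mult_diff_distrib matrix_vector_mul_assoc eq_diff_eq diff_add_eq)
    then have "(h t', x) \<in> column_rel S" unfolding column_rel_def by blast
    then have "t' = t" using t(3) tu(2) by blast
    with * z have "S *v z = S *v (R *v z'' - k u')" by simp
    then have "z = R *v z'' - k u'" using inj by (simp add: inj_eq)
    then have "k u' - (- z) = R *v z''" by simp
    then have "(k u', - z) \<in> column_rel R" unfolding column_rel_def by blast
    then have "u' = u" using u(3) tu(3) by blast
    then show "tu = (t, u)" using tu(1) \<open>t' = t\<close> by simp
  qed
qed

lemma transversal_residue_vecs:
  assumes "N > 0"
  shows "transversal (column_rel (mat (int N) :: int^'n::finite^'n)) (residue_vecs N) (\<lambda>x. x)"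
  unfolding transversal_def
proof (intro conjI allI)
  fix x :: "int^'n"
  have rel: "(c, x) \<in> column_rel (mat (int N)) \<longleftrightarrow> (\<forall>j. c $ j mod int N = x $ j mod int N)" for c
  proof
    assume "\<forall>j. c $ j mod int N = x $ j mod int N"
    then have "\<forall>j. \<exists>z. c $ j - x $ j = int N * z" by (metis mod_eq_dvd_iff dvdE)
    then obtain z where "\<And>j. c $ j - x $ j = int N * z j" by metis
    then have "c - x = mat (int N) *v (\<chi> j. z j)" by (simp add: vec_eq_iff mat_vector)
    then show "(c, x) \<in> column_rel (mat (int N))" by (auto simp: column_rel_def)
  next
    assume "(c, x) \<in> column_rel (mat (int N))"
    then obtain z where "c - x = int N *s z" by (auto simp: column_rel_def mat_vector)
    then have "\<And>j. c $ j - x $ j = int N * z $ j" by (simp add: vec_eq_iff)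
    then show "\<forall>j. c $ j mod int N = x $ j mod int N" by (metis mod_eq_dvd_iff dvd_triv_left)
  qed
  show "\<exists>!c. c \<in> residue_vecs N \<and> (c, x) \<in> column_rel (mat (int N))"
    unfolding rel
  proof (rule ex1I[of _ "\<chi> j. x $ j mod int N"])
    show "(\<chi> j. x $ j mod int N) \<in> residue_vecs N \<and>
      (\<forall>j. (\<chi> j. x $ j mod int N) $ j mod int N = x $ j mod int N)"
      using assms by (simp add: residue_vecs_def)
    fix c assume "c \<in> residue_vecs N \<and> (\<forall>j. c $ j mod int N = x $ j mod int N)"
    then show "c = (\<chi> j. x $ j mod int N)"
      unfolding residue_vecs_def vec_eq_iff vec_lambda_beta mem_Collect_eq
      by (metis mod_pos_pos_trivial)
  qed
qed simp

lemma matrix_inv: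
  fixes A :: "'a::field^'n^'n"
  assumes "det A \<noteq> 0"
  shows "A ** matrix_inv A = mat 1" "matrix_inv A ** A = mat 1"
proof -
  have "\<exists>B. A ** B = mat 1 \<and> B ** A = mat 1"
    using assms by (simp add: invertible_det_nz[symmetric] invertible_def)
  then have "A ** matrix_inv A = mat 1 \<and> matrix_inv A ** A = mat 1"
    unfolding matrix_inv_def by (rule someI_ex)
  then show "A ** matrix_inv A = mat 1" "matrix_inv A ** A = mat 1" by auto
qed

lemma inj_of_int_mat:
  assumes "det (of_int_mat S :: rat^'n::finite^'n) \<noteq> 0"
  shows "inj ((*v) S)"
proof (rule injI)
  let ?A = "of_int_mat S :: rat^'n^'n"
  fix x y assume "S *v x = S *v y"
  then have "?A *v of_int_vec x = ?A *v of_int_vec y" by (simp add: of_int_mat_vector)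
  then have "matrix_inv ?A *v (?A *v of_int_vec x) = matrix_inv ?A *v (?A *v of_int_vec y)" by simp
  then have "(of_int_vec x :: rat^'n) = of_int_vec y"
    by (simp add: matrix_vector_mul_assoc matrix_inv[OF assms])
  then show "x = y" by simp
qed

lemma common_denominator:
  fixes B :: "'a::finite \<Rightarrow> rat"
  obtains N :: int and b where "N > 0" "\<And>i. of_int N * B i = of_int (b i)"
proof -
  have "\<exists>d>0. \<exists>b. of_int d * B i = of_int b" for i
  proof -
    obtain a d where ad: "quotient_of (B i) = (a, d)" by fastforce
    then have "of_int d * B i = of_int a" "d > 0"
      using quotient_of_div[OF ad] quotient_of_denom_pos[OF ad] by auto
    then show ?thesis by blast
  qed
  then obtain d where d: "\<And>i. d i > 0" "\<And>i. \<exists>b. of_int (d i) * B i = of_int b" by metis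
  have "\<exists>b. of_int (prod d UNIV) * B i = of_int b" for i
  proof -
    obtain b where b: "of_int (d i) * B i = of_int b" using d by blast
    have "of_int (prod d UNIV) * B i = of_int (prod d (UNIV - {i}) * b)"
      by (simp add: prod.remove[of UNIV i d] b[symmetric])
    then show ?thesis by blast
  qed
  moreover have "prod d UNIV > 0" using d by (intro prod_pos) auto
  ultimately show ?thesis using that by metis
qed

text \<open>Clearing denominators in the inverse of S gives an integral R with S R = N. Hence NZ^n
  lies in SZ^n, and the finitely many residues modulo N meet every class modulo S.\<close>

lemma exists_transversal:
  assumes nz: "det (of_int_mat S :: rat^'n::finite^'n) \<noteq> 0"
  obtains T :: "(int^'n) set set" and h where "transversal (column_rel S) T h"
proof -
  let ?A = "of_int_mat S :: rat^'n^'n"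
  obtain N b where N: "N > 0" "\<And>ij. of_int N * (case ij of (i, j) \<Rightarrow> matrix_inv ?A $ i $ j) = of_int (b ij)"
    using common_denominator[of "\<lambda>(i, j). matrix_inv ?A $ i $ j"] by metis
  define R :: "int^'n^'n" where "R = (\<chi> i j. b (i, j))"
  have "of_int_mat R = mat (of_int N) ** matrix_inv ?A"
    using N(2)[of "(_, _)"]
    by (simp add: vec_eq_iff R_def matrix_matrix_mult_def mat_def if_distrib[of "\<lambda>x. x * _"] cong: if_cong)
  then have "?A ** of_int_mat R = mat (of_int N) ** (?A ** matrix_inv ?A)"
    by (metis mat_times_commute matrix_mul_assoc)
  then have "(of_int_mat (S ** R) :: rat^'n^'n) = of_int_mat (mat N)"
    by (simp add: of_int_mat_mult matrix_inv[OF assms] of_int_mat_mat)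
  then have SR: "S ** R = mat N" by (simp add: vec_eq_iff)
  have sub: "column_rel (mat N) \<subseteq> column_rel S"
    unfolding column_rel_def SR[symmetric] by (auto simp flip: matrix_vector_mul_assoc)
  note r = equiv_column_rel[of S]
  have "finite (UNIV // column_rel S)"
  proof (rule finite_subset)
    show "finite ((\<lambda>c. column_rel S `` {c}) ` residue_vecs (nat N))" by simp
    show "UNIV // column_rel S \<subseteq> (\<lambda>c. column_rel S `` {c}) ` residue_vecs (nat N)"
    proof
      fix C assume "C \<in> UNIV // column_rel S"
      then obtain x where x: "C = column_rel S `` {x}" by (auto elim: quotientE)
      obtain c where "c \<in> residue_vecs (nat N)" "(c, x) \<in> column_rel (mat N)"
        using transversal_residue_vecs[of "nat N", where 'n = 'n] N(1) unfolding transversal_def by force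
      then show "C \<in> (\<lambda>c. column_rel S `` {c}) ` residue_vecs (nat N)"
        using x equiv_class_eq[OF r] sub by blast
    qed
  qed
  then show ?thesis using that transversal_quotient[OF r] by blast
qed

section \<open>The smoothed Dedekind sum as a single sum\<close>

type_synonym 'n zvec = "int^'n"

type_synonym 'n zmat = "int^'n^'n"

lemma matrix_inv_vector_eq:
  assumes "det (A :: 'a::field^'n^'n) \<noteq> 0" "A *v y = x"
  shows "matrix_inv A *v x = y"
  using matrix_inv(2)[OF assms(1)] by (simp add: assms(2)[symmetric] matrix_vector_mul_assoc)

lemma matrix_vector_inv:
  assumes "det (A :: 'a::field^'n^'n) \<noteq> 0"
  shows "A *v (matrix_inv A *v x) = x"
  using matrix_inv(1)[OF assms] by (simp add: matrix_vector_mul_assoc)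

lemma transversal_shift:
  assumes "transversal (column_rel S) T h"
  shows "transversal (column_rel S) T (\<lambda>t. h t + d)"
proof -
  have "(h t + d, x) \<in> column_rel S \<longleftrightarrow> (h t, x - d) \<in> column_rel S" for t x
    by (simp add: column_rel_def diff_diff_eq2)
  then show ?thesis using assms by (simp add: transversal_def)
qed

text \<open>\<open>S\<close> is sigma with its denominators cleared. Modulo l only the first row
  survives, and none of its entries vanishes, because every column comes from a matrix in Gamma_l;
  see \<open>smoothing_first_columns\<close>.\<close>

locale smoothing =
  fixes l :: nat and S :: "'n::{finite,linorder} zmat"
  assumes prime_l: "prime l"
    and first_row: "\<not> int l dvd S $ first $ j"
    and other_rows: "i \<noteq> first \<Longrightarrow> int l dvd S $ i $ j"
    and det_nz: "det (of_int_mat S :: 'n::{finite,linorder} qmat) \<noteq> 0"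
begin

text \<open>\<open>L\<close> is sigma_l, integral because the lower rows of \<open>S\<close> are
  divisible by l. The two factorisations of \<open>M\<close>, as \<open>Pi_l\<close> times
  \<open>S\<close> and as l times \<open>L\<close>, allow both sums of D_l to be rewritten over
  Z^n/MZ^n.\<close>

definition L :: "'n zmat" where
  "L = (\<chi> i j. if i = first then S $ i $ j else S $ i $ j div int l)"

definition Pi_l :: "'n zmat" where
  "Pi_l = (\<chi> i j. if i = j then (if i = first then int l else 1) else 0)"

definition M :: "'n zmat" where
  "M = Pi_l ** S"

lemma l_pos: "l > 0" using prime_l by (rule prime_gt_0_nat)

lemma Pi_l_vector: "(of_int_mat Pi_l *v x) $ i = (if i = first then of_nat l * x $ i else x $ i)"
  for x :: "('a::comm_ring_1, 'n) vec"
  by (simp add: matrix_vector_mult_def Pi_l_def if_distrib[of "\<lambda>x. of_int x * _"] cong: if_cong)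

lemma Pi_l_vector_int: "(Pi_l *v x) $ i = (if i = first then int l * x $ i else x $ i)"
  by (simp add: matrix_vector_mult_def Pi_l_def if_distrib[of "\<lambda>x. x * _"] cong: if_cong)

lemma pi_mat_eq: "pi_mat l = of_int_mat Pi_l"
  by (simp add: vec_eq_iff pi_mat_def Pi_l_def)

lemma M_nth: "M $ i $ j = (if i = first then int l * S $ i $ j else S $ i $ j)"
  by (simp add: M_def matrix_matrix_mult_def Pi_l_def if_distrib[of "\<lambda>x. x * _"] cong: if_cong)

lemma M_eq: "M = L ** mat (int l)"
  using other_rows l_pos
  by (simp add: vec_eq_iff M_nth matrix_matrix_mult_def L_def mat_def if_distrib[of "\<lambda>x. _ * x"] cong: if_cong)

lemma sigma_l_eq: "sigma_l l (of_int_mat S) = of_int_mat L"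
proof -
  have "pi_mat l ** of_int_mat S = of_int_mat M" by (simp add: pi_mat_eq M_def of_int_mat_mult)
  also have "\<dots> = of_int_mat L ** mat (of_nat l)" by (simp add: M_eq of_int_mat_mult of_int_mat_mat)
  finally show ?thesis using l_pos
    by (simp add: vec_eq_iff sigma_l_def) (simp add: matrix_matrix_mult_def mat_def if_distrib[of "\<lambda>x. _ * x"] cong: if_cong)
qed

lemma det_Pi_nz: "det (of_int_mat Pi_l :: 'n qmat) \<noteq> 0"
  using l_pos by (subst det_diagonal) (auto simp: Pi_l_def)

lemma det_M_nz: "det (of_int_mat M :: 'n qmat) \<noteq> 0"
  using det_nz det_Pi_nz by (simp add: M_def of_int_mat_mult det_mul)

lemma det_L_nz: "det (of_int_mat L :: 'n qmat) \<noteq> 0"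
  using det_M_nz by (auto simp: M_eq of_int_mat_mult det_mul)

abbreviation inv_M :: "'n qvec \<Rightarrow> 'n qvec" where "inv_M \<equiv> (*v) (matrix_inv (of_int_mat M))"
abbreviation inv_L :: "'n qvec \<Rightarrow> 'n qvec" where "inv_L \<equiv> (*v) (matrix_inv (of_int_mat L))"
abbreviation inv_S :: "'n qvec \<Rightarrow> 'n qvec" where "inv_S \<equiv> (*v) (matrix_inv (of_int_mat S))"
abbreviation pi_vec :: "'n qvec \<Rightarrow> 'n qvec" where "pi_vec \<equiv> (*v) (of_int_mat Pi_l)"

lemma inv_M_pi: "inv_M (pi_vec u) = inv_S u"
proof (rule matrix_inv_vector_eq[OF det_M_nz])
  show "of_int_mat M *v inv_S u = pi_vec u"
    by (simp add: M_def of_int_mat_mult matrix_vector_inv[OF det_nz] flip: matrix_vector_mul_assoc)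
qed

lemma inv_M_L: "inv_M u = (1 / of_nat l) *s inv_L u"
proof (rule matrix_inv_vector_eq[OF det_M_nz])
  have "mat (of_nat l) *v ((1 / of_nat l) *s inv_L u) = inv_L u"
    using l_pos by (simp add: mat_vector vec_eq_iff)
  then show "of_int_mat M *v ((1 / of_nat l) *s inv_L u) = u"
    by (simp add: M_eq of_int_mat_mult of_int_mat_mat matrix_vector_inv[OF det_L_nz] flip: matrix_vector_mul_assoc)
qed

lemma inv_L_pi: "inv_L (pi_vec u) = of_nat l *s inv_S u"
  using inv_M_pi[of u] inv_M_L[of "pi_vec u"] l_pos by (simp add: vec_eq_iff field_simps)

lemma inv_M_M: "inv_M (of_int_vec (M *v z)) = of_int_vec z"
  by (rule matrix_inv_vector_eq[OF det_M_nz]) (simp add: of_int_mat_vector)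

lemma inv_L_L: "inv_L (of_int_vec (L *v z)) = of_int_vec z"
  by (rule matrix_inv_vector_eq[OF det_L_nz]) (simp add: of_int_mat_vector)

definition weight :: "int \<Rightarrow> rat" where
  "weight z = (if int l dvd z then 1 - of_nat l else 1)"

lemma weight_cong: "int l dvd a - b \<Longrightarrow> weight a = weight b"
  unfolding weight_def by (metis dvd_diff_right_iff dvd_add_right_iff diff_add_cancel)

lemma M_first: "int l dvd (M *v z) $ first"
  by (simp add: M_def Pi_l_vector_int flip: matrix_vector_mul_assoc)

text \<open>F is arbitrary because the lattice arguments use only two properties of the Bernoulli
  functions, periodicity and the distribution relation.\<close>

definition smoothed_sum :: "('n qvec \<Rightarrow> rat) \<Rightarrow> 'n qvec \<Rightarrow> rat" where
  "smoothed_sum F w = coset_sum (of_int_mat M) (\<lambda>x. weight (x $ first) * F (inv_M (of_int_vec x + pi_vec w)))"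

text \<open>Only the first coordinate is reduced modulo l, so the multiples of the first basis
  vector represent all classes.\<close>

lemma transversal_Pi: "transversal (column_rel Pi_l) {0..<int l} (\<lambda>i. axis first i)"
  unfolding transversal_def
proof (intro conjI allI)
  fix x :: "'n zvec"
  have rel: "(axis first i, x) \<in> column_rel Pi_l \<longleftrightarrow> int l dvd i - x $ first" for i
  proof
    assume "(axis first i, x) \<in> column_rel Pi_l"
    then obtain z where "axis first i - x = Pi_l *v z" by (auto simp: column_rel_def)
    then have "(axis first i - x) $ first = (Pi_l *v z) $ first" by simp
    then show "int l dvd i - x $ first" by (simp add: Pi_l_vector_int axis_def)
  next
    assume "int l dvd i - x $ first"
    then obtain q where "i - x $ first = int l * q" by (elim dvdE)
    then have "axis first i - x = Pi_l *v (\<chi> j. if j = first then q else - x $ j)"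
      by (simp add: vec_eq_iff Pi_l_vector_int axis_def)
    then show "(axis first i, x) \<in> column_rel Pi_l" unfolding column_rel_def by blast
  qed
  show "\<exists>!i. i \<in> {0..<int l} \<and> (axis first i, x) \<in> column_rel Pi_l"
    unfolding rel
  proof (rule ex1I[of _ "x $ first mod int l"])
    fix i assume "i \<in> {0..<int l} \<and> int l dvd i - x $ first"
    then show "i = x $ first mod int l" by (auto simp: mod_eq_dvd_iff[symmetric])
  qed (use l_pos in \<open>auto simp: mod_eq_dvd_iff[symmetric]\<close>)
qed simp

text \<open>F stands for w \<mapsto> B_e(w, Q) and E for the sum of the e_j. The power N^n on the
  right collects one factor N from each coordinate.\<close>

context
  fixes F :: "'n qvec \<Rightarrow> rat" and E :: nat
  assumes periodic: "\<And>t z. F (t + of_int_vec z) = F t"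
    and distribution: "\<And>N t. N > 0 \<Longrightarrow> of_nat N ^ E * (\<Sum>c\<in>residue_vecs N. F ((1 / of_nat N) *s (t + of_int_vec c)))
        = of_nat N ^ CARD('n) * F t"
begin

lemma respects_inv_M: "(x, y) \<in> column_rel M \<Longrightarrow> F (inv_M (of_int_vec x + u)) = F (inv_M (of_int_vec y + u))"
proof -
  assume "(x, y) \<in> column_rel M"
  then obtain z where "x = y + M *v z" by (auto simp: column_rel_def algebra_simps)
  then have "inv_M (of_int_vec x + u) = inv_M (of_int_vec y + u) + of_int_vec z"
    by (simp add: of_int_vec_add matrix_vector_right_distrib inv_M_M)
  then show ?thesis by (simp add: periodic)
qed

lemma respects_weight: "(x, y) \<in> column_rel M \<Longrightarrow> weight (x $ first) = weight (y $ first)"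
proof -
  assume "(x, y) \<in> column_rel M"
  then obtain z where "x - y = M *v z" by (auto simp: column_rel_def)
  then have "(x - y) $ first = (M *v z) $ first" by simp
  then show ?thesis using M_first[of z] by (intro weight_cong) simp
qed

lemma smoothed_sum_transversal:
  assumes "transversal (column_rel M) T h"
  shows "smoothed_sum F w = (\<Sum>t\<in>T. weight (h t $ first) * F (inv_M (of_int_vec (h t) + pi_vec w)))"
  unfolding smoothed_sum_def
  using respects_weight respects_inv_M
  by (intro coset_sum_transversal[OF assms, where F = "\<lambda>x. weight (x $ first) * F (inv_M (of_int_vec x + pi_vec w))"]) metis

text \<open>Shifting w by z amounts to shifting x by \<open>Pi_l\<close> z. This permutes the
  classes modulo \<open>M\<close> and moves the first coordinate by a multiple of l, so the weight
  is unaffected.\<close>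

lemma smoothed_sum_periodic: "smoothed_sum F (w + of_int_vec z) = smoothed_sum F w"
proof -
  obtain T :: "('n zvec) set set" and h where T: "transversal (column_rel M) T h"
    using exists_transversal[OF det_M_nz] .
  have "weight (x $ first) = weight ((x + Pi_l *v z) $ first)" for x
    by (intro weight_cong) (simp add: Pi_l_vector_int)
  then show ?thesis
    unfolding smoothed_sum_transversal[OF T, of "w + of_int_vec z"]
      smoothed_sum_transversal[OF transversal_shift[OF T, of "Pi_l *v z"], of w]
    by (simp add: of_int_vec_add matrix_vector_right_distrib of_int_mat_vector[symmetric] ac_simps)
qed

lemma transversal_M_L:
  assumes "transversal (column_rel L) T h"
  shows "transversal (column_rel M) (T \<times> residue_vecs l) (\<lambda>(t, c). h t + L *v c)"
  unfolding M_eq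
  using transversal_mult[OF assms transversal_residue_vecs[OF l_pos] inj_of_int_mat[OF det_L_nz]] .

lemma inv_M_transversal_L:
  "inv_M (of_int_vec (x + L *v c) + u) = (1 / of_nat l) *s (inv_L (of_int_vec x + u) + of_int_vec c)"
  by (simp add: inv_M_L of_int_vec_add matrix_vector_right_distrib inv_L_L ac_simps)

lemma smoothed_sum_L:
  assumes "transversal (column_rel L) T h"
  shows "smoothed_sum F w = (\<Sum>t\<in>T. \<Sum>c\<in>residue_vecs l.
    weight ((h t + L *v c) $ first) * F ((1 / of_nat l) *s (inv_L (of_int_vec (h t) + pi_vec w) + of_int_vec c)))"
  unfolding smoothed_sum_transversal[OF transversal_M_L[OF assms]]
  by (simp add: sum.cartesian_product case_prod_unfold inv_M_transversal_L)

text \<open>The sum modulo \<open>L\<close> is spread over Z^n/MZ^n by the distribution relation for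
  N = l. The sum modulo \<open>S\<close> is the part of that sum with l | x_1, because
  \<open>Pi_l\<close> maps Z^n onto the vectors with l | x_1. The exponent 1 - n + E leaves exactly
  the factor l of the weight.\<close>

lemma smoothed_difference:
  "of_nat l ^ CARD('n) * (coset_sum (of_int_mat L) (\<lambda>x. F (inv_L (of_int_vec x + pi_vec w)))
     - of_nat l powi (1 - int CARD('n) + int E) * coset_sum (of_int_mat S) (\<lambda>x. F (inv_S (of_int_vec x + w))))
   = of_nat l ^ E * smoothed_sum F w"
proof -
  obtain T :: "('n zvec) set set" and h where T: "transversal (column_rel L) T h"
    using exists_transversal[OF det_L_nz] .
  obtain U :: "('n zvec) set set" and k where U: "transversal (column_rel S) U k"
    using exists_transversal[OF det_nz] .
  note TM = transversal_M_L[OF T]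
  note UM = transversal_mult[OF transversal_Pi U inj_of_int_mat[OF det_Pi_nz], folded M_def]
  let ?G = "\<lambda>x. F (inv_M (of_int_vec x + pi_vec w))"
  have respL: "F (inv_L (of_int_vec x + pi_vec w)) = F (inv_L (of_int_vec y + pi_vec w))" if xy: "(x, y) \<in> column_rel L" for x y
  proof -
    obtain z where "x = y + L *v z" using xy by (auto simp: column_rel_def algebra_simps)
    then have "inv_L (of_int_vec x + pi_vec w) = inv_L (of_int_vec y + pi_vec w) + of_int_vec z"
      by (simp add: of_int_vec_add matrix_vector_right_distrib inv_L_L)
    then show ?thesis by (simp add: periodic)
  qed
  have respS: "F (inv_S (of_int_vec x + w)) = F (inv_S (of_int_vec y + w))" if xy: "(x, y) \<in> column_rel S" for x y
  proof -
    obtain z where z: "x = y + S *v z" using xy by (auto simp: column_rel_def algebra_simps)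
    have "inv_S (of_int_vec (S *v z)) = of_int_vec z"
      by (rule matrix_inv_vector_eq[OF det_nz]) (simp add: of_int_mat_vector)
    then have "inv_S (of_int_vec x + w) = inv_S (of_int_vec y + w) + of_int_vec z"
      by (simp add: z of_int_vec_add matrix_vector_right_distrib)
    then show ?thesis by (simp add: periodic)
  qed
  have 1: "of_nat l ^ CARD('n) * coset_sum (of_int_mat L) (\<lambda>x. F (inv_L (of_int_vec x + pi_vec w)))
     = of_nat l ^ E * (\<Sum>(t, c)\<in>T \<times> residue_vecs l. ?G (h t + L *v c))"
  proof -
    have "coset_sum (of_int_mat L) (\<lambda>x. F (inv_L (of_int_vec x + pi_vec w)))
      = (\<Sum>t\<in>T. F (inv_L (of_int_vec (h t) + pi_vec w)))"
      by (rule coset_sum_transversal[OF T respL])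
    then show ?thesis
      by (simp add: sum_distrib_left distribution[OF l_pos, symmetric] inv_M_transversal_L
          flip: sum.cartesian_product)
  qed
  have 2: "coset_sum (of_int_mat S) (\<lambda>x. F (inv_S (of_int_vec x + w)))
     = (\<Sum>(t, c)\<in>T \<times> residue_vecs l. (if int l dvd (h t + L *v c) $ first then ?G (h t + L *v c) else 0))"
  proof -
    let ?H = "\<lambda>x. if int l dvd x $ first then ?G x else 0"
    have H: "?H x = ?H y" if xy: "(x, y) \<in> column_rel M" for x y
    proof -
      obtain z where z: "x - y = M *v z" using xy by (auto simp: column_rel_def)
      have "int l dvd (x - y) $ first" unfolding z by (rule M_first)
      then have "int l dvd x $ first \<longleftrightarrow> int l dvd y $ first"
        by (metis dvd_diff_right_iff dvd_diff_left_iff vector_minus_component)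
      then show ?thesis using respects_inv_M[OF xy] by simp
    qed
    have "coset_sum (of_int_mat S) (\<lambda>x. F (inv_S (of_int_vec x + w))) = (\<Sum>u\<in>U. F (inv_S (of_int_vec (k u) + w)))"
      by (rule coset_sum_transversal[OF U respS])
    also have "\<dots> = (\<Sum>u\<in>U. ?G (Pi_l *v k u))"
      by (simp add: inv_M_pi of_int_mat_vector[symmetric] flip: matrix_vector_right_distrib)
    \<comment> \<open>A sum over i is inserted to which only i = 0 contributes, so that (i, u) runs
      through all classes modulo \<open>M\<close>; the condition i = 0 then becomes l | x_1.\<close>
    also have "\<dots> = (\<Sum>u\<in>U. \<Sum>i\<in>{0..<int l}. if i = 0 then ?G (Pi_l *v k u) else 0)"
      using l_pos by simp
    also have "\<dots> = (\<Sum>u\<in>U. \<Sum>i\<in>{0..<int l}. ?H (axis first i + Pi_l *v k u))"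
    proof (intro sum.cong refl)
      fix u i assume i: "i \<in> {0..<int l}"
      have "int l dvd (axis first i + Pi_l *v k u) $ first \<longleftrightarrow> i = 0"
      proof -
        have "int l dvd i \<longleftrightarrow> i = 0"
          using i zdvd_imp_le[of "int l" i] by (cases "i = 0") auto
        then show ?thesis by (simp add: Pi_l_vector_int axis_def dvd_add_left_iff)
      qed
      moreover have "axis first 0 = (0 :: 'n zvec)" by (simp add: vec_eq_iff axis_def)
      ultimately show "(if i = 0 then ?G (Pi_l *v k u) else 0) = ?H (axis first i + Pi_l *v k u)"
        by (cases "i = 0") (simp_all only: add_0 if_True if_False)
    qed
    also have "\<dots> = (\<Sum>(i, u)\<in>{0..<int l} \<times> U. ?H (axis first i + Pi_l *v k u))"
      by (subst sum.swap) (simp add: sum.cartesian_product)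
    also have "\<dots> = (\<Sum>(t, c)\<in>T \<times> residue_vecs l. ?H (h t + L *v c))"
      using sum_transversal[OF equiv_column_rel UM TM, where F = ?H, OF H] unfolding case_prod_unfold .
    finally show ?thesis .
  qed
  have 3: "of_nat l ^ CARD('n) * of_nat l powi (1 - int CARD('n) + int E) = (of_nat l * of_nat l ^ E :: rat)"
  proof -
    have "of_nat l ^ CARD('n) * of_nat l powi (1 - int CARD('n) + int E)
      = (of_nat l :: rat) powi (int CARD('n) + (1 - int CARD('n) + int E))"
      using l_pos by (subst power_int_add) auto
    also have "\<dots> = of_nat l powi (int (Suc E))" by (simp add: add.commute)
    finally show ?thesis by (simp only: power_int_of_nat power_Suc)
  qed
  have "smoothed_sum F w = (\<Sum>(t, c)\<in>T \<times> residue_vecs l. ?G (h t + L *v c)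
      - of_nat l * (if int l dvd (h t + L *v c) $ first then ?G (h t + L *v c) else 0))"
    unfolding smoothed_sum_transversal[OF TM]
    by (intro sum.cong) (auto simp: weight_def algebra_simps)
  also have "\<dots> = (\<Sum>(t, c)\<in>T \<times> residue_vecs l. ?G (h t + L *v c))
      - of_nat l * coset_sum (of_int_mat S) (\<lambda>x. F (inv_S (of_int_vec x + w)))"
    unfolding 2 by (simp add: case_prod_unfold sum_subtractf sum_distrib_left)
  finally show ?thesis
    unfolding right_diff_distrib 1 mult.assoc[symmetric] 3 by (simp add: right_diff_distrib ac_simps)
qed

text \<open>As N is prime to l, \<open>Pi_l\<close> is invertible modulo N and permutes the residue
  classes; m below is the inverse of l modulo N.\<close>

lemma transversal_residue_Pi:
  assumes N: "N > 0" "coprime N l"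
  shows "transversal (column_rel (mat (int N) :: 'n zmat)) (residue_vecs N) (\<lambda>y. Pi_l *v y)"
proof -
  obtain m k where m: "int l * m = 1 + int N * k"
  proof -
    obtain u v where "u * int l + v * int N = gcd (int l) (int N)" using bezout_int by blast
    then have "int l * u = 1 + int N * (- v)" using N(2) by (simp add: gcd.commute algebra_simps)
    then show ?thesis by (rule that)
  qed
  let ?s = "\<lambda>x :: 'n zvec. (\<chi> i. if i = first then m * x $ i else x $ i)"
  have rel: "(x, y) \<in> column_rel (mat (int N)) \<longleftrightarrow> (\<forall>i. int N dvd x $ i - y $ i)" for x y :: "'n zvec"
  proof
    assume "(x, y) \<in> column_rel (mat (int N))"
    then show "\<forall>i. int N dvd x $ i - y $ i"
      by (auto simp: column_rel_def mat_vector vec_eq_iff)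
  next
    assume "\<forall>i. int N dvd x $ i - y $ i"
    then obtain z where "\<And>i. x $ i - y $ i = int N * z i" unfolding dvd_def by metis
    then have "x - y = mat (int N) *v (\<chi> i. z i)" by (simp add: mat_vector vec_eq_iff)
    then show "(x, y) \<in> column_rel (mat (int N))" unfolding column_rel_def by blast
  qed
  have eq: "(Pi_l *v y, x) \<in> column_rel (mat (int N)) \<longleftrightarrow> (y, ?s x) \<in> column_rel (mat (int N))" for x y
  proof -
    have "int N dvd int l * a - b \<longleftrightarrow> int N dvd a - m * b" for a b
    proof
      assume "int N dvd int l * a - b"
      then have "int N dvd m * (int l * a - b) - int N * (k * a)" by (intro dvd_diff[OF dvd_mult[of "int N" _ m] dvd_triv_left])
      also have "m * (int l * a - b) - int N * (k * a) = (int l * m - int N * k) * a - m * b"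
        by (simp add: algebra_simps)
      finally show "int N dvd a - m * b" by (simp add: m)
    next
      assume "int N dvd a - m * b"
      then have "int N dvd int l * (a - m * b) + int N * (k * b)" by (intro dvd_add[OF dvd_mult[of "int N" _ "int l"] dvd_triv_left])
      also have "int l * (a - m * b) + int N * (k * b) = int l * a - (int l * m - int N * k) * b"
        by (simp add: algebra_simps)
      finally show "int N dvd int l * a - b" by (simp add: m)
    qed
    then show ?thesis unfolding rel by (simp add: Pi_l_vector_int)
  qed
  show ?thesis
    using transversal_residue_vecs[OF N(1), where 'n = 'n] unfolding transversal_def eq by blast
qed

text \<open>Two systems of representatives modulo N times \<open>M\<close> are compared:
  \<open>Pi_l\<close> y + N h(t) produces the smoothed sums at (w + y)/N, while h(t) +
  \<open>M\<close> c lets the distribution relation of F collapse the sum over c.\<close>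

lemma smoothed_sum_distribution:
  assumes N: "N > 0" "coprime N l"
  shows "of_nat N ^ E * (\<Sum>y\<in>residue_vecs N. smoothed_sum F ((1 / of_nat N) *s (w + of_int_vec y)))
    = of_nat N ^ CARD('n) * smoothed_sum F w"
proof -
  obtain T :: "('n zvec) set set" and h where T: "transversal (column_rel M) T h"
    using exists_transversal[OF det_M_nz] .
  have "det (of_int_mat (mat (int N)) :: 'n qmat) \<noteq> 0"
    using N by (simp add: of_int_mat_mat det_diagonal mat_def)
  then have inj: "inj ((*v) (mat (int N) :: 'n zmat))" by (rule inj_of_int_mat)
  note T1 = transversal_mult[OF transversal_residue_Pi[OF N] T inj]
  note T2 = transversal_mult[OF T transversal_residue_vecs[OF N(1)] inj_of_int_mat[OF det_M_nz],
      folded mat_times_commute]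
  let ?K = "\<lambda>x. weight (x $ first) * F ((1 / of_nat N) *s inv_M (of_int_vec x + pi_vec w))"
  have K: "?K x = ?K y" if xy: "(x, y) \<in> column_rel (mat (int N) ** M)" for x y
  proof -
    obtain z where z: "x - y = (mat (int N) ** M) *v z" using xy by (auto simp: column_rel_def)
    then have z': "x - y = M *v (int N *s z)"
      by (simp add: mat_times_commute mat_vector flip: matrix_vector_mul_assoc)
    then have x: "x = y + M *v (int N *s z)" by (simp add: algebra_simps)
    have "(x, y) \<in> column_rel M" using z' unfolding column_rel_def by blast
    moreover have "(1 / of_nat N) *s inv_M (of_int_vec x + pi_vec w)
      = (1 / of_nat N) *s inv_M (of_int_vec y + pi_vec w) + of_int_vec z"
      unfolding x of_int_vec_add using N(1)
      by (simp add: matrix_vector_right_distrib inv_M_M vec_eq_iff field_simps)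
    ultimately show ?thesis using respects_weight by (metis periodic)
  qed
  \<comment> \<open>Since N is prime to l, the numbers N x_1 and x_1 are divisible by l
    simultaneously, so scaling by N keeps the weight.\<close>
  have w1: "weight ((Pi_l *v y + mat (int N) *v x) $ first) = weight (x $ first)" for x y
  proof -
    have "int l dvd int N * x $ first \<longleftrightarrow> int l dvd x $ first"
      using N(2) by (intro coprime_dvd_mult_right_iff) (simp add: coprime_commute)
    then show ?thesis by (simp add: weight_def Pi_l_vector_int mat_vector dvd_add_right_iff)
  qed
  have f1: "(1 / of_nat N) *s inv_M (of_int_vec (Pi_l *v y + mat (int N) *v x) + pi_vec w)
    = inv_M (of_int_vec x + pi_vec ((1 / of_nat N) *s (w + of_int_vec y)))" for x y
  proof -
    have "of_int_vec (Pi_l *v y + mat (int N) *v x) + pi_vec w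
      = of_nat N *s (of_int_vec x + pi_vec ((1 / of_nat N) *s (w + of_int_vec y)))"
      using N(1) by (simp add: vec_eq_iff mat_vector Pi_l_vector Pi_l_vector_int field_simps)
    then show ?thesis using N(1)
      by (simp only: vector_scalar_commute vector_smult_assoc) simp
  qed
  have w2: "weight ((x + M *v c) $ first) = weight (x $ first)" for x c
    by (rule weight_cong) (simp add: M_first)
  have f2: "inv_M (of_int_vec (x + M *v c) + pi_vec w) = inv_M (of_int_vec x + pi_vec w) + of_int_vec c" for x c
    by (simp add: of_int_vec_add matrix_vector_right_distrib inv_M_M)
  have "(\<Sum>y\<in>residue_vecs N. smoothed_sum F ((1 / of_nat N) *s (w + of_int_vec y)))
    = (\<Sum>(y, t)\<in>residue_vecs N \<times> T. ?K (Pi_l *v y + mat (int N) *v h t))"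
    unfolding smoothed_sum_transversal[OF T] by (simp only: sum.cartesian_product w1 f1)
  also have "\<dots> = (\<Sum>(t, c)\<in>T \<times> residue_vecs N. ?K (h t + M *v c))"
    using sum_transversal[OF equiv_column_rel T1 T2, where F = ?K, OF K] unfolding case_prod_unfold .
  also have "\<dots> = (\<Sum>t\<in>T. weight (h t $ first) * (\<Sum>c\<in>residue_vecs N. 
      F ((1 / of_nat N) *s (inv_M (of_int_vec (h t) + pi_vec w) + of_int_vec c))))"
    by (simp only: w2 f2 sum_distrib_left flip: sum.cartesian_product)
  finally have "of_nat N ^ E * (\<Sum>y\<in>residue_vecs N. smoothed_sum F ((1 / of_nat N) *s (w + of_int_vec y)))
    = (\<Sum>t\<in>T. weight (h t $ first) * (of_nat N ^ E * (\<Sum>c\<in>residue_vecs N.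
      F ((1 / of_nat N) *s (inv_M (of_int_vec (h t) + pi_vec w) + of_int_vec c)))))"
    by (simp only: sum_distrib_left[of "of_nat N ^ E"] mult.left_commute[of "of_nat N ^ E"])
  then show ?thesis
    unfolding smoothed_sum_transversal[OF T] distribution[OF N(1)]
    by (simp only: sum_distrib_left mult.left_commute)
qed

end

end

section \<open>Products of Bernoulli functions and their cancellation under the weight\<close>

lemma bernoulli_tuple_eq:
  fixes Q :: "('n::finite, 'm::finite) forms" and w :: "('a::floor_ceiling, 'n) vec"
  assumes Q: "\<And>i j. Q $ i $ j \<noteq> 0" and e: "\<And>j. e j \<noteq> 0"
  shows "bernoulli_tuple e w Q = (\<Sum>i\<in>UNIV. \<Prod>j\<in>UNIV. bernoulli_bi (Q $ i $ j > 0) (e j) (w $ j)) / of_nat CARD('m)"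
proof -
  let ?J = "{j. e j = 1 \<and> w $ j \<in> \<int>}"
  have floor: "\<lfloor>- 1 :: real\<rfloor> = - 1" by (rule floor_unique) auto
  have "(\<Prod>j\<in>?J. of_int \<lfloor>sgn (Q $ i $ j)\<rfloor> / 2) * (\<Prod>j\<in>- ?J. periodic_bernoulli (e j) (w $ j))
    = (\<Prod>j\<in>UNIV. bernoulli_bi (Q $ i $ j > 0) (e j) (w $ j))" for i
  proof -
    have "(\<Prod>j\<in>?J. of_int \<lfloor>sgn (Q $ i $ j)\<rfloor> / 2) = (\<Prod>j\<in>?J. bernoulli_bi (Q $ i $ j > 0) (e j) (w $ j))"
      using Q by (intro prod.cong) (auto simp: bernoulli_bi_eq sgn_if floor)
    moreover have "(\<Prod>j\<in>- ?J. periodic_bernoulli (e j) (w $ j)) = (\<Prod>j\<in>- ?J. bernoulli_bi (Q $ i $ j > 0) (e j) (w $ j))"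
      using e by (intro prod.cong) (auto simp: bernoulli_bi_eq)
    ultimately show ?thesis
      using prod.union_disjoint[of ?J "- ?J" "\<lambda>j. bernoulli_bi (Q $ i $ j > 0) (e j) (w $ j)"]
      by (simp only: Compl_partition finite Compl_disjoint)
  qed
  then show ?thesis by (simp add: bernoulli_tuple_def)
qed

text \<open>The truth value of Q_ij > 0 is the same at w and at all points (w + c)/N, so the
  one-variable relations multiply over the coordinates for each form separately.\<close>

lemma
  fixes Q :: "('n::finite, 'm::finite) forms" and w :: "('a::floor_ceiling, 'n) vec"
  assumes Q: "\<And>i j. Q $ i $ j \<noteq> 0" and e: "\<And>j. e j \<noteq> 0"
  shows bernoulli_tuple_periodic: "bernoulli_tuple e (w + of_int_vec z) Q = bernoulli_tuple e w Q"
    and bernoulli_tuple_distribution: "N > 0 \<Longrightarrow> of_nat N ^ (\<Sum>j\<in>UNIV. e j) * (\<Sum>c\<in>residue_vecs N.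
      bernoulli_tuple e ((1 / of_nat N) *s (w + of_int_vec c)) Q) = of_nat N ^ CARD('n) * bernoulli_tuple e w Q"
proof -
  note eq = bernoulli_tuple_eq[OF assms]
  have "bernoulli_bi b k (x + of_int y) = bernoulli_bi b k x" for b k y and x :: 'a
    by (rule bernoulli_bi_cong) simp
  then show "bernoulli_tuple e (w + of_int_vec z) Q = bernoulli_tuple e w Q"
    by (simp add: eq)
  assume N: "N > 0"
  have "of_nat N ^ (\<Sum>j\<in>UNIV. e j) * (\<Sum>c\<in>residue_vecs N. \<Prod>j\<in>UNIV. bernoulli_bi (Q $ i $ j > 0) (e j) ((w $ j + of_int (c $ j)) / of_nat N))
    = of_nat N ^ CARD('n) * (\<Prod>j\<in>UNIV. bernoulli_bi (Q $ i $ j > 0) (e j) (w $ j))" for i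
  proof -
    have "(\<Sum>c\<in>residue_vecs N. \<Prod>j\<in>UNIV. bernoulli_bi (Q $ i $ j > 0) (e j) ((w $ j + of_int (c $ j)) / of_nat N))
      = (\<Prod>j\<in>UNIV. \<Sum>z\<in>{0..<int N}. bernoulli_bi (Q $ i $ j > 0) (e j) ((w $ j + of_int z) / of_nat N))"
      by (rule sum_residue_vecs_prod)
    then show ?thesis
      using N by (simp add: power_sum bernoulli_bi_multiplication flip: prod.distrib) (simp add: prod.distrib)
  qed
  then show "of_nat N ^ (\<Sum>j\<in>UNIV. e j) * (\<Sum>c\<in>residue_vecs N.
      bernoulli_tuple e ((1 / of_nat N) *s (w + of_int_vec c)) Q) = of_nat N ^ CARD('n) * bernoulli_tuple e w Q"
    by (simp add: eq del: vector_add_ldistrib flip: sum_divide_distrib)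
      (subst sum.swap, simp add: sum_distrib_left)
qed

context smoothing
begin

text \<open>As i runs through the residues modulo l, so does z + s i; the single weight 1 - l
  cancels the l - 1 weights 1.\<close>

lemma sum_weight: 
  assumes "\<not> int l dvd s"
  shows "(\<Sum>i\<in>{0..<int l}. weight (z + s * i)) = 0"
proof -
  have pl: "prime (int l)" using prime_l by simp
  have cop: "coprime (int l) s" using assms pl by (simp add: prime_imp_coprime)
  have inj: "inj_on (\<lambda>i. (z + s * i) mod int l) {0..<int l}"
  proof (rule inj_onI)
    fix i j assume ij: "i \<in> {0..<int l}" "j \<in> {0..<int l}" "(z + s * i) mod int l = (z + s * j) mod int l"
    then have "int l dvd s * (i - j)" by (simp add: mod_eq_dvd_iff right_diff_distrib)
    then have "int l dvd i - j" using cop by (simp add: coprime_dvd_mult_right_iff)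
    then have "i mod int l = j mod int l" by (simp add: mod_eq_dvd_iff)
    then show "i = j" using ij by simp
  qed
  have img: "(\<lambda>i. (z + s * i) mod int l) ` {0..<int l} = {0..<int l}"
    using l_pos by (intro card_subset_eq) (auto simp: card_image[OF inj])
  have "(\<Sum>i\<in>{0..<int l}. weight (z + s * i)) = (\<Sum>i\<in>{0..<int l}. weight ((z + s * i) mod int l))"
    by (intro sum.cong refl weight_cong) (simp add: minus_mod_eq_mult_div)
  also have "\<dots> = (\<Sum>i\<in>{0..<int l}. weight i)"
    using sum.reindex[OF inj, of weight] by (simp add: img)
  also have "\<dots> = weight 0 + (\<Sum>i\<in>{1..<int l}. weight i)"
  proof -
    have "{0..<int l} = insert 0 {1..<int l}" using l_pos by auto
    then show ?thesis by simp
  qed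
  also have "(\<Sum>i\<in>{1..<int l}. weight i) = (\<Sum>i\<in>{1..<int l}. 1)"
    by (intro sum.cong refl) (use zdvd_imp_le in \<open>fastforce simp: weight_def\<close>)
  finally show ?thesis using l_pos by (simp add: weight_def of_nat_diff)
qed

text \<open>
  The weight has mean zero along every coordinate axis, so a factor that is constant in one coordinate
  kills the sum; only the products of the nonconstant parts survive.
\<close>

lemma weighted_sum_cancel:
  fixes a :: "'n \<Rightarrow> rat" and d :: "'n \<Rightarrow> int \<Rightarrow> rat"
  assumes d: "\<And>j x y. int l dvd x - y \<Longrightarrow> d j x = d j y" and s: "\<And>j. \<not> int l dvd s j"
  shows "(\<Sum>c\<in>residue_vecs l. weight (z + (\<Sum>j\<in>UNIV. s j * c $ j)) * (\<Prod>j\<in>UNIV. a j + d j (c $ j)))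
    = (\<Sum>c\<in>residue_vecs l. weight (z + (\<Sum>j\<in>UNIV. s j * c $ j)) * (\<Prod>j\<in>UNIV. d j (c $ j)))"
proof -
  let ?g = "\<lambda>c :: 'n zvec. weight (z + (\<Sum>j\<in>UNIV. s j * c $ j))"
  \<comment> \<open>Averaging over the l translations along axis k leaves H unchanged, while the
    weights add up to 0 by \<open>sum_weight\<close>.\<close>
  have zero: "(\<Sum>c\<in>residue_vecs l. ?g c * H c) = 0"
    if H1: "\<And>c i. H (c + axis k i) = H c" and H2: "\<And>x y. (x, y) \<in> column_rel (mat (int l)) \<Longrightarrow> H x = H y"
    for H :: "'n zvec \<Rightarrow> rat" and k
  proof -
    have resp: "?g x * H x = ?g y * H y" if xy: "(x, y) \<in> column_rel (mat (int l))" for x y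
    proof -
      obtain u where u: "x - y = int l *s u" using xy by (auto simp: column_rel_def mat_vector)
      then have "x = y + int l *s u" by (simp add: algebra_simps)
      then have "?g x = ?g y"
        by (intro weight_cong) (simp add: sum_subtractf[symmetric] right_diff_distrib[symmetric] dvd_sum)
      then show ?thesis using H2[OF xy] by simp
    qed
    note T = transversal_residue_vecs[OF l_pos, where 'n = 'n]
    have g: "?g (c + axis k i) = weight ((z + (\<Sum>j\<in>UNIV. s j * c $ j)) + s k * i)" for c i
      by (rule arg_cong[where f = weight])
        (simp add: axis_def distrib_left sum.distrib if_distrib[of "\<lambda>x. _ * x"] cong: if_cong)
    have "of_nat l * (\<Sum>c\<in>residue_vecs l. ?g c * H c) = (\<Sum>i\<in>{0..<int l}. \<Sum>c\<in>residue_vecs l. ?g c * H c)"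
      by simp
    also have "\<dots> = (\<Sum>i\<in>{0..<int l}. \<Sum>c\<in>residue_vecs l. ?g (c + axis k i) * H (c + axis k i))"
      by (intro sum.cong refl sum_transversal[OF equiv_column_rel T transversal_shift[OF T], where F = "\<lambda>c. ?g c * H c"] resp)
    also have "\<dots> = (\<Sum>c\<in>residue_vecs l. (\<Sum>i\<in>{0..<int l}. weight ((z + (\<Sum>j\<in>UNIV. s j * c $ j)) + s k * i)) * H c)"
      by (subst sum.swap) (simp only: g H1 sum_distrib_right)
    also have "\<dots> = 0" by (simp add: sum_weight[OF s])
    finally show ?thesis using l_pos by simp
  qed
  \<comment> \<open>J is the set of coordinates that still carry their constant. Dropping the
    constant at k discards a_k times a product without a factor at k, whose weighted sum is
    0.\<close>
  have "(\<Sum>c\<in>residue_vecs l. ?g c * ((\<Prod>j\<in>J. a j + d j (c $ j)) * (\<Prod>j\<in>- J. d j (c $ j))))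
    = (\<Sum>c\<in>residue_vecs l. ?g c * (\<Prod>j\<in>UNIV. d j (c $ j)))" for J
  proof (induction J rule: finite_induct[OF finite])
    case (2 k J)
    let ?r = "\<lambda>c. (\<Prod>j\<in>J. a j + d j (c $ j)) * (\<Prod>j\<in>- insert k J. d j (c $ j))"
    have compl: "- J = insert k (- insert k J)" using 2 by auto
    have eq: "(\<Prod>j\<in>insert k J. a j + d j (c $ j)) * (\<Prod>j\<in>- insert k J. d j (c $ j))
      = (\<Prod>j\<in>J. a j + d j (c $ j)) * (\<Prod>j\<in>- J. d j (c $ j)) + a k * ?r c" for c :: "'n zvec"
      using 2 unfolding compl by (simp add: algebra_simps)
    have "(\<Sum>c\<in>residue_vecs l. ?g c * (a k * ?r c)) = 0"
    proof (rule zero[where k = k])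
      show "a k * ?r (c + axis k i) = a k * ?r c" for c i
        using 2 by (intro arg_cong2[where f = "(*)"] refl prod.cong) (auto simp: axis_def)
      show "a k * ?r x = a k * ?r y" if xy: "(x, y) \<in> column_rel (mat (int l))" for x y
      proof -
        obtain u where u: "x - y = int l *s u" using xy by (auto simp: column_rel_def mat_vector)
        have "int l dvd (x - y) $ j" for j unfolding u by simp
        then have "d j (x $ j) = d j (y $ j)" for j by (intro d) simp
        then show ?thesis by simp
      qed
    qed
    then show ?case unfolding eq distrib_left sum.distrib using 2 by simp
  qed (simp add: Compl_eq_Diff_UNIV)
  from this[of UNIV] show ?thesis by simp
qed

text \<open>The top term of the difference is (r + 1) (y/l)^r c/l; the factor l^r/(r + 1) normalises
  it to (c/l) y^r.\<close>

definition bern_diff :: "nat \<Rightarrow> int \<Rightarrow> rat \<Rightarrow> rat" where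
  "bern_diff r c y = of_nat l ^ r / of_nat (r + 1)
     * (bernoulli_poly (r + 1) ((y + of_int c) / of_nat l) - bernoulli_poly (r + 1) (y / of_nat l))"

text \<open>This is the shape a + d(c) required by \<open>weighted_sum_cancel\<close>: the first
  summand is free of c, and the second depends on c only modulo l.\<close>

lemma bernoulli_bi_divide_l:
  "of_nat l ^ r / of_nat (r + 1) * bernoulli_bi b (r + 1) ((x + of_int c) / of_nat l)
    = of_nat l ^ r / of_nat (r + 1) * bernoulli_poly (r + 1) (frac_bi b x / of_nat l)
      + bern_diff r ((\<lfloor>x - frac_bi b x\<rfloor> + c) mod int l) (frac_bi b x)"
proof -
  have "x - frac_bi b x = of_int \<lfloor>x - frac_bi b x\<rfloor>"
    using frac_bi_props(2)[of x b] by (metis floor_of_int Ints_cases)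
  from frac_bi_divide[OF l_pos this, of c] show ?thesis
    by (simp add: bernoulli_bi_def bern_diff_def right_diff_distrib)
qed

lemma smoothed_sum_bernoulli:
  fixes Q :: "('n, 'm::finite) forms"
  assumes Q: "\<And>i j. Q $ i $ j \<noteq> 0" and T: "transversal (column_rel L) T h"
  shows "(\<Prod>j\<in>UNIV. of_nat l ^ r j / of_nat (r j + 1)) * smoothed_sum (\<lambda>t. bernoulli_tuple (\<lambda>j. 1 + r j) t Q) w
    = (\<Sum>i\<in>UNIV. \<Sum>t\<in>T. \<Sum>c\<in>residue_vecs l. weight ((h t + L *v c) $ first) *
        (\<Prod>j\<in>UNIV. let x = inv_L (of_int_vec (h t) + pi_vec w) $ j; y = frac_bi (Q $ i $ j > 0) x
          in bern_diff (r j) ((\<lfloor>x - y\<rfloor> + c $ j) mod int l) y)) / of_nat CARD('m)"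
proof -
  let ?F = "\<lambda>t. bernoulli_tuple (\<lambda>j. 1 + r j) t Q"
  let ?x = "\<lambda>t. inv_L (of_int_vec (h t) + pi_vec w)"
  let ?b = "\<lambda>i j. Q $ i $ j > 0"
  have sum: "smoothed_sum ?F w = (\<Sum>t\<in>T. \<Sum>c\<in>residue_vecs l. weight ((h t + L *v c) $ first) * ?F ((1 / of_nat l) *s (?x t + of_int_vec c)))"
    by (rule smoothed_sum_L[OF bernoulli_tuple_periodic bernoulli_tuple_distribution T]) (use Q in auto)
  have F: "?F ((1 / of_nat l) *s (?x t + of_int_vec c))
    = (\<Sum>i\<in>UNIV. \<Prod>j\<in>UNIV. bernoulli_bi (?b i j) (r j + 1) ((?x t $ j + of_int (c $ j)) / of_nat l)) / of_nat CARD('m)" for t c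
    by (subst bernoulli_tuple_eq) (simp_all add: Q del: vector_add_ldistrib)
  let ?d = "\<lambda>i t j c. bern_diff (r j) ((\<lfloor>?x t $ j - frac_bi (?b i j) (?x t $ j)\<rfloor> + c) mod int l) (frac_bi (?b i j) (?x t $ j))"
  have "(\<Prod>j\<in>UNIV. of_nat l ^ r j / of_nat (r j + 1)) * smoothed_sum ?F w
    = (\<Sum>t\<in>T. \<Sum>c\<in>residue_vecs l. \<Sum>i\<in>UNIV. weight ((h t + L *v c) $ first) *
       (\<Prod>j\<in>UNIV. of_nat l ^ r j / of_nat (r j + 1) * bernoulli_bi (?b i j) (r j + 1) ((?x t $ j + of_int (c $ j)) / of_nat l))) / of_nat CARD('m)"
    unfolding sum F prod.distrib
    by (simp only: sum_distrib_left sum_divide_distrib times_divide_eq_right mult.left_commute)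
  also have "(\<Sum>t\<in>T. \<Sum>c\<in>residue_vecs l. \<Sum>i\<in>UNIV. weight ((h t + L *v c) $ first) *
       (\<Prod>j\<in>UNIV. of_nat l ^ r j / of_nat (r j + 1) * bernoulli_bi (?b i j) (r j + 1) ((?x t $ j + of_int (c $ j)) / of_nat l)))
     = (\<Sum>i\<in>UNIV. \<Sum>t\<in>T. \<Sum>c\<in>residue_vecs l. weight ((h t + L *v c) $ first) *
       (\<Prod>j\<in>UNIV. of_nat l ^ r j / of_nat (r j + 1) * bernoulli_bi (?b i j) (r j + 1) ((?x t $ j + of_int (c $ j)) / of_nat l)))"
    by (subst sum.swap[of _ UNIV "residue_vecs l"], subst sum.swap[of _ UNIV T]) (rule refl)
  also have "\<dots> = (\<Sum>i\<in>UNIV. \<Sum>t\<in>T. \<Sum>c\<in>residue_vecs l. weight ((h t + L *v c) $ first) * (\<Prod>j\<in>UNIV. ?d i t j (c $ j)))"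
  proof (rule sum.cong[OF refl], rule sum.cong[OF refl])
    fix i t
    \<comment> \<open>\<open>L\<close> and \<open>S\<close> share their first row, whose entries are
      prime to l, so the cancellation applies along every axis.\<close>
    have L: "(h t + L *v c) $ first = h t $ first + (\<Sum>j\<in>UNIV. S $ first $ j * c $ j)" for c
      by (simp add: matrix_vector_mult_def L_def)
    have d: "?d i t j x = ?d i t j y" if "int l dvd x - y" for j x y
    proof -
      have "(k + x) mod int l = (k + y) mod int l" for k using that by (simp add: mod_eq_dvd_iff)
      then show ?thesis by simp
    qed
    show "(\<Sum>c\<in>residue_vecs l. weight ((h t + L *v c) $ first) *
       (\<Prod>j\<in>UNIV. of_nat l ^ r j / of_nat (r j + 1) * bernoulli_bi (?b i j) (r j + 1) ((?x t $ j + of_int (c $ j)) / of_nat l)))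
     = (\<Sum>c\<in>residue_vecs l. weight ((h t + L *v c) $ first) * (\<Prod>j\<in>UNIV. ?d i t j (c $ j)))"
      unfolding bernoulli_bi_divide_l L by (rule weighted_sum_cancel[OF d first_row])
  qed
  finally show ?thesis by (simp only: Let_def)
qed

end

text \<open>The coefficient is the value of Q_i at row k of the inverse of B, which is a nonzero
  rational vector.\<close>

lemma forms_act_nonzero:
  fixes Q :: "('n::finite, 'm::finite) forms"
  assumes "Q \<in> linear_forms" and "det B \<noteq> 0"
  shows "forms_act (matrix_inv B) Q $ i $ k \<noteq> 0"
proof -
  have "matrix_inv B $ k \<noteq> 0"
  proof
    assume "matrix_inv B $ k = 0"
    then have "(matrix_inv B ** B) $ k $ k = 0" by (simp add: matrix_matrix_mult_def)
    then show False using matrix_inv(2)[OF assms(2)] by (simp add: mat_def)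
  qed
  then show ?thesis using assms(1) by (simp add: linear_forms_def forms_act_def)
qed

section \<open>The smoothed sums D_l\<close>

context smoothing
begin

abbreviation sigma :: "'n qmat" where "sigma \<equiv> of_int_mat S"

lemma D_l_eq:
  fixes Q :: "('n, 'm::finite) forms"
  assumes Q: "Q \<in> linear_forms" and e: "\<And>j. e j \<noteq> 0"
  shows "of_nat l ^ CARD('n) * D_l l sigma e Q w
    = of_nat l ^ (\<Sum>j\<in>UNIV. e j) * smoothed_sum (\<lambda>t. bernoulli_tuple e t (forms_act (matrix_inv sigma) Q)) w"
proof -
  note nz = forms_act_nonzero[OF Q det_nz]
  show ?thesis
    unfolding D_l_def sigma_l_eq pi_mat_eq
    using smoothed_difference[OF bernoulli_tuple_periodic bernoulli_tuple_distribution, OF nz e nz e]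
    by (simp add: det_nz)
qed

lemma
  fixes Q :: "('n, 'm::finite) forms"
  assumes Q: "Q \<in> linear_forms" and e: "\<And>j. e j \<noteq> 0"
  shows D_l_periodic: "D_l l sigma e Q (w + of_int_vec z) = D_l l sigma e Q w"
    and D_l_distribution: "N > 0 \<Longrightarrow> coprime N l \<Longrightarrow> of_nat N ^ (\<Sum>j\<in>UNIV. e j) *
        (\<Sum>y\<in>residue_vecs N. D_l l sigma e Q ((1 / of_nat N) *s (w + of_int_vec y)))
      = of_nat N ^ CARD('n) * D_l l sigma e Q w"
proof -
  note nz = forms_act_nonzero[OF Q det_nz]
  let ?F = "\<lambda>t. bernoulli_tuple e t (forms_act (matrix_inv sigma) Q)"
  let ?k = "of_nat l ^ (\<Sum>j\<in>UNIV. e j) / of_nat l ^ CARD('n) :: rat"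
  have D: "D_l l sigma e Q w = ?k * smoothed_sum ?F w" for w
    using D_l_eq[OF assms, where w = w] l_pos by (simp add: field_simps)
  show "D_l l sigma e Q (w + of_int_vec z) = D_l l sigma e Q w"
    unfolding D using smoothed_sum_periodic[OF bernoulli_tuple_periodic bernoulli_tuple_distribution, OF nz e nz e]
    by simp
  assume N: "N > 0" "coprime N l"
  have "of_nat N ^ (\<Sum>j\<in>UNIV. e j) * (\<Sum>y\<in>residue_vecs N. smoothed_sum ?F ((1 / of_nat N) *s (w + of_int_vec y)))
      = of_nat N ^ CARD('n) * smoothed_sum ?F w"
    by (rule smoothed_sum_distribution[OF bernoulli_tuple_periodic bernoulli_tuple_distribution, OF nz e nz e _ N])
  then show "of_nat N ^ (\<Sum>j\<in>UNIV. e j) *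
        (\<Sum>y\<in>residue_vecs N. D_l l sigma e Q ((1 / of_nat N) *s (w + of_int_vec y)))
      = of_nat N ^ CARD('n) * D_l l sigma e Q w"
    unfolding D sum_distrib_left[symmetric] mult.left_commute[of "of_nat N ^ _" ?k] by simp
qed

lemma D_l_bern_diff:
  fixes Q :: "('n, 'm::finite) forms"
  assumes Q: "Q \<in> linear_forms" and T: "transversal (column_rel L) T h"
  shows "D_l l sigma (\<lambda>j. 1 + r j) Q w / (\<Prod>j\<in>UNIV. of_nat (r j + 1))
    = (\<Sum>i\<in>UNIV. \<Sum>t\<in>T. \<Sum>c\<in>residue_vecs l. weight ((h t + L *v c) $ first) *
        (\<Prod>j\<in>UNIV. let x = inv_L (of_int_vec (h t) + pi_vec w) $ j;
          y = frac_bi (forms_act (matrix_inv sigma) Q $ i $ j > 0) x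
          in bern_diff (r j) ((\<lfloor>x - y\<rfloor> + c $ j) mod int l) y)) / of_nat CARD('m)"
proof -
  note nz = forms_act_nonzero[OF Q det_nz]
  let ?F = "\<lambda>t. bernoulli_tuple (\<lambda>j. 1 + r j) t (forms_act (matrix_inv sigma) Q)"
  have "of_nat l ^ CARD('n) * D_l l sigma (\<lambda>j. 1 + r j) Q w
    = of_nat l ^ (\<Sum>j\<in>UNIV. 1 + r j) * smoothed_sum ?F w"
    by (rule D_l_eq[OF Q]) simp
  also have "(\<Sum>j\<in>UNIV. 1 + r j) = CARD('n) + (\<Sum>j\<in>UNIV. r j)" by (subst sum.distrib) simp
  finally have "D_l l sigma (\<lambda>j. 1 + r j) Q w = of_nat l ^ (\<Sum>j\<in>UNIV. r j) * smoothed_sum ?F w"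
    using l_pos by (simp add: power_add)
  then have "D_l l sigma (\<lambda>j. 1 + r j) Q w / (\<Prod>j\<in>UNIV. of_nat (r j + 1))
    = (\<Prod>j\<in>UNIV. of_nat l ^ r j / of_nat (r j + 1)) * smoothed_sum ?F w"
    by (simp add: power_sum prod_dividef)
  then show ?thesis unfolding smoothed_sum_bernoulli[OF nz T] .
qed

end

section \<open>Evaluation of polynomials\<close>

abbreviation qpoly_eval :: "('n::finite \<Rightarrow> rat) \<Rightarrow> 'n qpoly \<Rightarrow> rat" where
  "qpoly_eval \<equiv> qpoly_insert (\<lambda>c. c)"

lemma qpoly_eval_superset:
  assumes "finite K" "Poly_Mapping.keys P \<subseteq> K"
  shows "qpoly_eval x P = (\<Sum>r\<in>K. Poly_Mapping.lookup P r * (\<Prod>j\<in>UNIV. x j ^ Poly_Mapping.lookup r j))"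
  unfolding qpoly_insert_def
  by (rule sum.mono_neutral_left) (use assms in \<open>auto simp: in_keys_iff\<close>)

lemma qpoly_eval_add: "qpoly_eval x (P + R) = qpoly_eval x P + qpoly_eval x R"
proof -
  let ?K = "Poly_Mapping.keys P \<union> Poly_Mapping.keys R"
  have "qpoly_eval x (P + R) = (\<Sum>r\<in>?K. Poly_Mapping.lookup (P + R) r * (\<Prod>j\<in>UNIV. x j ^ Poly_Mapping.lookup r j))"
    by (rule qpoly_eval_superset[OF _ keys_add]) simp
  moreover have "qpoly_eval x P = (\<Sum>r\<in>?K. Poly_Mapping.lookup P r * (\<Prod>j\<in>UNIV. x j ^ Poly_Mapping.lookup r j))"
    by (rule qpoly_eval_superset) auto
  moreover have "qpoly_eval x R = (\<Sum>r\<in>?K. Poly_Mapping.lookup R r * (\<Prod>j\<in>UNIV. x j ^ Poly_Mapping.lookup r j))"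
    by (rule qpoly_eval_superset) auto
  ultimately show ?thesis by (simp add: lookup_add distrib_right sum.distrib)
qed

lemma qpoly_eval_sum: "qpoly_eval x (sum f I) = (\<Sum>i\<in>I. qpoly_eval x (f i))"
  by (induction I rule: infinite_finite_induct) (auto simp: qpoly_eval_add, simp_all add: qpoly_insert_def)

lemma qpoly_eval_single: "qpoly_eval x (Poly_Mapping.single r a) = a * (\<Prod>j\<in>UNIV. x j ^ Poly_Mapping.lookup r j)"
  by (subst qpoly_eval_superset[of "{r}"]) auto

lemma qpoly_eq_sum_single: "(\<Sum>r\<in>Poly_Mapping.keys P. Poly_Mapping.single r (Poly_Mapping.lookup P r)) = P"
  by (rule poly_mapping_eqI)
    (auto simp: lookup_sum lookup_single when_def in_keys_iff sum.delta[OF finite_keys] cong: if_cong)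

lemma qpoly_eval_mult: "qpoly_eval x (P * R) = qpoly_eval x P * qpoly_eval x R"
proof -
  have single: "qpoly_eval x (Poly_Mapping.single r a * Poly_Mapping.single s b)
    = qpoly_eval x (Poly_Mapping.single r a) * qpoly_eval x (Poly_Mapping.single s b)" for r s a b
    by (simp add: mult_single qpoly_eval_single lookup_add power_add prod.distrib)
  let ?s = "\<lambda>P r. Poly_Mapping.single r (Poly_Mapping.lookup P r)"
  have "qpoly_eval x (P * R) = qpoly_eval x ((\<Sum>r\<in>Poly_Mapping.keys P. ?s P r) * (\<Sum>r\<in>Poly_Mapping.keys R. ?s R r))"
    by (simp only: qpoly_eq_sum_single)
  also have "\<dots> = qpoly_eval x (\<Sum>r\<in>Poly_Mapping.keys P. ?s P r) * qpoly_eval x (\<Sum>r\<in>Poly_Mapping.keys R. ?s R r)"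
    by (simp only: sum_product qpoly_eval_sum single)
  finally show ?thesis by (simp only: qpoly_eq_sum_single)
qed

lemma qpoly_eval_const: "qpoly_eval x (qpoly_const a) = a"
  by (simp add: qpoly_eval_single)

lemma qpoly_eval_1: "qpoly_eval x 1 = 1"
  using qpoly_eval_const[of x 1] by simp

lemma qpoly_eval_var: "qpoly_eval x (qpoly_var k) = x k"
proof -
  have "(\<Prod>j\<in>UNIV. x j ^ Poly_Mapping.lookup (Poly_Mapping.single k 1) j) = (\<Prod>j\<in>UNIV. if j = k then x j else 1)"
    by (intro prod.cong) (auto simp: lookup_single)
  then show ?thesis by (simp add: qpoly_eval_single)
qed

lemma qpoly_eval_power: "qpoly_eval x (P ^ k) = qpoly_eval x P ^ k"
  by (induction k) (auto simp: qpoly_eval_mult qpoly_eval_1)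

lemma qpoly_eval_prod: "qpoly_eval x (prod f I) = (\<Prod>i\<in>I. qpoly_eval x (f i))"
  by (induction I rule: infinite_finite_induct) (auto simp: qpoly_eval_mult qpoly_eval_1)

text \<open>At x = sigma^{-1}(v + a) this recovers P(v + a) from the coefficients P_r of the
  cocycle.\<close>

lemma qpoly_eval_transform:
  "qpoly_eval (\<lambda>j. x $ j) (qpoly_transform \<sigma> P) = qpoly_eval (\<lambda>i. (\<sigma> *v x) $ i) P"
  by (simp add: qpoly_transform_def qpoly_insert_def[of "qpoly_const"] qpoly_eval_sum qpoly_eval_mult
      qpoly_eval_prod qpoly_eval_power qpoly_eval_const qpoly_eval_var[unfolded One_nat_def] matrix_vector_mult_def)
    (simp add: qpoly_insert_def)

section \<open>Homogeneous polynomials and homogeneous parts\<close>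

definition qpoly_homogeneous :: "nat \<Rightarrow> 'n::finite qpoly \<Rightarrow> bool" where
  "qpoly_homogeneous d P \<longleftrightarrow> (\<forall>r\<in>Poly_Mapping.keys P. total r = d)"

lemma total_0 [simp]: "total 0 = 0"
  by (simp add: total_def)

lemma total_add: "total (r + s) = total r + total s"
  by (simp add: total_def lookup_add sum.distrib)

lemma qpoly_homogeneous_mult:
  "qpoly_homogeneous d P \<Longrightarrow> qpoly_homogeneous e R \<Longrightarrow> qpoly_homogeneous (d + e) (P * R)"
  using keys_mult[of P R] by (fastforce simp: qpoly_homogeneous_def total_add)

lemma qpoly_homogeneous_sum:
  "(\<And>i. i \<in> I \<Longrightarrow> qpoly_homogeneous d (f i)) \<Longrightarrow> qpoly_homogeneous d (sum f I)"
  using keys_sum[of f I] by (fastforce simp: qpoly_homogeneous_def)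

lemma qpoly_homogeneous_const: "qpoly_homogeneous 0 (qpoly_const a)"
  by (simp add: qpoly_homogeneous_def)

lemma qpoly_homogeneous_1: "qpoly_homogeneous 0 1"
  by (simp add: qpoly_homogeneous_def)

lemma qpoly_homogeneous_var: "qpoly_homogeneous 1 (qpoly_var k)"
  by (simp add: qpoly_homogeneous_def total_def lookup_single when_def)

lemma qpoly_homogeneous_power: "qpoly_homogeneous d P \<Longrightarrow> qpoly_homogeneous (k * d) (P ^ k)"
  by (induction k) (auto intro: qpoly_homogeneous_mult qpoly_homogeneous_1)

lemma qpoly_homogeneous_prod:
  "(\<And>i. i \<in> I \<Longrightarrow> qpoly_homogeneous (d i) (f i)) \<Longrightarrow> qpoly_homogeneous (sum d I) (prod f I)"
  by (induction I rule: infinite_finite_induct) (auto intro: qpoly_homogeneous_mult qpoly_homogeneous_1)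

lemma qpoly_homogeneous_transform:
  assumes "qpoly_homogeneous d P"
  shows "qpoly_homogeneous d (qpoly_transform \<sigma> P)"
  unfolding qpoly_transform_def qpoly_insert_def
proof (rule qpoly_homogeneous_sum)
  fix r assume "r \<in> Poly_Mapping.keys P"
  then have d: "d = 0 + (\<Sum>i\<in>UNIV. Poly_Mapping.lookup r i * 1)" using assms by (auto simp: qpoly_homogeneous_def total_def)
  have "qpoly_homogeneous (0 + 1) (\<Sum>j\<in>UNIV. qpoly_const (\<sigma> $ i $ j) * qpoly_var j)" for i
    by (intro qpoly_homogeneous_sum qpoly_homogeneous_mult qpoly_homogeneous_const qpoly_homogeneous_var)
  then show "qpoly_homogeneous d (qpoly_const (Poly_Mapping.lookup P r) *
     (\<Prod>i\<in>UNIV. (\<Sum>j\<in>UNIV. qpoly_const (\<sigma> $ i $ j) * qpoly_var j) ^ Poly_Mapping.lookup r i))"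
    unfolding d by (intro qpoly_homogeneous_mult qpoly_homogeneous_const qpoly_homogeneous_prod qpoly_homogeneous_power) simp
qed

text \<open>Sums over all r of a given degree would be 0 by convention if this set were
  infinite.\<close>

lemma finite_total: "finite {r :: 'n::finite \<Rightarrow>\<^sub>0 nat. total r = d}"
proof (rule finite_imageD)
  show "inj_on Poly_Mapping.lookup {r :: 'n \<Rightarrow>\<^sub>0 nat. total r = d}"
    by (simp add: inj_on_def lookup_inject)
  show "finite (Poly_Mapping.lookup ` {r :: 'n \<Rightarrow>\<^sub>0 nat. total r = d})"
  proof (rule finite_subset)
    show "Poly_Mapping.lookup ` {r :: 'n \<Rightarrow>\<^sub>0 nat. total r = d} \<subseteq> PiE UNIV (\<lambda>_. {..d})"
      by (auto simp: total_def intro: member_le_sum)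
  qed (simp add: finite_PiE)
qed

lemma qpoly_eval_homogeneous:
  assumes "qpoly_homogeneous d P"
  shows "qpoly_eval x P = (\<Sum>r | total r = d. Poly_Mapping.lookup P r * (\<Prod>j\<in>UNIV. x j ^ Poly_Mapping.lookup r j))"
  by (rule qpoly_eval_superset[OF finite_total]) (use assms in \<open>auto simp: qpoly_homogeneous_def\<close>)

lemma keys_homogeneous_part:
  "Poly_Mapping.keys (homogeneous_part d P) \<subseteq> {r \<in> Poly_Mapping.keys P. total r = d}"
  unfolding homogeneous_part_def by (rule order_trans[OF keys_sum]) (auto split: if_splits)

lemma qpoly_homogeneous_part: "qpoly_homogeneous d (homogeneous_part d P)"
  using keys_homogeneous_part unfolding qpoly_homogeneous_def by blast

lemma qpoly_eval_parts:
  "qpoly_eval x P = (\<Sum>d\<in>total ` Poly_Mapping.keys P. qpoly_eval x (homogeneous_part d P))"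
proof -
  have "qpoly_eval x P = (\<Sum>d\<in>total ` Poly_Mapping.keys P. \<Sum>r | r \<in> Poly_Mapping.keys P \<and> total r = d.
      Poly_Mapping.lookup P r * (\<Prod>j\<in>UNIV. x j ^ Poly_Mapping.lookup r j))"
    unfolding qpoly_insert_def by (rule sum.image_gen) simp
  then show ?thesis by (simp add: homogeneous_part_def qpoly_eval_sum qpoly_eval_single)
qed

lemma qpoly_insert_of_rat:
  "qpoly_insert of_rat (\<lambda>j. of_rat (x j)) P = (of_rat (qpoly_eval x P) :: 'a::field_char_0)"
  by (simp add: qpoly_insert_def of_rat_sum of_rat_mult of_rat_prod of_rat_power)

section \<open>p-adic estimates for families of rational numbers\<close>

text \<open>The families are later indexed by the pairs (k, a). The bound is uniform over the
  family, which is why whole families are estimated and not single numbers.\<close>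

definition padic_bounded :: "nat \<Rightarrow> ('s \<Rightarrow> rat) \<Rightarrow> bool" where
  "padic_bounded p F \<longleftrightarrow> (\<exists>C. \<forall>s. padic_abs p (F s) \<le> C)"

text \<open>F = G + O(N) uniformly in s, to be applied with N = p^k.\<close>

definition padic_cong :: "nat \<Rightarrow> ('s \<Rightarrow> rat) \<Rightarrow> ('s \<Rightarrow> rat) \<Rightarrow> ('s \<Rightarrow> rat) \<Rightarrow> bool" where
  "padic_cong p N F G \<longleftrightarrow> padic_bounded p (\<lambda>s. (F s - G s) / N s)"

lemma padic_bounded_nonneg:
  assumes "prime p" "padic_bounded p F"
  obtains C where "C \<ge> 0" "\<And>s. padic_abs p (F s) \<le> C"
  using assms unfolding padic_bounded_def
  by (metis padic_abs_nonneg order_trans)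

lemma padic_abs_of_int_le: "prime p \<Longrightarrow> padic_abs p (of_int a) \<le> 1"
  using padic_abs_le_1I[of p 1 a] by (metis div_by_1 int_dvd_int_iff nat_dvd_1_iff_1 not_prime_1 of_int_1 of_nat_1)

context
  fixes p :: nat
  assumes p: "prime p"
begin

lemma padic_bounded_const: "padic_bounded p (\<lambda>s. c)"
  by (auto simp: padic_bounded_def)

lemma padic_bounded_of_int: "padic_bounded p (\<lambda>s. of_int (f s))"
  using padic_abs_of_int_le[OF p] by (auto simp: padic_bounded_def)

lemma padic_bounded_add:
  assumes "padic_bounded p F" "padic_bounded p G"
  shows "padic_bounded p (\<lambda>s. F s + G s)"
proof -
  obtain B C where "\<And>s. padic_abs p (F s) \<le> B" "\<And>s. padic_abs p (G s) \<le> C"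
    using assms by (auto simp: padic_bounded_def)
  then have "padic_abs p (F s + G s) \<le> max B C" for s
    using padic_abs_add[OF p, of "F s" "G s"] by (meson max.mono order_trans)
  then show ?thesis unfolding padic_bounded_def by blast
qed

lemma padic_bounded_mult:
  assumes "padic_bounded p F" "padic_bounded p G"
  shows "padic_bounded p (\<lambda>s. F s * G s)"
proof -
  obtain B where B: "B \<ge> 0" "\<And>s. padic_abs p (F s) \<le> B" using padic_bounded_nonneg[OF p assms(1)] by blast
  obtain C where C: "C \<ge> 0" "\<And>s. padic_abs p (G s) \<le> C" using padic_bounded_nonneg[OF p assms(2)] by blast
  have "padic_abs p (F s * G s) \<le> B * C" for s
    unfolding padic_abs_mult[OF p] by (intro mult_mono B C padic_abs_nonneg[OF p])
  then show ?thesis unfolding padic_bounded_def by blast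
qed

lemma padic_bounded_minus: "padic_bounded p F \<Longrightarrow> padic_bounded p (\<lambda>s. - F s)"
  by (simp add: padic_bounded_def padic_abs_minus[OF p])

lemma padic_bounded_diff: "padic_bounded p F \<Longrightarrow> padic_bounded p G \<Longrightarrow> padic_bounded p (\<lambda>s. F s - G s)"
  using padic_bounded_add[OF _ padic_bounded_minus] by simp

lemma padic_bounded_sum:
  "(\<And>i. i \<in> I \<Longrightarrow> padic_bounded p (F i)) \<Longrightarrow> padic_bounded p (\<lambda>s. \<Sum>i\<in>I. F i s)"
  by (induction I rule: infinite_finite_induct) (auto intro: padic_bounded_const padic_bounded_add)

lemma padic_bounded_power: "padic_bounded p F \<Longrightarrow> padic_bounded p (\<lambda>s. F s ^ k)"
  by (induction k) (auto intro: padic_bounded_const padic_bounded_mult)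

lemma padic_cong_refl: "padic_cong p N F F"
  by (simp add: padic_cong_def padic_bounded_const)

lemma padic_cong_trans: "padic_cong p N F G \<Longrightarrow> padic_cong p N G H \<Longrightarrow> padic_cong p N F H"
  unfolding padic_cong_def by (drule (1) padic_bounded_add) (simp add: diff_divide_distrib)

lemma padic_cong_sum:
  assumes "\<And>i. i \<in> I \<Longrightarrow> padic_cong p N (F i) (G i)"
  shows "padic_cong p N (\<lambda>s. \<Sum>i\<in>I. F i s) (\<lambda>s. \<Sum>i\<in>I. G i s)"
  using padic_bounded_sum[OF assms[unfolded padic_cong_def]]
  by (simp add: padic_cong_def sum_divide_distrib diff_divide_distrib sum_subtractf)

lemma padic_cong_mult:
  assumes "padic_cong p N F F'" "padic_cong p N G G'" "padic_bounded p F" "padic_bounded p G'"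
  shows "padic_cong p N (\<lambda>s. F s * G s) (\<lambda>s. F' s * G' s)"
proof -
  have "padic_bounded p (\<lambda>s. F s * ((G s - G' s) / N s) + (F s - F' s) / N s * G' s)"
    using assms unfolding padic_cong_def by (intro padic_bounded_add padic_bounded_mult)
  then show ?thesis
    by (simp add: padic_cong_def add_divide_distrib[symmetric] algebra_simps)
qed

lemma padic_cong_mult_left: "padic_cong p N F G \<Longrightarrow> padic_cong p N (\<lambda>s. c * F s) (\<lambda>s. c * G s)"
  using padic_bounded_mult[OF padic_bounded_const]
  by (fastforce simp: padic_cong_def right_diff_distrib[symmetric] times_divide_eq_right[symmetric] simp del: times_divide_eq_right)

lemma padic_bounded_prod:
  "(\<And>i. i \<in> I \<Longrightarrow> padic_bounded p (F i)) \<Longrightarrow> padic_bounded p (\<lambda>s. \<Prod>i\<in>I. F i s)"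
  by (induction I rule: infinite_finite_induct) (auto intro: padic_bounded_const padic_bounded_mult)

lemma padic_cong_prod:
  assumes "\<And>i. i \<in> I \<Longrightarrow> padic_cong p N (F i) (G i)"
    "\<And>i. i \<in> I \<Longrightarrow> padic_bounded p (F i)" "\<And>i. i \<in> I \<Longrightarrow> padic_bounded p (G i)"
  shows "padic_cong p N (\<lambda>s. \<Prod>i\<in>I. F i s) (\<lambda>s. \<Prod>i\<in>I. G i s)"
  using assms
  by (induction I rule: infinite_finite_induct)
    (auto intro!: padic_cong_refl padic_cong_mult padic_bounded_prod)

lemma padic_cong_power:
  assumes "padic_cong p N F G" "padic_bounded p F" "padic_bounded p G"
  shows "padic_cong p N (\<lambda>s. F s ^ k) (\<lambda>s. G s ^ k)"
  using padic_cong_prod[of "{..<k}" N "\<lambda>_. F" "\<lambda>_. G"] assms by simp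

text \<open>The condition N s \<noteq> 0 excludes the convention x / 0 = 0, under which the
  congruence would say nothing about F.\<close>

lemma padic_cong_bounded:
  assumes "padic_cong p N F G" "padic_bounded p N" "padic_bounded p G" and "\<And>s. N s \<noteq> 0"
  shows "padic_bounded p F"
proof -
  have "padic_bounded p (\<lambda>s. N s * ((F s - G s) / N s) + G s)"
    using assms unfolding padic_cong_def by (intro padic_bounded_add padic_bounded_mult)
  then show ?thesis using assms(4) by simp
qed

end

section \<open>Congruences for the smoothed cocycle\<close>

context smoothing
begin

text \<open>In degree 0 there is no error term. This exact value yields the integrality, and it
  identifies the leading sum in the congruences with D_l at r = 0.\<close>

lemma bern_diff_0: "bern_diff 0 c y = of_int c / of_nat l"
  using l_pos by (simp add: bern_diff_def bernoulli_poly_1[unfolded One_nat_def] field_simps)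

text \<open>B_{r+1} is expanded in powers of its argument, and (y + c)^i - y^i has degree i - 1 in
  y. The power y^r arises only from i = r + 1, h = r.\<close>

lemma bern_diff_expand:
  "bern_diff r c y = of_int c / of_nat l * y ^ r + of_nat l ^ r / of_nat (r + 1) *
     ((\<Sum>h<r. of_nat (Suc r choose h) / of_nat l ^ Suc r * (y ^ h * of_int c ^ (Suc r - h)))
      + (\<Sum>i\<le>r. \<Sum>h<i. of_nat (Suc r choose i) * bernoulli_poly (Suc r - i) 0 / of_nat l ^ i * of_nat (i choose h)
          * (y ^ h * of_int c ^ (i - h))))"
proof -
  let ?a = "\<lambda>i. of_nat (Suc r choose i) * bernoulli_poly (Suc r - i) 0 / of_nat l ^ i :: rat"
  have binom: "(y + of_int c) ^ i - y ^ i = (\<Sum>h<i. of_nat (i choose h) * (y ^ h * of_int c ^ (i - h)))" for i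
    by (simp add: binomial_ring lessThan_Suc_atMost[symmetric] mult.assoc)
  have "bernoulli_poly (Suc r) (u / of_nat l) = (\<Sum>i\<le>Suc r. ?a i * u ^ i)" for u :: rat
    using bernoulli_poly_add[of "Suc r" 0 "u / of_nat l"] by (simp add: power_divide)
  then have "bernoulli_poly (r + 1) ((y + of_int c) / of_nat l) - bernoulli_poly (r + 1) (y / of_nat l)
    = (\<Sum>i\<le>Suc r. ?a i * ((y + of_int c) ^ i - y ^ i))"
    by (simp only: Suc_eq_plus1[symmetric] right_diff_distrib sum_subtractf)
  also have "\<dots> = (\<Sum>i\<le>r. ?a i * ((y + of_int c) ^ i - y ^ i)) + ?a (Suc r) * ((y + of_int c) ^ Suc r - y ^ Suc r)"
    by (simp only: sum.atMost_Suc)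
  also have "(y + of_int c) ^ Suc r - y ^ Suc r
     = (\<Sum>h<r. of_nat (Suc r choose h) * (y ^ h * of_int c ^ (Suc r - h))) + of_nat (r + 1) * (y ^ r * of_int c)"
    by (simp only: binom sum.lessThan_Suc) simp
  also have "?a (Suc r) = 1 / of_nat l ^ Suc r" by simp
  finally have eq: "bernoulli_poly (r + 1) ((y + of_int c) / of_nat l) - bernoulli_poly (r + 1) (y / of_nat l)
    = (\<Sum>i\<le>r. \<Sum>h<i. ?a i * of_nat (i choose h) * (y ^ h * of_int c ^ (i - h)))
      + ((\<Sum>h<r. of_nat (Suc r choose h) / of_nat l ^ Suc r * (y ^ h * of_int c ^ (Suc r - h)))
      + 1 / of_nat l ^ Suc r * (of_nat (r + 1) * (y ^ r * of_int c)))"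
    unfolding binom distrib_left by (simp add: sum_distrib_left sum_divide_distrib mult.assoc)
  have "of_nat l ^ r / of_nat (r + 1) * (1 / of_nat l ^ Suc r * (of_nat (r + 1) * (y ^ r * of_int c))) = of_int c / of_nat l * y ^ r"
    using l_pos by (simp add: divide_simps del: of_nat_Suc of_nat_add)
  then show ?thesis
    unfolding bern_diff_def eq distrib_left by (simp only: ac_simps)
qed

text \<open>Although y may be unbounded, N y is bounded, and N^r y^h = N^{r-h} (N y)^h is a bounded
  multiple of N for h < r.\<close>

lemma bern_diff_cong:
  assumes p: "prime p" and N: "padic_bounded p N" "\<And>s. N s \<noteq> 0" and y: "padic_bounded p (\<lambda>s. N s * y s)"
  shows "padic_cong p N (\<lambda>s. N s ^ r * bern_diff r (c s) (y s)) (\<lambda>s. of_int (c s) / of_nat l * (N s * y s) ^ r)"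
proof -
  have lower: "padic_bounded p (\<lambda>s. N s ^ r * (y s ^ h * of_int (c s) ^ m) / N s)" if "h < r" for h m
  proof -
    have "N s ^ r * (y s ^ h * of_int (c s) ^ m) / N s = N s ^ (r - 1 - h) * ((N s * y s) ^ h * of_int (c s) ^ m)" for s
    proof -
      have "N s ^ r = N s * (N s ^ (r - 1 - h) * N s ^ h)"
        using that by (simp flip: power_add power_Suc)
      then show ?thesis using N(2)[of s] by (simp add: power_mult_distrib)
    qed
    then show ?thesis
      by (auto intro!: padic_bounded_mult[OF p] padic_bounded_power[OF p] padic_bounded_of_int[OF p] N y)
  qed
  \<comment> \<open>Pure rearrangement: the leading terms cancel, and the factor N^r / N moves
    inside the sums to meet the bound \<open>lower\<close>.\<close>
  have expand: "(N s ^ r * (of_int (c s) / of_nat l * y s ^ r + K * ((\<Sum>h<r. \<alpha> h * t h) + (\<Sum>i\<le>r. \<Sum>h<i. \<beta> i h * u i h)))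
      - of_int (c s) / of_nat l * (N s * y s) ^ r) / N s
    = K * ((\<Sum>h<r. \<alpha> h * (N s ^ r * t h / N s)) + (\<Sum>i\<le>r. \<Sum>h<i. \<beta> i h * (N s ^ r * u i h / N s)))"
    for s K and \<alpha> t :: "nat \<Rightarrow> rat" and \<beta> u :: "nat \<Rightarrow> nat \<Rightarrow> rat"
  proof -
    have *: "(n * (A + K * (B + C)) - A') / M = K * ((n / M) * B + (n / M) * C)" if "n * A = A'" for n A A' M B C :: rat
      using that[symmetric] by (simp add: distrib_left mult.left_commute[of n K] add_divide_distrib)
    have "(N s ^ r * (of_int (c s) / of_nat l * y s ^ r + K * ((\<Sum>h<r. \<alpha> h * t h) + (\<Sum>i\<le>r. \<Sum>h<i. \<beta> i h * u i h)))
      - of_int (c s) / of_nat l * (N s * y s) ^ r) / N s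
      = K * ((N s ^ r / N s) * (\<Sum>h<r. \<alpha> h * t h) + (N s ^ r / N s) * (\<Sum>i\<le>r. \<Sum>h<i. \<beta> i h * u i h))"
      by (rule *) (simp add: power_mult_distrib)
    then show ?thesis by (simp add: sum_distrib_left mult.left_commute)
  qed
  have eq: "(N s ^ r * bern_diff r (c s) (y s) - of_int (c s) / of_nat l * (N s * y s) ^ r) / N s
     = of_nat l ^ r / of_nat (r + 1) *
     ((\<Sum>h<r. of_nat (Suc r choose h) / of_nat l ^ Suc r * (N s ^ r * (y s ^ h * of_int (c s) ^ (Suc r - h)) / N s))
      + (\<Sum>i\<le>r. \<Sum>h<i. of_nat (Suc r choose i) * bernoulli_poly (Suc r - i) 0 / of_nat l ^ i * of_nat (i choose h)
          * (N s ^ r * (y s ^ h * of_int (c s) ^ (i - h)) / N s)))" for s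
    unfolding bern_diff_expand by (rule expand)
  show ?thesis unfolding padic_cong_def eq
    by (intro padic_bounded_mult[OF p] padic_bounded_const[OF p] padic_bounded_add[OF p] padic_bounded_sum[OF p] lower)
      auto
qed

text \<open>Each fractional part Y satisfies N Y = l U + O(N) with U a coordinate of sigma^{-1}(v +
  a), so its factor is (k/l) (l U)^r + O(N). The powers of l U do not depend on i, t, c and leave
  the sum; the integers k do not depend on r, so what remains is D_l at r = 0.\<close>

lemma D_l_cong:
  fixes Q :: "('n, 'm::finite) forms" and N :: "'s \<Rightarrow> rat" and a :: "'s \<Rightarrow> 'n zvec"
    and v :: "'n qvec"
  assumes p: "prime p" and Q: "Q \<in> linear_forms" and N: "padic_bounded p N" "\<And>s. N s \<noteq> 0"
  defines "w \<equiv> \<lambda>s. (1 / N s) *s (v + of_int_vec (a s))"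
  shows "padic_cong p N
    (\<lambda>s. N s ^ (\<Sum>j\<in>UNIV. r j) * (D_l l sigma (\<lambda>j. 1 + r j) Q (w s) / (\<Prod>j\<in>UNIV. of_nat (r j + 1))))
    (\<lambda>s. of_nat l ^ (\<Sum>j\<in>UNIV. r j) * (\<Prod>j\<in>UNIV. (inv_S (v + of_int_vec (a s)) $ j) ^ r j) * D_l l sigma (\<lambda>j. 1) Q (w s))"
proof -
  obtain T :: "'n zvec set set" and h where T: "transversal (column_rel L) T h"
    using exists_transversal[OF det_L_nz] .
  let ?b = "\<lambda>i j. forms_act (matrix_inv sigma) Q $ i $ j > 0"
  define X where "X t j s = inv_L (of_int_vec (h t) + pi_vec (w s)) $ j" for t j s
  define Y where "Y i t j s = frac_bi (?b i j) (X t j s)" for i t j s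
  define k where "k i t c j s = (\<lfloor>X t j s - Y i t j s\<rfloor> + c $ j) mod int l" for i t j s and c :: "'n zvec"
  define U where "U j s = inv_S (v + of_int_vec (a s)) $ j" for j s
  have D: "D_l l sigma (\<lambda>j. 1 + r j) Q (w s) / (\<Prod>j\<in>UNIV. of_nat (r j + 1))
    = (\<Sum>i\<in>UNIV. \<Sum>t\<in>T. \<Sum>c\<in>residue_vecs l. weight ((h t + L *v c) $ first) *
        (\<Prod>j\<in>UNIV. bern_diff (r j) (k i t c j s) (Y i t j s))) / of_nat CARD('m)" for r s
    unfolding D_l_bern_diff[OF Q T] Let_def X_def Y_def k_def ..
  have U: "padic_bounded p (U j)" for j
    unfolding U_def matrix_vector_mult_def
    by (auto intro!: padic_bounded_sum[OF p] padic_bounded_mult[OF p] padic_bounded_const[OF p] padic_bounded_add[OF p] padic_bounded_of_int[OF p])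
  \<comment> \<open>Multiplication by N turns w into v + a, and sigma_l^{-1} pi_l = l
    sigma^{-1}.\<close>
  have NX: "N s * X t j s = N s * inv_L (of_int_vec (h t)) $ j + of_nat l * U j s" for t j s
  proof -
    have "N s *s pi_vec (w s) = pi_vec (v + of_int_vec (a s))"
      using N(2)[of s] by (simp add: w_def vector_scalar_commute[symmetric] del: vector_add_ldistrib)
    then have "N s * inv_L (pi_vec (w s)) $ j = inv_L (pi_vec (v + of_int_vec (a s))) $ j"
      by (metis vector_scalar_commute vector_smult_component)
    then show ?thesis
      by (simp add: X_def U_def matrix_vector_right_distrib distrib_left inv_L_pi)
  qed
  have Y: "Y i t j s = X t j s - of_int \<lfloor>X t j s - Y i t j s\<rfloor>" for i t j s
    using frac_bi_props(2)[of "X t j s" "?b i j"] unfolding Y_def[symmetric] by (auto elim!: Ints_cases)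
  have lU: "padic_bounded p (\<lambda>s. of_nat l * U j s)" for j
    by (intro padic_bounded_mult[OF p] padic_bounded_const[OF p] U)
  \<comment> \<open>The representative h t contributes a constant and the fractional part removes an
    integer; both are bounded, hence O(N) after multiplication by N.\<close>
  have NY: "padic_cong p N (\<lambda>s. N s * Y i t j s) (\<lambda>s. of_nat l * U j s)" for i t j
  proof -
    have "(N s * Y i t j s - of_nat l * U j s) / N s = inv_L (of_int_vec (h t)) $ j - of_int \<lfloor>X t j s - Y i t j s\<rfloor>" for s
      by (subst Y) (use N(2)[of s] in \<open>simp add: right_diff_distrib NX diff_divide_distrib\<close>)
    then show ?thesis unfolding padic_cong_def
      by (simp add: padic_bounded_diff[OF p] padic_bounded_const[OF p] padic_bounded_of_int[OF p])
  qed
  note bNY = padic_cong_bounded[OF p NY N(1) lU N(2)]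
  have kl: "padic_bounded p (\<lambda>s. of_int (k i t c j s) / of_nat l)" for i t c j
    unfolding divide_inverse by (intro padic_bounded_mult[OF p] padic_bounded_const[OF p] padic_bounded_of_int[OF p])
  have bern: "padic_cong p N (\<lambda>s. N s ^ r j * bern_diff (r j) (k i t c j s) (Y i t j s))
     (\<lambda>s. of_int (k i t c j s) / of_nat l * (of_nat l * U j s) ^ r j)" for i t c j
    by (rule padic_cong_trans[OF p bern_diff_cong[OF p N bNY]])
      (intro padic_cong_mult[OF p] padic_cong_refl[OF p] padic_cong_power[OF p] padic_bounded_power[OF p] kl NY bNY lU)
  have bern_bd: "padic_bounded p (\<lambda>s. of_int (k i t c j s) / of_nat l * (of_nat l * U j s) ^ r j)" for i t c j
    by (intro padic_bounded_mult[OF p] padic_bounded_power[OF p] kl lU)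
  note bern_bd' = padic_cong_bounded[OF p bern N(1) bern_bd N(2)]
  have "padic_cong p N
    (\<lambda>s. 1 / of_nat CARD('m) * (\<Sum>i\<in>UNIV. \<Sum>t\<in>T. \<Sum>c\<in>residue_vecs l. weight ((h t + L *v c) $ first) *
        (\<Prod>j\<in>UNIV. N s ^ r j * bern_diff (r j) (k i t c j s) (Y i t j s))))
    (\<lambda>s. 1 / of_nat CARD('m) * (\<Sum>i\<in>UNIV. \<Sum>t\<in>T. \<Sum>c\<in>residue_vecs l. weight ((h t + L *v c) $ first) *
        (\<Prod>j\<in>UNIV. of_int (k i t c j s) / of_nat l * (of_nat l * U j s) ^ r j)))"
    by (intro padic_cong_sum[OF p] padic_cong_mult_left[OF p] padic_cong_prod[OF p] bern bern_bd bern_bd')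
  moreover have "1 / of_nat CARD('m) * (\<Sum>i\<in>UNIV. \<Sum>t\<in>T. \<Sum>c\<in>residue_vecs l. weight ((h t + L *v c) $ first) *
        (\<Prod>j\<in>UNIV. N s ^ r j * bern_diff (r j) (k i t c j s) (Y i t j s)))
    = N s ^ (\<Sum>j\<in>UNIV. r j) * (D_l l sigma (\<lambda>j. 1 + r j) Q (w s) / (\<Prod>j\<in>UNIV. of_nat (r j + 1)))" for s
    unfolding D prod.distrib power_sum
    by (simp add: sum_distrib_left sum_divide_distrib mult.left_commute[of "\<Prod>j\<in>UNIV. N s ^ r j"])
  moreover have "1 / of_nat CARD('m) * (\<Sum>i\<in>UNIV. \<Sum>t\<in>T. \<Sum>c\<in>residue_vecs l. weight ((h t + L *v c) $ first) *
        (\<Prod>j\<in>UNIV. of_int (k i t c j s) / of_nat l * (of_nat l * U j s) ^ r j))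
    = of_nat l ^ (\<Sum>j\<in>UNIV. r j) * (\<Prod>j\<in>UNIV. U j s ^ r j) * D_l l sigma (\<lambda>j. 1) Q (w s)" for s
  proof -
    have "(\<Prod>j\<in>UNIV. of_int (k i t c j s) / of_nat l * (of_nat l * U j s) ^ r j)
      = (of_nat l ^ (\<Sum>j\<in>UNIV. r j) * (\<Prod>j\<in>UNIV. U j s ^ r j)) * (\<Prod>j\<in>UNIV. of_int (k i t c j s) / of_nat l)" for i t c
      unfolding prod.distrib power_mult_distrib power_sum by (simp only: ac_simps)
    then show ?thesis
      \<comment> \<open>For r = 0 every \<open>bern_diff\<close> is exactly k/l, so the remaining
        sum of products of the k/l is D_l.\<close>
      using D[of "\<lambda>j. 0" s]
      by (simp add: bern_diff_0 sum_distrib_left sum_divide_distrib mult.left_commute[of _ "of_nat l ^ _ * _"])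
  qed
  ultimately show ?thesis unfolding U_def by simp
qed

text \<open>Every \<open>bern_diff\<close> with r = 0 is an integer divided by l, so the only
  denominators are m and l^n, and p differs from l.\<close>

lemma D_l_integral:
  fixes Q :: "('n, 'm::finite) forms"
  assumes p: "prime p" "p \<noteq> l" and Q: "Q \<in> linear_forms"
  shows "padic_abs p (of_nat CARD('m) * D_l l sigma (\<lambda>j. 1) Q w) \<le> 1"
proof -
  obtain T :: "'n zvec set set" and h where T: "transversal (column_rel L) T h"
    using exists_transversal[OF det_L_nz] .
  have "\<exists>z. of_nat CARD('m) * D_l l sigma (\<lambda>j. 1) Q w = of_int z / of_nat l ^ CARD('n)"
  proof -
    define k :: "'m \<Rightarrow> 'n zvec set \<Rightarrow> 'n zvec \<Rightarrow> 'n \<Rightarrow> int" where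
      "k i t c j = (let x = inv_L (of_int_vec (h t) + pi_vec w) $ j;
          y = frac_bi (forms_act (matrix_inv sigma) Q $ i $ j > 0) x
          in (\<lfloor>x - y\<rfloor> + c $ j) mod int l)" for i t c j
    define g where "g z = (if int l dvd z then 1 - int l else 1)" for z
    have g: "weight z = of_int (g z)" for z by (simp add: weight_def g_def)
    have "of_nat CARD('m) * D_l l sigma (\<lambda>j. 1) Q w
      = (\<Sum>i\<in>UNIV. \<Sum>t\<in>T. \<Sum>c\<in>residue_vecs l. weight ((h t + L *v c) $ first) * (\<Prod>j\<in>UNIV. of_int (k i t c j) / of_nat l))"
      using D_l_bern_diff[OF Q T, of "\<lambda>j. 0" w] by (simp add: bern_diff_0 Let_def k_def)
    also have "\<dots> = of_int (\<Sum>i\<in>UNIV. \<Sum>t\<in>T. \<Sum>c\<in>residue_vecs l. g ((h t + L *v c) $ first) * (\<Prod>j\<in>UNIV. k i t c j))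
        / of_nat l ^ CARD('n)"
      by (simp add: g prod_dividef sum_divide_distrib)
    finally show ?thesis by blast
  qed
  then obtain z where "of_nat CARD('m) * D_l l sigma (\<lambda>j. 1) Q w = of_int z / of_int (int l ^ CARD('n))" by auto
  moreover have "\<not> int p dvd int l ^ CARD('n)"
    using p prime_l by (metis int_dvd_int_iff of_nat_power prime_dvd_power primes_dvd_imp_eq)
  ultimately show ?thesis using padic_abs_le_1I[OF p(1)] by metis
qed

text \<open>The r! contained in P_r cancels against (r + 1)! and leaves the product of the r_j + 1,
  which is the normalisation of \<open>bern_diff\<close>.\<close>

lemma Psi_homogeneous_eq:
  "Psi_homogeneous l sigma d P Q w = (- 1) ^ CARD('n) * sgn (det sigma) *
     (\<Sum>r | total r = d. Poly_Mapping.lookup (qpoly_transform sigma P) r / of_nat l ^ d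
       * (D_l l sigma (\<lambda>j. 1 + Poly_Mapping.lookup r j) Q w / (\<Prod>j\<in>UNIV. of_nat (Poly_Mapping.lookup r j + 1))))"
proof -
  have "transform_coeff P r sigma / ((\<Prod>j\<in>UNIV. fact (Poly_Mapping.lookup r j + 1)) * of_nat l ^ total r) * D
    = Poly_Mapping.lookup (qpoly_transform sigma P) r / of_nat l ^ total r * (D / (\<Prod>j\<in>UNIV. of_nat (Poly_Mapping.lookup r j + 1)))" for r D
  proof -
    have "(\<Prod>j\<in>UNIV. fact (Poly_Mapping.lookup r j + 1) :: rat)
      = (\<Prod>j\<in>UNIV. of_nat (Poly_Mapping.lookup r j + 1)) * (\<Prod>j\<in>UNIV. fact (Poly_Mapping.lookup r j))"
      by (simp add: prod.distrib[symmetric])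
    moreover have "(\<Prod>j\<in>UNIV. fact (Poly_Mapping.lookup r j) :: rat) \<noteq> 0" by simp
    ultimately show ?thesis by (simp only: transform_coeff_def) (simp del: of_nat_Suc of_nat_add)
  qed
  note eq = this
  show ?thesis
    unfolding Psi_homogeneous_def eq by (intro arg_cong2[where f = "(*)"] refl sum.cong) auto
qed

text \<open>The cocycle for the fixed matrix \<open>sigma\<close>, as \<open>Psi_l\<close> sees it
  after clearing denominators.\<close>

definition Psi :: "'n qpoly \<Rightarrow> ('n, 'm::finite) forms \<Rightarrow> 'n qvec \<Rightarrow> rat" where
  "Psi P Q w = (\<Sum>d\<in>total ` Poly_Mapping.keys P. Psi_homogeneous l sigma d (homogeneous_part d P) Q w)"

lemma Psi_1: "Psi 1 Q w = (- 1) ^ CARD('n) * sgn (det sigma) * D_l l sigma (\<lambda>j. 1) Q w"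
proof -
  have part: "homogeneous_part 0 1 = (1 :: 'n qpoly)"
    using qpoly_eq_sum_single[of "1 :: 'n qpoly"] by (simp add: homogeneous_part_def conj_commute cong: conj_cong)
  have total: "{r :: 'n \<Rightarrow>\<^sub>0 nat. total r = 0} = {0}"
    by (auto simp: total_def intro: poly_mapping_eqI)
  have "qpoly_transform sigma 1 = 1"
    by (simp add: qpoly_transform_def qpoly_insert_def)
  then show ?thesis by (simp add: Psi_def part Psi_homogeneous_eq total)
qed

context
  fixes Q :: "('n, 'm::finite) forms" and p :: nat
  assumes Q: "Q \<in> linear_forms" and p: "prime p"
begin

lemma Psi_1_periodic: "Psi 1 Q (w + of_int_vec z) = Psi 1 Q w"
  by (simp add: Psi_1 D_l_periodic[OF Q])

text \<open>The exponents 1 + r_j add up to n + d, so dividing the relation for D_l by N^n leaves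
  N^d.\<close>

lemma Psi_homogeneous_distribution:
  assumes N: "N > 0" "coprime N l"
  shows "Psi_homogeneous l sigma d P Q w
    = of_nat N ^ d * (\<Sum>y\<in>residue_vecs N. Psi_homogeneous l sigma d P Q ((1 / of_nat N) *s (w + of_int_vec y)))"
proof -
  have D: "D_l l sigma (\<lambda>j. 1 + Poly_Mapping.lookup r j) Q w
    = of_nat N ^ d * (\<Sum>y\<in>residue_vecs N. D_l l sigma (\<lambda>j. 1 + Poly_Mapping.lookup r j) Q ((1 / of_nat N) *s (w + of_int_vec y)))"
    if "total r = d" for r :: "'n \<Rightarrow>\<^sub>0 nat"
  proof -
    have "(\<Sum>j\<in>UNIV. 1 + Poly_Mapping.lookup r j) = CARD('n) + d"
      unfolding that[symmetric] total_def by (subst sum.distrib) simp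
    then show ?thesis
      using D_l_distribution[OF Q _ N, of "\<lambda>j. 1 + Poly_Mapping.lookup r j" w] N(1) by (simp add: power_add)
  qed
  let ?k = "\<lambda>r. Poly_Mapping.lookup (qpoly_transform sigma P) r / of_nat l ^ d / (\<Prod>j\<in>UNIV. of_nat (Poly_Mapping.lookup r j + 1))"
  have Psi: "Psi_homogeneous l sigma d P Q w = (\<Sum>r | total r = d. (- 1) ^ CARD('n) * sgn (det sigma) * ?k r
     * D_l l sigma (\<lambda>j. 1 + Poly_Mapping.lookup r j) Q w)" for w
    unfolding Psi_homogeneous_eq by (simp add: sum_distrib_left mult.assoc)
  have "Psi_homogeneous l sigma d P Q w = (\<Sum>r | total r = d. \<Sum>y\<in>residue_vecs N. (- 1) ^ CARD('n) * sgn (det sigma) * ?k r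
     * (of_nat N ^ d * D_l l sigma (\<lambda>j. 1 + Poly_Mapping.lookup r j) Q ((1 / of_nat N) *s (w + of_int_vec y))))"
    unfolding Psi
  proof (rule sum.cong[OF refl])
    fix r :: "'n \<Rightarrow>\<^sub>0 nat" assume "r \<in> {r. total r = d}"
    then have "total r = d" by simp
    from D[OF this] show "(- 1) ^ CARD('n) * sgn (det sigma) * ?k r * D_l l sigma (\<lambda>j. 1 + Poly_Mapping.lookup r j) Q w
      = (\<Sum>y\<in>residue_vecs N. (- 1) ^ CARD('n) * sgn (det sigma) * ?k r
     * (of_nat N ^ d * D_l l sigma (\<lambda>j. 1 + Poly_Mapping.lookup r j) Q ((1 / of_nat N) *s (w + of_int_vec y))))"
      by (simp only: sum_distrib_left)
  qed
  then show ?thesis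
    unfolding Psi sum_distrib_left by (subst sum.swap) (simp only: mult.left_commute)
qed

lemma Psi_1_distribution:
  assumes N: "N > 0" "coprime N l"
  shows "Psi 1 Q w = (\<Sum>y\<in>residue_vecs N. Psi 1 Q ((1 / of_nat N) *s (w + of_int_vec y)))"
  using D_l_distribution[OF Q _ N, of "\<lambda>j. 1" w] N(1)
  by (simp add: Psi_1 sum_distrib_left[symmetric])

lemma Psi_1_integral:
  assumes "p \<noteq> l"
  shows "padic_abs p (of_nat CARD('m) * Psi 1 Q w) \<le> 1"
proof -
  have "\<bar>Psi 1 Q w\<bar> = \<bar>D_l l sigma (\<lambda>j. 1) Q w\<bar>"
    using det_nz by (simp add: Psi_1 abs_mult sgn_if)
  then have "Psi 1 Q w = D_l l sigma (\<lambda>j. 1) Q w \<or> Psi 1 Q w = - D_l l sigma (\<lambda>j. 1) Q w"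
    by (metis abs_eq_iff)
  then show ?thesis using D_l_integral[OF p assms Q, of w] padic_abs_minus[OF p] by auto
qed

text \<open>\<open>D_l_cong\<close> is applied to each r. Its power of l cancels the l^d in the
  denominator of Psi, and the monomials in sigma^{-1}(v + a) sum to P(v + a) by
  \<open>qpoly_eval_transform\<close>.\<close>

lemma Psi_homogeneous_cong:
  fixes N :: "'s \<Rightarrow> rat" and a :: "'s \<Rightarrow> 'n zvec" and v :: "'n qvec"
  assumes P: "qpoly_homogeneous d P" and N: "padic_bounded p N" "\<And>s. N s \<noteq> 0"
  defines "w \<equiv> \<lambda>s. (1 / N s) *s (v + of_int_vec (a s))"
  shows "padic_cong p N (\<lambda>s. N s ^ d * Psi_homogeneous l sigma d P Q (w s))
    (\<lambda>s. qpoly_eval (\<lambda>j. (v + of_int_vec (a s)) $ j) P * Psi 1 Q (w s))"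
proof -
  let ?e = "(- 1) ^ CARD('n) * sgn (det sigma)"
  let ?q = "\<lambda>r. ?e * (Poly_Mapping.lookup (qpoly_transform sigma P) r / of_nat l ^ d)"
  let ?U = "\<lambda>s. inv_S (v + of_int_vec (a s))"
  have "padic_cong p N
    (\<lambda>s. \<Sum>r | total r = d. ?q r * (N s ^ (\<Sum>j\<in>UNIV. Poly_Mapping.lookup r j) * 
       (D_l l sigma (\<lambda>j. 1 + Poly_Mapping.lookup r j) Q (w s) / (\<Prod>j\<in>UNIV. of_nat (Poly_Mapping.lookup r j + 1)))))
    (\<lambda>s. \<Sum>r | total r = d. ?q r * (of_nat l ^ (\<Sum>j\<in>UNIV. Poly_Mapping.lookup r j)
       * (\<Prod>j\<in>UNIV. (?U s $ j) ^ Poly_Mapping.lookup r j) * D_l l sigma (\<lambda>j. 1) Q (w s)))"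
    unfolding w_def by (intro padic_cong_sum[OF p] padic_cong_mult_left[OF p] D_l_cong[OF p Q N])
  moreover have "(\<Sum>r | total r = d. ?q r * (N s ^ (\<Sum>j\<in>UNIV. Poly_Mapping.lookup r j) * 
       (D_l l sigma (\<lambda>j. 1 + Poly_Mapping.lookup r j) Q (w s) / (\<Prod>j\<in>UNIV. of_nat (Poly_Mapping.lookup r j + 1)))))
     = N s ^ d * Psi_homogeneous l sigma d P Q (w s)" for s
    unfolding Psi_homogeneous_eq sum_distrib_left
    by (intro sum.cong refl) (simp add: total_def)
  moreover have "(\<Sum>r | total r = d. ?q r * (of_nat l ^ (\<Sum>j\<in>UNIV. Poly_Mapping.lookup r j)
       * (\<Prod>j\<in>UNIV. (?U s $ j) ^ Poly_Mapping.lookup r j) * D_l l sigma (\<lambda>j. 1) Q (w s)))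
     = qpoly_eval (\<lambda>j. (v + of_int_vec (a s)) $ j) P * Psi 1 Q (w s)" for s
  proof -
    have "qpoly_eval (\<lambda>j. (v + of_int_vec (a s)) $ j) P = qpoly_eval (\<lambda>j. ?U s $ j) (qpoly_transform sigma P)"
      by (simp add: qpoly_eval_transform matrix_vector_inv[OF det_nz])
    also have "\<dots> = (\<Sum>r | total r = d. Poly_Mapping.lookup (qpoly_transform sigma P) r * (\<Prod>j\<in>UNIV. (?U s $ j) ^ Poly_Mapping.lookup r j))"
      by (rule qpoly_eval_homogeneous[OF qpoly_homogeneous_transform[OF P]])
    finally have "qpoly_eval (\<lambda>j. (v + of_int_vec (a s)) $ j) P * Psi 1 Q (w s)
      = (\<Sum>r | total r = d. Poly_Mapping.lookup (qpoly_transform sigma P) r * (\<Prod>j\<in>UNIV. (?U s $ j) ^ Poly_Mapping.lookup r j) * Psi 1 Q (w s))"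
      by (simp only: sum_distrib_right)
    then show ?thesis unfolding Psi_1 using l_pos
      by (simp only:) (intro sum.cong refl, simp add: total_def)
  qed
  ultimately show ?thesis by simp
qed

text \<open>The distribution relation writes each homogeneous part of Psi(P, v) as a sum over a of
  p^{kd} times its value at (v + a)/p^k, to which the congruence applies. All pairs (k, a) form one
  family, so one C serves every k.\<close>

lemma Psi_riemann_sum:
  assumes "p \<noteq> l"
  shows "\<exists>C. \<forall>k. padic_abs p (Psi P Q v - (\<Sum>a\<in>residue_vecs (p ^ k).
      qpoly_eval (\<lambda>j. (v + of_int_vec a) $ j) P * Psi 1 Q ((1 / of_nat p ^ k) *s (v + of_int_vec a)))) \<le> C / of_nat p ^ k"
proof -
  define N :: "nat \<times> 'n zvec \<Rightarrow> rat" where "N s = of_nat p ^ fst s" for s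
  define w where "w s = (1 / N s) *s (v + of_int_vec (snd s))" for s
  have p0: "p > 0" using p by (rule prime_gt_0_nat)
  have "padic_bounded p (\<lambda>s :: nat \<times> 'n zvec. of_int (int p ^ fst s))" by (rule padic_bounded_of_int[OF p])
  then have N: "padic_bounded p N" "\<And>s. N s \<noteq> 0" using p0 by (simp_all add: N_def[abs_def])
  let ?D = "total ` Poly_Mapping.keys P"
  have "padic_cong p N (\<lambda>s. \<Sum>d\<in>?D. N s ^ d * Psi_homogeneous l sigma d (homogeneous_part d P) Q (w s))
     (\<lambda>s. \<Sum>d\<in>?D. qpoly_eval (\<lambda>j. (v + of_int_vec (snd s)) $ j) (homogeneous_part d P) * Psi 1 Q (w s))"
    unfolding w_def by (intro padic_cong_sum[OF p] Psi_homogeneous_cong qpoly_homogeneous_part N)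
  also have "(\<lambda>s. \<Sum>d\<in>?D. qpoly_eval (\<lambda>j. (v + of_int_vec (snd s)) $ j) (homogeneous_part d P) * Psi 1 Q (w s))
    = (\<lambda>s. qpoly_eval (\<lambda>j. (v + of_int_vec (snd s)) $ j) P * Psi 1 Q (w s))"
    by (simp only: qpoly_eval_parts[of _ P] sum_distrib_right)
  finally obtain C where C: "C \<ge> 0" "\<And>s. padic_abs p (((\<Sum>d\<in>?D. N s ^ d * Psi_homogeneous l sigma d (homogeneous_part d P) Q (w s))
     - qpoly_eval (\<lambda>j. (v + of_int_vec (snd s)) $ j) P * Psi 1 Q (w s)) / N s) \<le> C"
    unfolding padic_cong_def using padic_bounded_nonneg[OF p] by blast
  have "padic_abs p (Psi P Q v - (\<Sum>a\<in>residue_vecs (p ^ k).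
      qpoly_eval (\<lambda>j. (v + of_int_vec a) $ j) P * Psi 1 Q ((1 / of_nat p ^ k) *s (v + of_int_vec a)))) \<le> C / of_nat p ^ k" for k
  proof -
    have cop: "p ^ k > 0" "coprime (p ^ k) l"
      using p0 assms p prime_l by (auto simp: primes_coprime)
    let ?w = "\<lambda>a. w (k, a)"
    have wk: "?w a = (1 / of_nat p ^ k) *s (v + of_int_vec a)" for a by (simp add: w_def N_def)
    define E where "E a = ((\<Sum>d\<in>?D. N (k, a) ^ d * Psi_homogeneous l sigma d (homogeneous_part d P) Q (?w a))
     - qpoly_eval (\<lambda>j. (v + of_int_vec a) $ j) P * Psi 1 Q (?w a)) / N (k, a)" for a
    have Nk: "N (k, a) = of_nat (p ^ k)" for a by (simp add: N_def)
    have "Psi P Q v = (\<Sum>d\<in>?D. of_nat (p ^ k) ^ d * (\<Sum>a\<in>residue_vecs (p ^ k).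
        Psi_homogeneous l sigma d (homogeneous_part d P) Q ((1 / of_nat (p ^ k)) *s (v + of_int_vec a))))"
      unfolding Psi_def by (intro sum.cong refl Psi_homogeneous_distribution cop)
    also have "\<dots> = (\<Sum>a\<in>residue_vecs (p ^ k). \<Sum>d\<in>?D. N (k, a) ^ d * Psi_homogeneous l sigma d (homogeneous_part d P) Q (?w a))"
      unfolding sum_distrib_left by (subst sum.swap) (simp add: wk Nk)
    finally have "Psi P Q v - (\<Sum>a\<in>residue_vecs (p ^ k). qpoly_eval (\<lambda>j. (v + of_int_vec a) $ j) P * Psi 1 Q (?w a))
      = (\<Sum>a\<in>residue_vecs (p ^ k). of_nat p ^ k * E a)"
      using p0 by (simp add: E_def sum_subtractf N_def)
    \<comment> \<open>The ultrametric inequality keeps the bound of a single term, however many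
      residues a occur.\<close>
    moreover have "padic_abs p (\<Sum>a\<in>A. of_nat p ^ k * E a) \<le> C / of_nat p ^ k" for A
    proof (induction A rule: infinite_finite_induct)
      case (insert a A)
      have "padic_abs p (of_nat p ^ k :: rat) = 1 / of_nat p ^ k"
      proof -
        have "multiplicity (int p) (int p ^ k) = k"
          using p by (intro multiplicity_same_power) auto
        then have "padic_abs p (of_int (int p ^ k) / of_int 1) = real p powi (- int k)"
          using p0 by (subst padic_abs_Fract[OF p]) auto
        then show ?thesis by (simp add: power_int_minus divide_inverse)
      qed
      moreover have "padic_abs p (E a) \<le> C" using C(2)[of "(k, a)"] by (simp add: E_def)
      ultimately have "padic_abs p (of_nat p ^ k * E a) \<le> C / of_nat p ^ k"
        using p0 by (simp add: padic_abs_mult[OF p] divide_right_mono)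
      then show ?case
        using insert padic_abs_add[OF p, of "of_nat p ^ k * E a" "\<Sum>a\<in>A. of_nat p ^ k * E a"] by simp
    qed (use C(1) in \<open>simp_all add: padic_abs_0[OF p]\<close>)
    ultimately show ?thesis unfolding wk by simp
  qed
  then show ?thesis by blast
qed

end

end

section \<open>Topology of the p-adic numbers\<close>

lemma padic_norm_mult: "padic_norm (x * y) = padic_norm x * padic_norm (y :: 'p::prime_card padic)"
proof -
  obtain X where X: "padic_cauchy CARD('p) X" "x = Padic X" by (rule Padic_cases)
  obtain Y where Y: "padic_cauchy CARD('p) Y" "y = Padic Y" by (rule Padic_cases)
  have "(\<lambda>n. padic_abs CARD('p) (X n * Y n)) \<longlonglongrightarrow> padic_norm (x * y)"
    using padic_norm_Padic[OF padic_cauchy_mult[OF prime_card X(1) Y(1)]] X Y by (simp add: mult_Padic)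
  moreover have "(\<lambda>n. padic_abs CARD('p) (X n * Y n)) \<longlonglongrightarrow> padic_norm x * padic_norm y"
    unfolding padic_abs_mult[OF prime_card] using padic_norm_Padic[OF X(1)] padic_norm_Padic[OF Y(1)] X(2) Y(2)
    by (simp add: tendsto_mult)
  ultimately show ?thesis by (rule LIMSEQ_unique)
qed

lemma padic_norm_diff: "padic_norm (x - y) \<le> max (padic_norm x) (padic_norm (y :: 'p::prime_card padic))"
  using padic_norm_add[of x "- y"] by (simp add: padic_norm_minus)

lemma padic_norm_commute: "padic_norm (x - y) = padic_norm (y - x :: 'p::prime_card padic)"
  using padic_norm_minus[of "x - y"] by simp

lemma padic_norm_triangle: "padic_norm (x - z) \<le> max (padic_norm (x - y)) (padic_norm (y - z :: 'p::prime_card padic))"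
  using padic_norm_add[of "x - y" "y - z"] by simp

lemma padic_norm_triangle_le:
  "padic_norm (x - y) \<le> r \<Longrightarrow> padic_norm (y - z) \<le> r \<Longrightarrow> padic_norm (x - z :: 'p::prime_card padic) \<le> r"
  by (meson max.boundedI order_trans padic_norm_triangle)

lemma padic_norm_0 [simp]: "padic_norm (0 :: 'p::prime_card padic) = 0"
  by (simp add: padic_norm_eq_0_iff)

lemma padic_norm_sum_le:
  assumes "\<And>i. i \<in> I \<Longrightarrow> padic_norm (f i) \<le> C" "C \<ge> 0"
  shows "padic_norm (\<Sum>i\<in>I. f i :: 'p::prime_card padic) \<le> C"
  using assms(1)
proof (induction I rule: infinite_finite_induct)
  case (insert i I)
  have "padic_norm (f i + sum f I) \<le> max (padic_norm (f i)) (padic_norm (sum f I))" by (rule padic_norm_add)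
  also have "\<dots> \<le> C" using insert by simp
  finally show ?case using insert by simp
qed (use assms(2) in auto)

abbreviation rad :: "'p::prime_card itself \<Rightarrow> nat \<Rightarrow> real" where
  "rad _ k \<equiv> 1 / real CARD('p) ^ k"

lemma rad_mono: "k \<le> k' \<Longrightarrow> rad TYPE('p::prime_card) k' \<le> rad TYPE('p) k"
  using prime_gt_1_nat[OF prime_card[where 'a = 'p]]
  by (intro divide_left_mono power_increasing) auto

lemma rad_pos: "rad TYPE('p::prime_card) k > 0"
  using prime_gt_1_nat[OF prime_card[where 'a = 'p]] by simp

lemma exists_rad_less:
  assumes "e > 0"
  obtains k where "C * rad TYPE('p::prime_card) k < e"
proof -
  have "1 < real CARD('p)" using prime_gt_1_nat[OF prime_card[where 'a = 'p]] by simp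
  then obtain k where "C / e < real CARD('p) ^ k" using real_arch_pow by blast
  then have "C * rad TYPE('p) k < e"
    using assms rad_pos[where 'p = 'p, of k] by (simp add: field_simps)
  then show ?thesis by (rule that)
qed

lemma padic_approx:
  assumes "e > 0"
  obtains q where "padic_norm (x - of_rat q :: 'p::prime_card padic) < e"
proof -
  obtain X where X: "padic_cauchy CARD('p) X" "x = Padic X" by (rule Padic_cases)
  obtain k where k: "\<forall>m\<ge>k. \<forall>n\<ge>k. padic_abs CARD('p) (X m - X n) < e / 2"
    using X(1) assms unfolding padic_cauchy_def by (meson half_gt_zero)
  note c = padic_cauchy_const[OF prime_card[where 'a = 'p], of "X k"]
  have "x - of_rat (X k) = Padic (\<lambda>n. X n - X k)"
    using X c padic_cauchy_minus[OF prime_card c]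
    by (simp add: of_rat_padic minus_padic_def minus_Padic add_Padic)
  then have "(\<lambda>n. padic_abs CARD('p) (X n - X k)) \<longlonglongrightarrow> padic_norm (x - of_rat (X k))"
    using padic_norm_Padic[OF padic_cauchy_add[OF prime_card X(1) padic_cauchy_minus[OF prime_card c]]] by simp
  then have "padic_norm (x - of_rat (X k)) \<le> e / 2"
    by (rule LIMSEQ_le_const2) (use k in \<open>auto intro!: exI[of _ k] less_imp_le\<close>)
  then show ?thesis using assms that[of "X k"] by simp
qed

text \<open>Completeness is needed for the compactness of X_v. The terms of a Cauchy sequence are
  replaced by rationals within 1/(n + 1), and the p-adic number which these rationals represent is
  the limit.\<close>

instance padic :: (prime_card) complete_space
proof
  fix X :: "nat \<Rightarrow> 'a padic" assume X: "Cauchy X"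
  have "\<exists>q. padic_norm (X n - of_rat q) < inverse (real (Suc n))" for n
    using padic_approx[of "inverse (real (Suc n))" "X n"] by auto
  then obtain q where q: "\<And>n. padic_norm (X n - of_rat (q n)) < inverse (real (Suc n))" by metis
  have small: "\<exists>k. \<forall>n\<ge>k. inverse (real (Suc n)) < e" if "e > 0" for e
  proof -
    obtain k where k: "inverse (real (Suc k)) < e" using reals_Archimedean \<open>e > 0\<close> by blast
    then have "inverse (real (Suc n)) < e" if "n \<ge> k" for n
      using that by (smt (verit) le_imp_inverse_le of_nat_0_less_iff of_nat_mono Suc_le_mono zero_less_Suc)
    then show ?thesis by blast
  qed
  have cauchy: "padic_cauchy CARD('a) q"
    unfolding padic_cauchy_def
  proof (intro allI impI)
    fix e :: real assume e: "e > 0"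
    obtain k where k: "\<forall>m\<ge>k. \<forall>n\<ge>k. dist (X m) (X n) < e" using X e unfolding Cauchy_def by meson
    obtain j where j: "\<forall>n\<ge>j. inverse (real (Suc n)) < e" using small[OF e] by blast
    have "padic_abs CARD('a) (q m - q n) < e" if "m \<ge> max k j" "n \<ge> max k j" for m n
    proof -
      have 1: "padic_norm (of_rat (q m) - X m) < e" "padic_norm (X n - of_rat (q n)) < e"
        using q[of m] q[of n] j that by (auto simp: padic_norm_commute[of "of_rat _"] intro: less_trans)
      have 2: "padic_norm (X m - X n) < e" using k that by (simp add: dist_padic_def)
      have "padic_norm (of_rat (q m) - of_rat (q n) :: 'a padic) < e"
        using padic_norm_triangle[of "of_rat (q m)" "of_rat (q n)" "X m"]
          padic_norm_triangle[of "X m" "of_rat (q n)" "X n"] 1 2 by (simp add: max_def split: if_splits)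
      then show ?thesis by (simp flip: padic_norm_of_rat of_rat_diff)
    qed
    then show "\<exists>k. \<forall>m\<ge>k. \<forall>n\<ge>k. padic_abs CARD('a) (q m - q n) < e" by blast
  qed
  define L :: "'a padic" where "L = Padic q"
  have "X \<longlonglongrightarrow> L"
  proof (rule metric_LIMSEQ_I)
    fix e :: real assume e: "e > 0"
    obtain k where k: "\<forall>m\<ge>k. \<forall>n\<ge>k. padic_abs CARD('a) (q m - q n) < e / 2"
      using cauchy e unfolding padic_cauchy_def by (meson half_gt_zero)
    obtain j where j: "\<forall>n\<ge>j. inverse (real (Suc n)) < e" using small[OF e] by blast
    have "dist (X n) L < e" if n: "n \<ge> max k j" for n
    proof -
      note c = padic_cauchy_const[OF prime_card[where 'a = 'a], of "q n"]
      have "L - of_rat (q n) = Padic (\<lambda>m. q m - q n)"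
        using cauchy c padic_cauchy_minus[OF prime_card c]
        by (simp add: L_def of_rat_padic minus_padic_def minus_Padic add_Padic)
      then have "(\<lambda>m. padic_abs CARD('a) (q m - q n)) \<longlonglongrightarrow> padic_norm (L - of_rat (q n))"
        using padic_norm_Padic[OF padic_cauchy_add[OF prime_card cauchy padic_cauchy_minus[OF prime_card c]]] by simp
      then have "padic_norm (L - of_rat (q n)) \<le> e / 2"
        by (rule LIMSEQ_le_const2) (use k n in \<open>auto intro!: exI[of _ k] less_imp_le\<close>)
      moreover have "padic_norm (X n - of_rat (q n)) < e" using q[of n] j n by (auto intro: less_trans)
      ultimately show ?thesis
        using padic_norm_triangle[of "X n" L "of_rat (q n)"] e
        by (simp add: dist_padic_def padic_norm_commute[of "of_rat (q n)"] max_def split: if_splits)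
    qed
    then show "\<exists>k. \<forall>n\<ge>k. dist (X n) L < e" by blast
  qed
  then show "convergent X" by (auto simp: convergent_def)
qed

lemma padic_norm_power_p: "padic_norm (of_nat CARD('p) ^ k :: 'p::prime_card padic) = rad TYPE('p) k"
proof -
  have pr: "prime CARD('p)" by (rule prime_card)
  have "multiplicity (int CARD('p)) (int CARD('p) ^ k) = k"
    using pr by (intro multiplicity_same_power) auto
  then have "padic_abs CARD('p) (of_int (int CARD('p) ^ k) / of_int 1) = real CARD('p) powi (- int k)"
    using prime_gt_0_nat[OF pr] by (subst padic_abs_Fract[OF pr]) auto
  then have "padic_abs CARD('p) (of_nat CARD('p) ^ k) = rad TYPE('p) k"
    by (simp add: power_int_minus divide_inverse)
  then show ?thesis using padic_norm_of_rat[where 'p = 'p, of "of_nat CARD('p) ^ k"] by (simp add: of_rat_power)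
qed

lemma padic_norm_of_int_le:
  "padic_norm (of_int z :: 'p::prime_card padic) \<le> rad TYPE('p) k \<longleftrightarrow> int CARD('p) ^ k dvd z"
proof
  let ?p = "CARD('p)"
  have pr: "prime ?p" by (rule prime_card)
  assume "padic_norm (of_int z :: 'p padic) \<le> rad TYPE('p) k"
  moreover have "of_int z = of_nat ?p ^ k * (of_rat (of_int z / of_nat ?p ^ k) :: 'p padic)"
    using prime_gt_0_nat[OF pr] by (simp add: of_rat_divide of_rat_power)
  ultimately have "rad TYPE('p) k * padic_abs ?p (of_int z / of_nat ?p ^ k) \<le> rad TYPE('p) k * 1"
    using padic_norm_mult padic_norm_power_p padic_norm_of_rat by (metis mult_1_right)
  then have "padic_abs ?p (of_int z / of_nat ?p ^ k) \<le> 1"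
    using rad_pos[where 'p = 'p, of k] by (metis mult_le_cancel_left_pos)
  then obtain a b where ab: "\<not> int ?p dvd b" "of_int z / of_nat ?p ^ k = (of_int a / of_int b :: rat)"
    by (rule padic_abs_le_1D[OF pr])
  then have "of_int (z * b) = (of_int (a * int ?p ^ k) :: rat)"
    using prime_gt_0_nat[OF pr] by (cases "b = 0") (simp_all add: field_simps)
  then have "z * b = a * int ?p ^ k" by (simp only: of_int_eq_iff)
  then have "int ?p ^ k dvd z * b" by simp
  moreover have "coprime (int ?p ^ k) b"
    using ab(1) pr by (simp add: prime_imp_coprime)
  ultimately show "int ?p ^ k dvd z" by (simp add: coprime_dvd_mult_left_iff)
next
  let ?p = "CARD('p)"
  assume "int ?p ^ k dvd z"
  then obtain y where "z = int ?p ^ k * y" by (elim dvdE)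
  then have "padic_norm (of_int z :: 'p padic) = rad TYPE('p) k * padic_norm (of_rat (of_int y) :: 'p padic)"
    by (simp add: padic_norm_mult padic_norm_power_p)
  also have "\<dots> \<le> rad TYPE('p) k * 1"
    unfolding padic_norm_of_rat
    using rad_pos[where 'p = 'p, of k] padic_abs_of_int_le[OF prime_card[where 'a = 'p]] by (intro mult_left_mono) auto
  finally show "padic_norm (of_int z :: 'p padic) \<le> rad TYPE('p) k" by simp
qed

text \<open>A rational approximation has the form a/b with b prime to p. If u inverts b modulo p^k,
  then a/b and a u differ by a p-adic integer times p^k, and a u can be reduced modulo p^k.\<close>

lemma padic_int_approx:
  fixes x :: "'p::prime_card padic"
  assumes "padic_norm x \<le> 1"
  obtains a where "0 \<le> a" "a < int CARD('p) ^ k" "padic_norm (x - of_int a) \<le> rad TYPE('p) k"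
proof -
  let ?p = "CARD('p)"
  have pr: "prime ?p" by (rule prime_card)
  obtain q where q: "padic_norm (x - of_rat q) < rad TYPE('p) k" using padic_approx rad_pos by blast
  have "padic_norm (of_rat q :: 'p padic) \<le> 1"
    using padic_norm_diff[of x "x - of_rat q"] q assms rad_mono[where 'p = 'p, of 0 k] by simp
  then have "padic_abs ?p q \<le> 1" by (simp add: padic_norm_of_rat)
  then obtain a b where ab: "\<not> int ?p dvd b" "q = of_int a / of_int b" by (rule padic_abs_le_1D[OF pr])
  have "coprime (int ?p) b" using ab(1) pr by (simp add: prime_imp_coprime)
  then have "coprime b (int ?p ^ k)" by (simp add: coprime_commute)
  then obtain u v where uv: "u * b + v * int ?p ^ k = 1"
    using bezout_int[of b "int ?p ^ k"] by auto
  define c where "c = a * u"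
  have b0: "of_int b \<noteq> (0 :: 'p padic)" using ab(1) by auto
  have "of_rat q - of_int c = (of_int (a * v * int ?p ^ k) / of_int b :: 'p padic)"
  proof -
    have "a - c * b = a * v * int ?p ^ k" using uv unfolding c_def by (metis (no_types, lifting) add_diff_cancel_left' mult.assoc mult.right_neutral right_diff_distrib)
    then have "(of_int a - of_int c * of_int b :: 'p padic) = of_int (a * v * int ?p ^ k)"
      by (metis of_int_diff of_int_mult)
    moreover have "of_rat q = (of_int a / of_int b :: 'p padic)" by (simp add: ab(2) of_rat_divide)
    moreover have "of_int a / of_int b - of_int c = (of_int a - of_int c * of_int b) / (of_int b :: 'p padic)"
      using b0 by (simp add: diff_divide_distrib)
    ultimately show ?thesis by simp
  qed
  also have "\<dots> = of_nat ?p ^ k * of_rat (of_int (a * v) / of_int b)"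
    by (simp only: of_rat_divide of_rat_of_int_eq) simp
  finally have "padic_norm (of_rat q - of_int c :: 'p padic) = rad TYPE('p) k * padic_abs ?p (of_int (a * v) / of_int b)"
    by (simp only: padic_norm_mult padic_norm_power_p padic_norm_of_rat)
  also have "\<dots> \<le> rad TYPE('p) k * 1"
    by (intro mult_left_mono padic_abs_le_1I[OF pr ab(1)] less_imp_le[OF rad_pos])
  finally have 1: "padic_norm (of_rat q - of_int c :: 'p padic) \<le> rad TYPE('p) k" by simp
  define d where "d = c mod int ?p ^ k"
  have "padic_norm (of_int (c - d) :: 'p padic) \<le> rad TYPE('p) k"
    unfolding padic_norm_of_int_le d_def by (simp add: minus_mod_eq_mult_div)
  then have "padic_norm (of_rat q - of_int d :: 'p padic) \<le> rad TYPE('p) k"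
    using padic_norm_triangle_le[OF 1] by simp
  then have "padic_norm (x - of_int d) \<le> rad TYPE('p) k"
    by (rule padic_norm_triangle_le[OF less_imp_le[OF q]])
  moreover have "0 \<le> d" "d < int ?p ^ k" using prime_gt_0_nat[OF pr] by (simp_all add: d_def)
  ultimately show ?thesis using that by blast
qed

text \<open>Closeness in the maximum norm. Unlike the Euclidean \<open>dist\<close> on vectors this
  norm is ultrametric, so for fixed k the relation is an equivalence whose classes are the balls of
  radius p^{-k}.\<close>

definition near :: "nat \<Rightarrow> 'p::prime_card padic^'n \<Rightarrow> 'p padic^'n \<Rightarrow> bool" where
  "near k x y \<longleftrightarrow> (\<forall>i. padic_norm (x $ i - y $ i) \<le> rad TYPE('p) k)"

lemma near_refl [simp]: "near k x x"
  using rad_pos by (simp add: near_def less_imp_le)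

lemma near_sym: "near k x y \<Longrightarrow> near k y x"
  by (simp add: near_def padic_norm_commute)

lemma near_trans: "near k x y \<Longrightarrow> near k y z \<Longrightarrow> near k x z"
  unfolding near_def by (meson max.boundedI order_trans padic_norm_triangle)

lemma near_mono: "near k' x y \<Longrightarrow> k \<le> k' \<Longrightarrow> near k x y"
  unfolding near_def by (meson order_trans rad_mono)

lemma near_imp_dist_le:
  fixes x y :: "'p::prime_card padic^'n::finite"
  assumes "near k x y"
  shows "dist x y \<le> real CARD('n) * rad TYPE('p) k"
proof -
  have "dist x y \<le> (\<Sum>i\<in>UNIV. dist (x $ i) (y $ i))"
    unfolding dist_vec_def by (rule L2_set_le_sum) simp
  also have "\<dots> \<le> (\<Sum>i\<in>(UNIV :: 'n set). rad TYPE('p) k)"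
    using assms by (intro sum_mono) (simp add: near_def dist_padic_def)
  finally show ?thesis by simp
qed

lemma dist_imp_near:
  fixes x y :: "'p::prime_card padic^'n::finite"
  assumes "dist x y \<le> rad TYPE('p) k"
  shows "near k x y"
  unfolding near_def using dist_vec_nth_le[of x _ y] assms by (metis dist_padic_def order_trans)

text \<open>A union of balls of radius p^{-k}; this reduces compact open sets to finite sets of
  residues.\<close>

definition saturated :: "nat \<Rightarrow> ('p::prime_card padic^'n) set \<Rightarrow> bool" where
  "saturated k U \<longleftrightarrow> (\<forall>x y. near k x y \<longrightarrow> x \<in> U \<longrightarrow> y \<in> U)"

lemma saturatedD: "saturated k U \<Longrightarrow> near k x y \<Longrightarrow> x \<in> U \<longleftrightarrow> y \<in> U"
  unfolding saturated_def using near_sym by blast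

lemma saturated_mono: "saturated k U \<Longrightarrow> k \<le> k' \<Longrightarrow> saturated k' U"
  unfolding saturated_def using near_mono by blast

lemma saturated_Compl: "saturated k U \<Longrightarrow> saturated k (- U)"
  unfolding saturated_def using near_sym by blast

lemma saturated_Un: "saturated k U \<Longrightarrow> saturated k V \<Longrightarrow> saturated k (U \<union> V)"
  unfolding saturated_def by blast

lemma saturated_near: "saturated k {x. near k x c}"
  unfolding saturated_def using near_sym near_trans by blast

lemma saturated_imp_open: 
  fixes U :: "('p::prime_card padic^'n::finite) set"
  assumes "saturated k U"
  shows "open U"
  unfolding open_dist
proof (intro ballI exI conjI allI impI)
  fix x y assume "x \<in> U" "dist y x < rad TYPE('p) k"
  then show "y \<in> U" using dist_imp_near[of x y k] assms by (auto simp: saturated_def dist_commute)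
qed (rule rad_pos)

lemma saturated_imp_closed: "saturated k U \<Longrightarrow> closed (U :: ('p::prime_card padic^'n::finite) set)"
  unfolding closed_def by (intro saturated_imp_open[of k] saturated_Compl)

section \<open>Balls, their centers and the compact open subsets of X_v\<close>

abbreviation center :: "'n::finite qvec \<Rightarrow> int^'n \<Rightarrow> 'p::prime_card padic^'n" where
  "center v a \<equiv> of_rat_vec v + of_int_vec a"

lemma X_coset_eq: "(X_coset v :: ('p::prime_card padic^'n::finite) set) = {x. near 0 x (of_rat_vec v)}"
proof -
  have "x \<in> X_coset v \<longleftrightarrow> x - of_rat_vec v \<in> X_set" for x :: "'p padic^'n"
    unfolding X_coset_def by (metis (no_types, lifting) add.commute diff_add_cancel image_iff add_diff_cancel_left')
  then show ?thesis by (auto simp: X_set_def near_def padic_ints_def)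
qed

lemma padic_ball_eq: "(padic_ball v a k :: ('p::prime_card padic^'n::finite) set) = {x. near k x (center v a)}"
proof (intro set_eqI iffI; (unfold mem_Collect_eq)?)
  let ?P = "of_nat CARD('p) ^ k :: 'p padic"
  have p0: "CARD('p) > 0" by (rule prime_gt_0_nat[OF prime_card])
  fix x :: "'p padic^'n"
  {
    assume "x \<in> padic_ball v a k"
    then obtain y where y: "y \<in> X_set" "x = center v a + ?P *s y" by (auto simp: padic_ball_def)
    then show "near k x (center v a)"
      using rad_pos[where 'p = 'p, of k]
      by (auto simp: near_def padic_norm_mult padic_norm_power_p X_set_def padic_ints_def mult_left_le divide_right_mono)
  }
  assume near: "near k x (center v a)"
  define y where "y = (1 / ?P) *s (x - center v a)"
  have x: "x = center v a + ?P *s y" using p0 by (simp add: y_def vector_smult_assoc del: vector_ssub_ldistrib vector_add_ldistrib)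
  have "padic_norm (y $ i) \<le> 1" for i
  proof -
    have "x $ i - center v a $ i = ?P * y $ i" by (subst x) simp
    then have "rad TYPE('p) k * padic_norm (y $ i) \<le> rad TYPE('p) k * 1"
      using near unfolding near_def by (metis padic_norm_mult padic_norm_power_p mult_1_right)
    then show ?thesis using rad_pos[where 'p = 'p, of k] by (metis mult_le_cancel_left_pos)
  qed
  then show "x \<in> padic_ball v a k" unfolding padic_ball_def
    by (intro image_eqI[of _ _ y] x) (simp add: X_set_def padic_ints_def)
qed

lemma near_center:
  "near k (center v a :: 'p::prime_card padic^'n::finite) (center v b) \<longleftrightarrow> (\<forall>i. int CARD('p) ^ k dvd a $ i - b $ i)"
  by (simp add: near_def flip: padic_norm_of_int_le)

lemma center_in_X: "(center v a :: 'p::prime_card padic^'n::finite) \<in> X_coset v"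
proof -
  have "center v 0 = (of_rat_vec v :: 'p padic^'n)" by (simp add: vec_eq_iff)
  then show ?thesis using near_center[where 'p = 'p, of 0 v a 0] by (simp add: X_coset_eq)
qed

text \<open>This is the partition of X_v into p^{kn} balls of radius p^{-k}, which indexes the
  Riemann sums.\<close>

lemma unique_center:
  assumes "x \<in> X_coset v"
  shows "\<exists>!a. a \<in> residue_vecs (CARD('p) ^ k) \<and> near k x (center v a :: 'p::prime_card padic^'n::finite)"
proof -
  have "\<exists>a. 0 \<le> a \<and> a < int CARD('p) ^ k \<and> padic_norm (x $ i - of_rat (v $ i) - of_int a) \<le> rad TYPE('p) k" for i
    using assms padic_int_approx[of "x $ i - of_rat (v $ i)" k] by (auto simp: X_coset_eq near_def of_rat_vec_def)
  then obtain a where a: "\<And>i. 0 \<le> a i \<and> a i < int CARD('p) ^ k \<and> padic_norm (x $ i - of_rat (v $ i) - of_int (a i)) \<le> rad TYPE('p) k"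
    by metis
  have near_a: "near k x (center v (\<chi> i. a i))"
    using a by (simp add: near_def of_rat_vec_def diff_diff_eq)
  show ?thesis
  proof (rule ex1I[of _ "\<chi> i. a i"])
    show "(\<chi> i. a i) \<in> residue_vecs (CARD('p) ^ k) \<and> near k x (center v (\<chi> i. a i))"
      using a near_a unfolding residue_vecs_def by simp
    fix b assume b: "b \<in> residue_vecs (CARD('p) ^ k) \<and> near k x (center v b)"
    have "near k (center v b) (center v (\<chi> i. a i) :: 'p padic^'n)"
    proof (rule near_trans)
      show "near k (center v b) x" using b by (blast intro: near_sym)
      show "near k x (center v (\<chi> i. a i))" by (rule near_a)
    qed
    then have dvd: "int CARD('p) ^ k dvd b $ i - a i" for i unfolding near_center by simp
    have "b $ i = a i" for i
    proof -
      have "b $ i mod int CARD('p) ^ k = a i mod int CARD('p) ^ k" using dvd[of i] by (simp only: mod_eq_dvd_iff)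
      moreover have "b $ i mod int CARD('p) ^ k = b $ i"
        using b by (intro mod_pos_pos_trivial) (simp_all add: residue_vecs_def)
      moreover have "a i mod int CARD('p) ^ k = a i"
        using a[of i] by (intro mod_pos_pos_trivial) simp_all
      ultimately show ?thesis by simp
    qed
    then show "b = (\<chi> i. a i)" by (simp add: vec_eq_iff)
  qed
qed

lemma compact_X_coset: "compact (X_coset v :: ('p::prime_card padic^'n::finite) set)"
  unfolding compact_eq_totally_bounded
proof (intro conjI allI impI)
  show "complete (X_coset v :: ('p padic^'n) set)"
    unfolding complete_eq_closed X_coset_eq by (rule saturated_imp_closed[OF saturated_near])
  fix e :: real assume "e > 0"
  then obtain k where k: "real CARD('n) * rad TYPE('p) k < e" using exists_rad_less by blast
  show "\<exists>K. finite K \<and> (X_coset v :: ('p padic^'n) set) \<subseteq> (\<Union>x\<in>K. ball x e)"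
  proof (intro exI conjI)
    show "finite ((\<lambda>a. center v a :: 'p padic^'n) ` residue_vecs (CARD('p) ^ k))" by simp
    show "(X_coset v :: ('p padic^'n) set) \<subseteq> (\<Union>x\<in>(\<lambda>a. center v a) ` residue_vecs (CARD('p) ^ k). ball x e)"
    proof
      fix x :: "'p padic^'n" assume "x \<in> X_coset v"
      then obtain a where "a \<in> residue_vecs (CARD('p) ^ k)" "near k x (center v a)"
        using unique_center by blast
      moreover from this have "dist (center v a) x < e"
        using near_imp_dist_le[of k x "center v a"] k by (simp add: dist_commute)
      ultimately show "x \<in> (\<Union>x\<in>(\<lambda>a. center v a) ` residue_vecs (CARD('p) ^ k). ball x e)" by auto
    qed
  qed
qed

text \<open>Compactness provides one radius e such that the e-ball about every point of U stays in
  U, so a single level k suffices. Conversely, saturated sets are open and closed.\<close>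

lemma compact_opens_X_coset:
  "U \<in> compact_opens (X_coset v) \<longleftrightarrow> U \<subseteq> X_coset v \<and> (\<exists>k. saturated k (U :: ('p::prime_card padic^'n::finite) set))"
proof safe
  fix k assume U: "U \<subseteq> X_coset v" "saturated k U"
  then have "compact (X_coset v \<inter> U)"
    by (intro compact_Int_closed compact_X_coset saturated_imp_closed)
  then have "compact U" using U(1) by (simp add: inf.absorb2)
  then show "U \<in> compact_opens (X_coset v)" using U saturated_imp_open by (auto simp: compact_opens_def)
next
  fix x assume "U \<in> compact_opens (X_coset v)" "x \<in> U"
  then show "x \<in> X_coset v" by (auto simp: compact_opens_def)
next
  assume "U \<in> compact_opens (X_coset v)"
  then have "compact U" "open U" by (auto simp: compact_opens_def)
  then obtain e where e: "e > 0" "(\<Union>x\<in>U. ball x e) \<subseteq> U"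
    by (rule compact_subset_open_imp_ball_epsilon_subset[of U U]) auto
  obtain k where k: "real CARD('n) * rad TYPE('p) k < e" using e(1) exists_rad_less by blast
  have "saturated k U"
    unfolding saturated_def
  proof (intro allI impI)
    fix x y assume "near k x y" "x \<in> U"
    then have "y \<in> ball x e" using near_imp_dist_le[of k x y] k by simp
    then show "y \<in> U" using e(2) \<open>x \<in> U\<close> by blast
  qed
  then show "\<exists>k. saturated k U" by blast
qed

section \<open>The measure attached to a distribution\<close>

text \<open>\<phi> stands for Psi(1, .) and m for the number of linear forms; \<open>p_type\<close>
  fixes the type variable that carries the prime.\<close>

locale padic_distribution =
  fixes \<phi> :: "'n::finite qvec \<Rightarrow> rat" and v :: "'n qvec" and m :: nat and p_type :: "'p::prime_card itself"
  assumes periodic: "\<phi> (w + of_int_vec z) = \<phi> w"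
    and distribution: "\<phi> w = (\<Sum>y\<in>residue_vecs CARD('p). \<phi> ((1 / of_nat CARD('p)) *s (w + of_int_vec y)))"
    and integral: "padic_abs CARD('p) (of_nat m * \<phi> w) \<le> 1"
    and m_pos: "m > 0"
begin

lemma p_pos: "CARD('p) > 0" by (rule prime_gt_0_nat[OF prime_card])

definition scaled :: "nat \<Rightarrow> nat \<Rightarrow> int^'n \<Rightarrow> 'n qvec" where
  "scaled q k a = (1 / of_nat q ^ k) *s (v + of_int_vec a)"

text \<open>The value of the future measure on U, computed from balls of radius p^{-k}; it has this
  meaning once U is saturated at level k.\<close>

definition level_sum :: "nat \<Rightarrow> ('p padic^'n) set \<Rightarrow> rat" where
  "level_sum k U = (\<Sum>a\<in>{a \<in> residue_vecs (CARD('p) ^ k). center v a \<in> U}. \<phi> (scaled CARD('p) k a))"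

definition padic_values :: "'p padic set" where
  "padic_values = {x. of_nat m * x \<in> padic_ints}"

lemma phi_scaled_cong:
  fixes a b :: "int^'n"
  assumes "\<And>i. int CARD('p) ^ k dvd a $ i - b $ i"
  shows "\<phi> (scaled CARD('p) k a) = \<phi> (scaled CARD('p) k b)"
proof -
  obtain z where z: "\<And>i. a $ i - b $ i = int CARD('p) ^ k * z i" using assms unfolding dvd_def by metis
  have "rat_of_int (a $ i) = of_int (b $ i) + of_nat CARD('p) ^ k * of_int (z i)" for i
    using arg_cong[OF z[of i], of rat_of_int] by (simp add: algebra_simps)
  then have "scaled CARD('p) k a = scaled CARD('p) k b + of_int_vec (\<chi> i. z i)"
    using p_pos by (simp add: scaled_def vec_eq_iff field_simps)
  then show ?thesis by (simp add: periodic)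
qed

text \<open>The ball of level k about a splits into the balls of level k + 1 about a + p^k y, over
  which the distribution relation spreads its mass.\<close>

lemma level_sum_Suc:
  assumes U: "saturated k U"
  shows "level_sum (Suc k) U = level_sum k U"
proof -
  let ?A = "{a \<in> residue_vecs (CARD('p) ^ k). center v a \<in> U}"
  let ?P = "int CARD('p) ^ k"
  have P: "?P > 0" using p_pos by simp
  have sc: "(1 / of_nat CARD('p)) *s (scaled CARD('p) k a + of_int_vec y) = scaled CARD('p) (Suc k) (a + ?P *s y)" for a y
    using p_pos by (simp add: scaled_def vec_eq_iff field_simps)
  have near: "near k (center v a :: 'p padic^'n) (center v (a + ?P *s y))" for a y
    unfolding near_center by simp
  have "level_sum k U = (\<Sum>(a, y)\<in>?A \<times> residue_vecs CARD('p). \<phi> (scaled CARD('p) (Suc k) (a + ?P *s y)))"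
    unfolding level_sum_def distribution[of "scaled CARD('p) k _"] sc sum.cartesian_product ..
  also have "\<dots> = level_sum (Suc k) U"
    unfolding level_sum_def
  \<comment> \<open>Division by p^k with remainder splits off the top base-p digit and matches
    residues modulo p^{k+1} with the pairs (a, y).\<close>
  proof (rule sum.reindex_bij_witness[where i = "\<lambda>a. (\<chi> i. a $ i mod ?P, \<chi> i. a $ i div ?P)" and j = "\<lambda>(a, y). a + ?P *s y"])
    fix a assume a: "a \<in> {a \<in> residue_vecs (CARD('p) ^ Suc k). center v a \<in> U}"
    have eq: "(\<chi> i. a $ i mod ?P) + ?P *s (\<chi> i. a $ i div ?P) = a" by (simp add: vec_eq_iff)
    then show "(case (\<chi> i. a $ i mod ?P, \<chi> i. a $ i div ?P) of (a, y) \<Rightarrow> a + ?P *s y) = a" by simp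
    have "center v (\<chi> i. a $ i mod ?P) \<in> U"
      using saturatedD[OF U near[of "\<chi> i. a $ i mod ?P" "\<chi> i. a $ i div ?P"]] a unfolding eq by simp
    moreover have "a $ i div ?P < int CARD('p)" for i
    proof -
      have "a $ i < int CARD('p) * ?P" using a by (simp add: residue_vecs_def)
      then show ?thesis using P by (smt (verit) div_mult_mod_eq mult_right_mono pos_mod_sign)
    qed
    moreover have "0 \<le> a $ i div ?P" for i
      using a P by (simp add: residue_vecs_def pos_imp_zdiv_nonneg_iff)
    ultimately show "(\<chi> i. a $ i mod ?P, \<chi> i. a $ i div ?P) \<in> ?A \<times> residue_vecs CARD('p)"
      using P by (simp add: residue_vecs_def)
  next
    fix ay :: "(int^'n) \<times> (int^'n)" assume "ay \<in> ?A \<times> residue_vecs CARD('p)"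
    then obtain a y :: "int^'n" where ay: "ay = (a, y)" "a \<in> residue_vecs (CARD('p) ^ k)" "center v a \<in> U" "y \<in> residue_vecs CARD('p)" by auto
    have a: "0 \<le> a $ i" "a $ i < ?P" and y: "0 \<le> y $ i" "y $ i \<le> int CARD('p) - 1" for i
      using ay by (auto simp: residue_vecs_def zle_diff1_eq)
    show "(\<chi> i. (case ay of (a, y) \<Rightarrow> a + ?P *s y) $ i mod ?P, \<chi> i. (case ay of (a, y) \<Rightarrow> a + ?P *s y) $ i div ?P) = ay"
      using a P by (simp add: ay(1) vec_eq_iff div_pos_pos_trivial)
    have "a $ i + ?P * y $ i < int CARD('p) * ?P" for i
    proof -
      have "a $ i + ?P * y $ i < ?P + ?P * (int CARD('p) - 1)"
        using a(2)[of i] mult_left_mono[OF y(2)[of i], of ?P] P by linarith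
      then show ?thesis by (simp add: algebra_simps)
    qed
    moreover have "0 \<le> a $ i + ?P * y $ i" for i using a(1)[of i] y(1)[of i] P by simp
    moreover have "center v (a + ?P *s y) \<in> U" using saturatedD[OF U near] ay(3) by blast
    ultimately show "(case ay of (a, y) \<Rightarrow> a + ?P *s y) \<in> {a \<in> residue_vecs (CARD('p) ^ Suc k). center v a \<in> U}"
      by (simp add: ay(1) residue_vecs_def)
    show "\<phi> (scaled CARD('p) (Suc k) (case ay of (a, y) \<Rightarrow> a + ?P *s y)) = (case ay of (a, y) \<Rightarrow> \<phi> (scaled CARD('p) (Suc k) (a + ?P *s y)))"
      by (simp add: ay(1))
  qed
  finally show ?thesis by simp
qed

lemma level_sum_mono:
  assumes "saturated k U" "k \<le> k'"
  shows "level_sum k' U = level_sum k U"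
  using assms(2)
proof (induction k' rule: dec_induct)
  case (step j)
  then show ?case using level_sum_Suc[OF saturated_mono[OF assms(1)], of j] by simp
qed simp

lemma level_sum_Un:
  assumes "U \<inter> V = {}"
  shows "level_sum k (U \<union> V) = level_sum k U + level_sum k V"
proof -
  have "{a \<in> residue_vecs (CARD('p) ^ k). center v a \<in> U \<union> V}
    = {a \<in> residue_vecs (CARD('p) ^ k). center v a \<in> U} \<union> {a \<in> residue_vecs (CARD('p) ^ k). center v a \<in> V}" by auto
  moreover have "{a \<in> residue_vecs (CARD('p) ^ k). center v a \<in> U} \<inter> {a \<in> residue_vecs (CARD('p) ^ k). center v a \<in> V} = {}"
    using assms by blast
  ultimately show ?thesis
    unfolding level_sum_def by (simp add: sum.union_disjoint)
qed

lemma level_sum_ball: "level_sum k (padic_ball v a k) = \<phi> (scaled CARD('p) k a)"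
proof -
  obtain b where b: "b \<in> residue_vecs (CARD('p) ^ k)" "near k (center v a :: 'p padic^'n) (center v b)"
    "\<And>c. c \<in> residue_vecs (CARD('p) ^ k) \<Longrightarrow> near k (center v a :: 'p padic^'n) (center v c) \<Longrightarrow> c = b"
    using unique_center[OF center_in_X[of v a], where 'p = 'p, of k] by metis
  have "{c \<in> residue_vecs (CARD('p) ^ k). center v c \<in> (padic_ball v a k :: ('p padic^'n) set)} = {b}"
  proof (intro set_eqI iffI)
    fix c assume "c \<in> {c \<in> residue_vecs (CARD('p) ^ k). center v c \<in> (padic_ball v a k :: ('p padic^'n) set)}"
    then have "c \<in> residue_vecs (CARD('p) ^ k)" "near k (center v a :: 'p padic^'n) (center v c)"
      unfolding padic_ball_eq by (auto dest: near_sym)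
    then show "c \<in> {b}" using b(3) by simp
  qed (use b(1) near_sym[OF b(2)] in \<open>simp add: padic_ball_eq\<close>)
  moreover have "\<phi> (scaled CARD('p) k a) = \<phi> (scaled CARD('p) k b)"
    using b(2) unfolding near_center by (intro phi_scaled_cong) blast
  ultimately show ?thesis by (simp add: level_sum_def)
qed

lemma padic_norm_phi: "padic_norm (of_rat (\<phi> w) :: 'p padic) \<le> 1 / padic_abs CARD('p) (of_nat m)"
proof -
  have "padic_abs CARD('p) (of_nat m) > 0" using m_pos by (simp add: padic_abs_pos[OF prime_card])
  then show ?thesis using integral[of w]
    by (simp add: padic_norm_of_rat padic_abs_mult[OF prime_card] field_simps)
qed

lemma values_sum: "(\<And>i. i \<in> I \<Longrightarrow> f i \<in> padic_values) \<Longrightarrow> (\<Sum>i\<in>I. f i) \<in> padic_values"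
  unfolding padic_values_def padic_ints_def by (simp add: sum_distrib_left) (rule padic_norm_sum_le, auto)

lemma phi_values: "of_rat (\<phi> w) \<in> padic_values"
proof -
  have "of_nat m * of_rat (\<phi> w) = (of_rat (of_nat m * \<phi> w) :: 'p padic)" by (simp add: of_rat_mult)
  then show ?thesis using integral by (simp add: padic_values_def padic_ints_def padic_norm_of_rat)
qed

text \<open>The property by which \<open>mu_l\<close> is selected as a definite description.\<close>

definition measure_spec :: "(('p padic, 'n) vec set \<Rightarrow> 'p padic) \<Rightarrow> bool" where
  "measure_spec \<mu> \<longleftrightarrow> padic_measure (X_coset v) padic_values \<mu> \<and> (\<forall>a k. \<mu> (padic_ball v a k) = of_rat (\<phi> (scaled CARD('p) k a)))"

lemma ball_compact_open: "padic_ball v a k \<in> compact_opens (X_coset v :: ('p padic^'n) set)"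
  unfolding compact_opens_X_coset padic_ball_eq
proof (intro conjI exI)
  show "{x. near k x (center v a)} \<subseteq> (X_coset v :: ('p padic^'n) set)"
  proof
    fix x :: "'p padic^'n" assume "x \<in> {x. near k x (center v a)}"
    then have "near 0 x (center v a)" using near_mono by auto
    moreover have "near 0 (center v a :: 'p padic^'n) (of_rat_vec v)"
      using center_in_X[of v a, where 'p = 'p] by (simp add: X_coset_eq)
    ultimately show "x \<in> X_coset v" unfolding X_coset_eq using near_trans by blast
  qed
qed (rule saturated_near)

text \<open>Finite additivity forces the value, since U is the disjoint union of the level k balls
  whose centers it contains.\<close>

lemma measure_spec_level_sum:
  assumes \<mu>: "measure_spec \<mu>" and U: "U \<subseteq> X_coset v" "saturated k U"
  shows "\<mu> U = of_rat (level_sum k U)"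
proof -
  let ?B = "\<lambda>a. padic_ball v a k :: ('p padic^'n) set"
  have add: "\<mu> (V \<union> W) = \<mu> V + \<mu> W" if "V \<in> compact_opens (X_coset v)" "W \<in> compact_opens (X_coset v)" "V \<inter> W = {}" for V W
    using \<mu> that by (auto simp: measure_spec_def padic_measure_def)
  have empty: "{} \<in> compact_opens (X_coset v :: ('p padic^'n) set)" by (simp add: compact_opens_def)
  have un: "\<mu> (\<Union>a\<in>A. ?B a) = (\<Sum>a\<in>A. of_rat (\<phi> (scaled CARD('p) k a))) \<and> (\<Union>a\<in>A. ?B a) \<in> compact_opens (X_coset v)"
    if "finite A" "A \<subseteq> residue_vecs (CARD('p) ^ k)" for A
    using that
  proof (induction A)
    case empty
    \<comment> \<open>Additivity for the disjoint pair of empty sets gives \<mu>({}) = \<mu>({}) +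
      \<mu>({}), hence \<mu>({}) = 0.\<close>
    then show ?case using add[OF \<open>{} \<in> _\<close> \<open>{} \<in> _\<close>] \<open>{} \<in> compact_opens _\<close> by simp
  next
    case (insert a A)
    have "?B a \<inter> (\<Union>a\<in>A. ?B a) = {}"
    proof (rule ccontr)
      assume "?B a \<inter> (\<Union>a\<in>A. ?B a) \<noteq> {}"
      then obtain x b where b: "b \<in> A" "x \<in> ?B a" "x \<in> ?B b" by auto
      then have "x \<in> X_coset v" using ball_compact_open[of a k] by (auto simp: compact_opens_def)
      from unique_center[OF this, of k] have "a = b" using b insert by (auto simp: padic_ball_eq)
      then show False using b insert by simp
    qed
    then have "\<mu> (?B a \<union> (\<Union>a\<in>A. ?B a)) = \<mu> (?B a) + \<mu> (\<Union>a\<in>A. ?B a)"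
      using insert by (intro add ball_compact_open) auto
    moreover have "\<mu> (?B a) = of_rat (\<phi> (scaled CARD('p) k a))" using \<mu> by (simp add: measure_spec_def)
    moreover have "?B a \<union> (\<Union>a\<in>A. ?B a) \<in> compact_opens (X_coset v)"
      using insert ball_compact_open[of a k] by (auto simp: compact_opens_def)
    ultimately show ?case using insert by simp
  qed
  have "U = (\<Union>a\<in>{a \<in> residue_vecs (CARD('p) ^ k). center v a \<in> U}. ?B a)"
  proof (intro set_eqI iffI)
    fix x assume x: "x \<in> U"
    then obtain a where a: "a \<in> residue_vecs (CARD('p) ^ k)" "near k x (center v a)" using unique_center U(1) by blast
    then have "center v a \<in> U" using saturatedD[OF U(2)] x by blast
    then show "x \<in> (\<Union>a\<in>{a \<in> residue_vecs (CARD('p) ^ k). center v a \<in> U}. ?B a)" using a by (auto simp: padic_ball_eq)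
  next
    fix x assume "x \<in> (\<Union>a\<in>{a \<in> residue_vecs (CARD('p) ^ k). center v a \<in> U}. ?B a)"
    then show "x \<in> U" using saturatedD[OF U(2)] by (auto simp: padic_ball_eq)
  qed
  then show ?thesis
    using un[of "{a \<in> residue_vecs (CARD('p) ^ k). center v a \<in> U}"] by (simp add: level_sum_def of_rat_sum)
qed

text \<open>All levels at which U is saturated give the same sum, so an arbitrary choice of level is
  harmless, and two sets can be compared at the larger of their levels.\<close>

lemma measure_spec_exists: "\<exists>\<mu>. measure_spec \<mu>"
proof -
  define K where "K U = (SOME k. saturated k U)" for U :: "('p padic^'n) set"
  define \<mu> :: "('p padic^'n) set \<Rightarrow> 'p padic" where
    "\<mu> U = (if U \<in> compact_opens (X_coset v) then of_rat (level_sum (K U) U) else 0)" for U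
  have K: "saturated (K U) U" if "U \<in> compact_opens (X_coset v)" for U
    using that unfolding compact_opens_X_coset K_def by (auto intro: someI_ex)
  have \<mu>: "\<mu> U = of_rat (level_sum k U)" if "U \<in> compact_opens (X_coset v)" "saturated k U" for U k
  proof -
    have "level_sum (max k (K U)) U = level_sum k U" "level_sum (max k (K U)) U = level_sum (K U) U"
      using that K[OF that(1)] by (auto intro!: level_sum_mono)
    then show ?thesis using that(1) by (simp add: \<mu>_def)
  qed
  have "measure_spec \<mu>"
    unfolding measure_spec_def padic_measure_def
  proof (intro conjI ballI allI impI)
    fix U V :: "('p padic^'n) set" assume UV: "U \<in> compact_opens (X_coset v)" "V \<in> compact_opens (X_coset v)" "U \<inter> V = {}"
    let ?k = "max (K U) (K V)"
    have sat: "saturated ?k U" "saturated ?k V"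
      using K[OF UV(1)] K[OF UV(2)] by (auto intro: saturated_mono)
    then have "saturated ?k (U \<union> V)" by (rule saturated_Un)
    moreover have "U \<union> V \<in> compact_opens (X_coset v)" using UV by (auto simp: compact_opens_def)
    ultimately show "\<mu> (U \<union> V) = \<mu> U + \<mu> V"
      using \<mu>[OF _ sat(1)] \<mu>[OF _ sat(2)] \<mu>[of "U \<union> V" ?k] UV by (simp add: level_sum_Un of_rat_add)
  next
    fix U :: "('p padic^'n) set" assume "U \<in> compact_opens (X_coset v)"
    then have "\<mu> U = (\<Sum>a\<in>{a \<in> residue_vecs (CARD('p) ^ K U). center v a \<in> U}. of_rat (\<phi> (scaled CARD('p) (K U) a)))"
      by (simp add: \<mu>_def level_sum_def of_rat_sum)
    then show "\<mu> U \<in> padic_values" by (simp only:) (intro values_sum phi_values)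
  next
    fix U :: "('p padic^'n) set" assume "U \<notin> compact_opens (X_coset v)"
    then show "\<mu> U = 0" by (simp add: \<mu>_def)
  next
    fix a k
    have "saturated k (padic_ball v a k :: ('p padic^'n) set)" unfolding padic_ball_eq by (rule saturated_near)
    then show "\<mu> (padic_ball v a k) = of_rat (\<phi> (scaled CARD('p) k a))"
      using \<mu>[OF ball_compact_open] by (simp add: level_sum_ball)
  qed
  then show ?thesis by blast
qed

lemma measure_spec_unique:
  assumes "measure_spec \<mu>" "measure_spec \<nu>"
  shows "\<mu> = \<nu>"
proof
  fix U
  show "\<mu> U = \<nu> U"
  proof (cases "U \<in> compact_opens (X_coset v)")
    case True
    then show ?thesis using measure_spec_level_sum[OF assms(1)] measure_spec_level_sum[OF assms(2)]
      unfolding compact_opens_X_coset by metis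
  next
    case False
    then show ?thesis using assms by (simp add: measure_spec_def padic_measure_def)
  qed
qed

text \<open>Boundedness is included because it closes the class under products, so that it contains
  the polynomials.\<close>

definition lipschitz :: "('p padic^'n \<Rightarrow> 'p padic) \<Rightarrow> bool" where
  "lipschitz f \<longleftrightarrow> (\<exists>C. \<forall>x\<in>X_coset v. padic_norm (f x) \<le> C \<and> (\<forall>y\<in>X_coset v. padic_norm (f x - f y) \<le> C * dist x y))"

lemma lipschitzE:
  assumes "lipschitz f"
  obtains C where "C \<ge> 0" "\<And>x. x \<in> X_coset v \<Longrightarrow> padic_norm (f x) \<le> C"
    "\<And>x y. x \<in> X_coset v \<Longrightarrow> y \<in> X_coset v \<Longrightarrow> padic_norm (f x - f y) \<le> C * dist x y"
proof -
  obtain C where C: "\<forall>x\<in>X_coset v. padic_norm (f x) \<le> C \<and> (\<forall>y\<in>X_coset v. padic_norm (f x - f y) \<le> C * dist x y)"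
    using assms by (auto simp: lipschitz_def)
  moreover have "C \<ge> 0"
    using C center_in_X[of v 0] padic_norm_nonneg order_trans by blast
  ultimately show ?thesis using that by blast
qed

lemma lipschitz_const: "lipschitz (\<lambda>x. c)"
  unfolding lipschitz_def by (intro exI[of _ "padic_norm c"]) (simp add: padic_norm_nonneg)

lemma lipschitz_add:
  assumes "lipschitz f" "lipschitz g"
  shows "lipschitz (\<lambda>x. f x + g x)"
proof -
  obtain B where B: "B \<ge> 0" "\<And>x. x \<in> X_coset v \<Longrightarrow> padic_norm (f x) \<le> B"
    "\<And>x y. x \<in> X_coset v \<Longrightarrow> y \<in> X_coset v \<Longrightarrow> padic_norm (f x - f y) \<le> B * dist x y"
    using assms(1) by (rule lipschitzE) blast
  obtain C where C: "C \<ge> 0" "\<And>x. x \<in> X_coset v \<Longrightarrow> padic_norm (g x) \<le> C"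
    "\<And>x y. x \<in> X_coset v \<Longrightarrow> y \<in> X_coset v \<Longrightarrow> padic_norm (g x - g y) \<le> C * dist x y"
    using assms(2) by (rule lipschitzE) blast
  show ?thesis unfolding lipschitz_def
  proof (intro exI[of _ "max B C"] ballI conjI)
    fix x :: "'p padic^'n" assume x: "x \<in> X_coset v"
    show "padic_norm (f x + g x) \<le> max B C"
      using padic_norm_add[of "f x" "g x"] B(2)[OF x] C(2)[OF x] by linarith
    fix y :: "'p padic^'n" assume y: "y \<in> X_coset v"
    have "padic_norm ((f x - f y) + (g x - g y)) \<le> max (B * dist x y) (C * dist x y)"
      using padic_norm_add[of "f x - f y" "g x - g y"] B(3)[OF x y] C(3)[OF x y] by linarith
    also have "\<dots> = max B C * dist x y" by (simp add: max_mult_distrib_right)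
    finally show "padic_norm (f x + g x - (f y + g y)) \<le> max B C * dist x y" by (simp add: algebra_simps)
  qed
qed

lemma lipschitz_mult:
  assumes "lipschitz f" "lipschitz g"
  shows "lipschitz (\<lambda>x. f x * g x)"
proof -
  obtain B where B: "B \<ge> 0" "\<And>x. x \<in> X_coset v \<Longrightarrow> padic_norm (f x) \<le> B"
    "\<And>x y. x \<in> X_coset v \<Longrightarrow> y \<in> X_coset v \<Longrightarrow> padic_norm (f x - f y) \<le> B * dist x y"
    using assms(1) by (rule lipschitzE) blast
  obtain C where C: "C \<ge> 0" "\<And>x. x \<in> X_coset v \<Longrightarrow> padic_norm (g x) \<le> C"
    "\<And>x y. x \<in> X_coset v \<Longrightarrow> y \<in> X_coset v \<Longrightarrow> padic_norm (g x - g y) \<le> C * dist x y"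
    using assms(2) by (rule lipschitzE) blast
  show ?thesis unfolding lipschitz_def
  proof (intro exI[of _ "B * C"] ballI conjI)
    fix x :: "'p padic^'n" assume x: "x \<in> X_coset v"
    show "padic_norm (f x * g x) \<le> B * C"
      unfolding padic_norm_mult by (intro mult_mono B C x padic_norm_nonneg)
    fix y :: "'p padic^'n" assume y: "y \<in> X_coset v"
    have 1: "padic_norm (f x * (g x - g y)) \<le> B * (C * dist x y)"
      unfolding padic_norm_mult by (intro mult_mono B C x y padic_norm_nonneg)
    have 2: "padic_norm ((f x - f y) * g y) \<le> (B * dist x y) * C"
      unfolding padic_norm_mult using B(1) by (intro mult_mono B C x y padic_norm_nonneg) simp
    have "padic_norm (f x * (g x - g y) + (f x - f y) * g y) \<le> B * C * dist x y"
      using padic_norm_add[of "f x * (g x - g y)" "(f x - f y) * g y"] 1 2 by (simp add: algebra_simps)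
    then show "padic_norm (f x * g x - f y * g y) \<le> B * C * dist x y" by (simp add: algebra_simps)
  qed
qed

lemma lipschitz_component: "lipschitz (\<lambda>x. x $ j)"
  unfolding lipschitz_def
proof (intro exI[of _ "max 1 (padic_norm (of_rat (v $ j) :: 'p padic))"] ballI conjI)
  fix x :: "'p padic^'n" assume "x \<in> X_coset v"
  then have "padic_norm (x $ j - of_rat (v $ j)) \<le> 1" by (simp add: X_coset_eq near_def of_rat_vec_def)
  then show "padic_norm (x $ j) \<le> max 1 (padic_norm (of_rat (v $ j) :: 'p padic))"
    using padic_norm_add[of "x $ j - of_rat (v $ j)" "of_rat (v $ j)"] by (simp add: le_max_iff_disj) linarith
  fix y :: "'p padic^'n"
  have "padic_norm (x $ j - y $ j) \<le> 1 * dist x y"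
    using dist_vec_nth_le[of x j y] by (simp add: dist_padic_def)
  also have "\<dots> \<le> max 1 (padic_norm (of_rat (v $ j) :: 'p padic)) * dist x y"
    by (intro mult_right_mono) auto
  finally show "padic_norm (x $ j - y $ j) \<le> max 1 (padic_norm (of_rat (v $ j) :: 'p padic)) * dist x y" .
qed

lemma lipschitz_sum: "(\<And>i. i \<in> I \<Longrightarrow> lipschitz (f i)) \<Longrightarrow> lipschitz (\<lambda>x. \<Sum>i\<in>I. f i x)"
  by (induction I rule: infinite_finite_induct) (auto intro: lipschitz_const lipschitz_add)

lemma lipschitz_prod: "(\<And>i. i \<in> I \<Longrightarrow> lipschitz (f i)) \<Longrightarrow> lipschitz (\<lambda>x. \<Prod>i\<in>I. f i x)"
  by (induction I rule: infinite_finite_induct) (auto intro: lipschitz_const lipschitz_mult)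

lemma lipschitz_power: "lipschitz f \<Longrightarrow> lipschitz (\<lambda>x. f x ^ k)"
  by (induction k) (auto intro: lipschitz_const lipschitz_mult)

lemma lipschitz_qpoly: "lipschitz (\<lambda>x. qpoly_insert of_rat (\<lambda>j. x $ j) P)"
  unfolding qpoly_insert_def
  by (intro lipschitz_sum lipschitz_mult lipschitz_const lipschitz_prod lipschitz_power lipschitz_component)

text \<open>Without such partitions every number would vacuously be an integral; they are what makes
  the integral unique.\<close>

lemma exists_fine_partition:
  assumes "\<delta> > 0"
  obtains \<U> t where "finite \<U>" "partition_on (X_coset v :: ('p padic^'n) set) \<U>" "\<U> \<subseteq> compact_opens (X_coset v)"
    "\<And>U. U \<in> \<U> \<Longrightarrow> t U \<in> U \<and> diameter U < \<delta>"
proof -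
  obtain k where k: "real CARD('n) * rad TYPE('p) k < \<delta>" by (rule exists_rad_less[OF assms])
  define \<U> where "\<U> = (\<lambda>a. padic_ball v a k :: ('p padic^'n) set) ` residue_vecs (CARD('p) ^ k)"
  have ne: "center v a \<in> padic_ball v a k" for a :: "int^'n" by (simp add: padic_ball_eq)
  show ?thesis
  proof (rule that[of \<U> "\<lambda>U. SOME x. x \<in> U"])
    show "finite \<U>" by (simp add: \<U>_def)
    show sub: "\<U> \<subseteq> compact_opens (X_coset v)" using ball_compact_open by (auto simp: \<U>_def)
    show "partition_on (X_coset v) \<U>"
    proof (rule partition_onI)
      show "\<Union> \<U> = X_coset v"
      proof
        show "\<Union> \<U> \<subseteq> X_coset v" using sub by (auto simp: compact_opens_def)
        show "X_coset v \<subseteq> \<Union> \<U>"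
        proof
          fix x :: "'p padic^'n" assume "x \<in> X_coset v"
          then obtain a where "a \<in> residue_vecs (CARD('p) ^ k)" "near k x (center v a)" using unique_center by blast
          then show "x \<in> \<Union> \<U>" by (auto simp: \<U>_def padic_ball_eq)
        qed
      qed
      show "{} \<notin> \<U>" using ne by (auto simp: \<U>_def)
      fix U V assume UV: "U \<in> \<U>" "V \<in> \<U>" "U \<noteq> V"
      then obtain a b where ab: "U = padic_ball v a k" "V = padic_ball v b k" by (auto simp: \<U>_def)
      show "disjnt U V"
      proof (rule ccontr)
        assume "\<not> disjnt U V"
        then obtain x :: "'p padic^'n" where x: "near k x (center v a)" "near k x (center v b)" by (auto simp: disjnt_def ab padic_ball_eq)
        then have "near k y (center v a) \<longleftrightarrow> near k y (center v b)" for y :: "'p padic^'n"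
          using near_trans[of k y "center v a"] near_trans[of k y "center v b"]
            near_trans[OF near_sym[OF x(1)] x(2)] near_trans[OF near_sym[OF x(2)] x(1)] by blast
        then have "U = V" by (simp add: ab padic_ball_eq)
        then show False using UV by simp
      qed
    qed
    fix U assume "U \<in> \<U>"
    then obtain a where a: "U = padic_ball v a k" by (auto simp: \<U>_def)
    have "diameter U \<le> real CARD('n) * rad TYPE('p) k"
    proof -
      have "dist x y \<le> real CARD('n) * rad TYPE('p) k" if "x \<in> U" "y \<in> U" for x y
      proof (rule near_imp_dist_le)
        show "near k x y" using that near_trans[OF _ near_sym, of k x "center v a" y] by (simp add: a padic_ball_eq)
      qed
      then show ?thesis
        using ne[of a] unfolding diameter_def a by (auto intro!: cSUP_least)
    qed
    moreover have "(SOME x. x \<in> U) \<in> U" using ne[of a] unfolding a by (rule someI)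
    ultimately show "(SOME x. x \<in> U) \<in> U \<and> diameter U < \<delta>" using k by simp
  qed
qed

text \<open>Two different integrals would both lie within half their distance of a common Riemann
  sum.\<close>

lemma padic_integral_unique:
  assumes "has_padic_integral f I (X_coset v :: ('p padic^'n) set) \<mu>"
  shows "padic_integral (X_coset v) f \<mu> = (I :: 'p padic)"
  unfolding padic_integral_def
proof (rule the_equality, rule assms)
  fix J assume J: "has_padic_integral f J (X_coset v) \<mu>"
  show "J = I"
  proof (rule ccontr)
    assume "J \<noteq> I"
    then have pos: "dist J I / 2 > 0" by simp
    obtain \<delta> where d: "\<delta> > 0"
      and I: "\<And>\<U> t. finite \<U> \<and> partition_on (X_coset v) \<U> \<and> \<U> \<subseteq> compact_opens (X_coset v) \<and> (\<forall>U\<in>\<U>. t U \<in> U \<and> diameter U < \<delta>) \<Longrightarrow>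
        dist (\<Sum>U\<in>\<U>. f (t U) * \<mu> U) I < dist J I / 2"
      using assms[unfolded has_padic_integral_def, rule_format, OF pos] by blast
    obtain \<delta>' where d': "\<delta>' > 0" and J: "\<And>\<U> t. finite \<U> \<and> partition_on (X_coset v) \<U> \<and> \<U> \<subseteq> compact_opens (X_coset v) \<and> (\<forall>U\<in>\<U>. t U \<in> U \<and> diameter U < \<delta>') \<Longrightarrow>
        dist (\<Sum>U\<in>\<U>. f (t U) * \<mu> U) J < dist J I / 2"
      using J[unfolded has_padic_integral_def, rule_format, OF pos] by blast
    obtain \<U> t where U: "finite \<U>" "partition_on (X_coset v :: ('p padic^'n) set) \<U>" "\<U> \<subseteq> compact_opens (X_coset v)"
      "\<And>U. U \<in> \<U> \<Longrightarrow> t U \<in> U \<and> diameter U < min \<delta> \<delta>'"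
      by (rule exists_fine_partition[of "min \<delta> \<delta>'"]) (use d d' in auto)
    have "dist (\<Sum>U\<in>\<U>. f (t U) * \<mu> U) I < dist J I / 2" by (rule I) (use U in auto)
    moreover have "dist (\<Sum>U\<in>\<U>. f (t U) * \<mu> U) J < dist J I / 2" by (rule J) (use U in auto)
    ultimately show False using dist_triangle2[of J I "\<Sum>U\<in>\<U>. f (t U) * \<mu> U"] by (simp add: dist_commute)
  qed
qed

text \<open>A fine Riemann sum is compared with the sum over centers at a level k at which all cells
  are saturated. The level depends on the partition, but the cost of moving the sample points to the
  centers is controlled by \<delta> alone, because the masses of all balls are bounded by B.\<close>

lemma measure_spec_has_integral:
  assumes \<mu>: "measure_spec \<mu>" and f: "lipschitz f"
    and I: "\<And>k. padic_norm (I - (\<Sum>a\<in>residue_vecs (CARD('p) ^ k). f (center v a) * of_rat (\<phi> (scaled CARD('p) k a)))) \<le> D * rad TYPE('p) k"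
  shows "has_padic_integral f I (X_coset v) \<mu>"
  unfolding has_padic_integral_def
proof (intro allI impI)
  fix e :: real assume e: "e > 0"
  obtain C where C: "C \<ge> 0" "\<And>x y. x \<in> X_coset v \<Longrightarrow> y \<in> X_coset v \<Longrightarrow> padic_norm (f x - f y) \<le> C * dist x y"
    using f by (rule lipschitzE) blast
  define B where "B = 1 / padic_abs CARD('p) (of_nat m)"
  have B: "B > 0" "\<And>w. padic_norm (of_rat (\<phi> w) :: 'p padic) \<le> B"
    using m_pos padic_norm_phi by (simp_all add: B_def padic_abs_pos[OF prime_card])
  \<comment> \<open>The summand 1 avoids a division by zero when C = 0; the choice ensures C
    \<delta> B \<le> e/2.\<close>
  define \<delta> where "\<delta> = e / 2 / (C * B + 1)"
  have CB: "C * B \<ge> 0" using B(1) C(1) by simp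
  have \<delta>: "\<delta> > 0" "C * \<delta> * B \<le> e / 2"
  proof -
    show "\<delta> > 0" using CB e by (simp add: \<delta>_def)
    have "(C * B) * (e / 2) \<le> (C * B + 1) * (e / 2)" using e by (intro mult_right_mono) auto
    then show "C * \<delta> * B \<le> e / 2" using CB by (simp add: \<delta>_def field_simps)
  qed
  show "\<exists>\<delta>>0. \<forall>\<U> t. finite \<U> \<and> partition_on (X_coset v) \<U> \<and> \<U> \<subseteq> compact_opens (X_coset v) \<and> (\<forall>U\<in>\<U>. t U \<in> U \<and> diameter U < \<delta>) \<longrightarrow>
      dist (\<Sum>U\<in>\<U>. f (t U) * \<mu> U) I < e"
  proof (intro exI[of _ \<delta>] conjI allI impI \<delta>(1); elim conjE)
    fix \<U> t assume U: "finite \<U>" "partition_on (X_coset v :: ('p padic^'n) set) \<U>" "\<U> \<subseteq> compact_opens (X_coset v)"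
      "\<forall>U\<in>\<U>. t U \<in> U \<and> diameter U < \<delta>"
    have "\<forall>U\<in>\<U>. \<exists>k. saturated k U" using U(3) unfolding compact_opens_X_coset[symmetric] by (auto simp: compact_opens_X_coset)
    then obtain K where K: "\<And>U. U \<in> \<U> \<Longrightarrow> saturated (K U) U" by metis

    \<comment> \<open>The sign of D is unknown, and the monotonicity argument from k1 to k needs a
      nonnegative constant.\<close>
    define D' where "D' = max D 0"
    obtain k1 where k1: "D' * rad TYPE('p) k1 < e" by (rule exists_rad_less[OF e])
    define k where "k = max k1 (Max (insert 0 (K ` \<U>)))"
    have sat: "saturated k U" if "U \<in> \<U>" for U
    proof (rule saturated_mono[OF K[OF that]])
      show "K U \<le> k" using U(1) that by (auto simp: k_def le_max_iff_disj)
    qed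
    have Dk: "D * rad TYPE('p) k < e"
    proof -
      have "D * rad TYPE('p) k \<le> D' * rad TYPE('p) k1"
        using rad_mono[where 'p = 'p, of k1 k] rad_pos[where 'p = 'p, of k]
        by (intro mult_mono) (auto simp: D'_def k_def)
      then show ?thesis using k1 by linarith
    qed
    have cover: "\<exists>!U. U \<in> \<U> \<and> x \<in> U" if "x \<in> X_coset v" for x
    proof (rule ex_ex1I)
      show "\<exists>U. U \<in> \<U> \<and> x \<in> U" using U(2) that by (auto simp: partition_on_def)
      show "U = W" if "U \<in> \<U> \<and> x \<in> U" "W \<in> \<U> \<and> x \<in> W" for U W
        using that U(2) unfolding partition_on_def disjoint_def by blast
    qed
    \<comment> \<open>The cell of the partition that contains the center with index a; being
      saturated, it contains the whole ball of level k about it.\<close>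
    define V where "V a = (THE U. U \<in> \<U> \<and> center v a \<in> U)" for a
    have V: "V a \<in> \<U>" "center v a \<in> V a" for a
      using theI'[OF cover[OF center_in_X[of v a]]] unfolding V_def by auto
    have V3: "center v a \<in> U \<longleftrightarrow> V a = U" if "U \<in> \<U>" for a U
      using cover[OF center_in_X[of v a]] V[of a] that by auto
    let ?\<phi> = "\<lambda>a. of_rat (\<phi> (scaled CARD('p) k a)) :: 'p padic"
    have "(\<Sum>U\<in>\<U>. f (t U) * \<mu> U) = (\<Sum>U\<in>\<U>. \<Sum>a\<in>{a \<in> residue_vecs (CARD('p) ^ k). V a = U}. f (t (V a)) * ?\<phi> a)"
    proof (rule sum.cong[OF refl])
      fix U assume UU: "U \<in> \<U>"
      then have "U \<subseteq> X_coset v" using U(3) by (auto simp: compact_opens_def)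
      then have "\<mu> U = of_rat (level_sum k U)" by (rule measure_spec_level_sum[OF \<mu> _ sat[OF UU]])
      also have "\<dots> = (\<Sum>a\<in>{a \<in> residue_vecs (CARD('p) ^ k). V a = U}. ?\<phi> a)"
        unfolding level_sum_def of_rat_sum by (simp add: V3[OF UU])
      finally show "f (t U) * \<mu> U = (\<Sum>a\<in>{a \<in> residue_vecs (CARD('p) ^ k). V a = U}. f (t (V a)) * ?\<phi> a)"
        by (simp add: sum_distrib_left)
    qed
    also have "\<dots> = (\<Sum>a\<in>residue_vecs (CARD('p) ^ k). f (t (V a)) * ?\<phi> a)"
      using V(1) by (intro sum.group) (auto simp: U(1))
    finally have sum: "(\<Sum>U\<in>\<U>. f (t U) * \<mu> U) = (\<Sum>a\<in>residue_vecs (CARD('p) ^ k). f (t (V a)) * ?\<phi> a)" .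
    have "padic_norm (\<Sum>a\<in>residue_vecs (CARD('p) ^ k). (f (t (V a)) - f (center v a)) * ?\<phi> a) \<le> e / 2"
    proof (rule padic_norm_sum_le)
      fix a
      have co: "V a \<in> compact_opens (X_coset v)" using U(3) V(1) by blast
      have tV: "t (V a) \<in> V a" "diameter (V a) < \<delta>" using U(4) V(1) by auto
      have "dist (t (V a)) (center v a) \<le> diameter (V a)"
        using co by (intro diameter_bounded_bound V(2) tV(1) compact_imp_bounded) (auto simp: compact_opens_def)
      then have d: "dist (t (V a)) (center v a) \<le> \<delta>" using tV(2) by simp
      have "t (V a) \<in> X_coset v" using tV(1) co by (auto simp: compact_opens_def)
      then have "padic_norm (f (t (V a)) - f (center v a)) \<le> C * dist (t (V a)) (center v a)"
        by (rule C(2)[OF _ center_in_X])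
      also have "\<dots> \<le> C * \<delta>" using d C(1) by (rule mult_left_mono)
      finally have "padic_norm ((f (t (V a)) - f (center v a)) * ?\<phi> a) \<le> C * \<delta> * B"
        unfolding padic_norm_mult using C(1) \<delta>(1) by (intro mult_mono B(2) padic_norm_nonneg) auto
      then show "padic_norm ((f (t (V a)) - f (center v a)) * ?\<phi> a) \<le> e / 2" using \<delta>(2) by linarith
    qed (use e in simp)
    then have 1: "padic_norm ((\<Sum>U\<in>\<U>. f (t U) * \<mu> U) - (\<Sum>a\<in>residue_vecs (CARD('p) ^ k). f (center v a) * ?\<phi> a)) < e"
      unfolding sum using e by (simp add: sum_subtractf left_diff_distrib)
    have 2: "padic_norm ((\<Sum>a\<in>residue_vecs (CARD('p) ^ k). f (center v a) * ?\<phi> a) - I) < e"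
      using I[of k] Dk by (simp add: padic_norm_commute[of _ I])
    \<comment> \<open>By the ultrametric inequality, two errors below e give a total error below
      e.\<close>
    show "dist (\<Sum>U\<in>\<U>. f (t U) * \<mu> U) I < e"
      using padic_norm_triangle[of "\<Sum>U\<in>\<U>. f (t U) * \<mu> U" I "\<Sum>a\<in>residue_vecs (CARD('p) ^ k). f (center v a) * ?\<phi> a"] 1 2
      unfolding dist_padic_def by linarith
  qed
qed

end

section \<open>Matrices from the congruence group\<close>

lemma Z_loc_iff:
  assumes "prime l"
  shows "x \<in> Z_loc l \<longleftrightarrow> padic_abs l x \<le> 1"
  unfolding Z_loc_def using padic_abs_le_1I[OF assms] padic_abs_le_1D[OF assms] by (auto, metis)

lemma padic_abs_sum_less:
  assumes "prime l" "\<And>i. i \<in> I \<Longrightarrow> padic_abs l (f i) < C" "C > 0"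
  shows "padic_abs l (\<Sum>i\<in>I. f i) < C"
  using assms(2)
proof (induction I rule: infinite_finite_induct)
  case (insert i I)
  have "padic_abs l (f i + sum f I) \<le> max (padic_abs l (f i)) (padic_abs l (sum f I))" by (rule padic_abs_add[OF assms(1)])
  also have "\<dots> < C" using insert by simp
  finally show ?case using insert by simp
qed (use assms(1,3) in \<open>auto simp: padic_abs_0\<close>)

lemma padic_abs_multiple_less_1:
  assumes l: "prime l" and "padic_abs l c \<le> 1"
  shows "padic_abs l (of_nat l * c) < 1"
proof -
  have "multiplicity (int l) (int l) = 1"
    using l by (metis multiplicity_same_power power_one_right not_prime_0 not_prime_unit prime_int_nat_transfer prime_nat_int_transfer of_nat_eq_0_iff)
  then have "padic_abs l (of_int (int l) / of_int 1) = real l powi (- 1)"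
    using prime_gt_0_nat[OF l] by (subst padic_abs_Fract[OF l]) auto
  then have "padic_abs l (of_nat l) = 1 / real l" by (simp add: power_int_minus divide_inverse)
  then have "padic_abs l (of_nat l * c) \<le> 1 / real l"
    using assms(2) prime_gt_0_nat[OF l] by (simp add: padic_abs_mult[OF l] divide_right_mono)
  also have "\<dots> < 1" using prime_gt_1_nat[OF l] by simp
  finally show ?thesis .
qed

text \<open>The remainder of K modulo the least common denominator would be a smaller common
  denominator unless it is 0.\<close>

lemma common_denom_dvd:
  fixes B :: "'n::finite qmat"
  assumes "K > 0" "\<And>i j. of_nat K * B $ i $ j \<in> \<int>"
  shows "common_denom B dvd K" "common_denom B > 0" "of_nat (common_denom B) * B $ i $ j \<in> \<int>"
proof -
  let ?P = "\<lambda>N. N > 0 \<and> (\<forall>i j. of_nat N * B $ i $ j \<in> \<int>)"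
  let ?N = "common_denom B"
  have N: "?P ?N" unfolding common_denom_def by (rule LeastI[of ?P K]) (use assms in auto)
  then show "?N > 0" "of_nat ?N * B $ i $ j \<in> \<int>" by auto
  have "of_nat (K mod ?N) * B $ i $ j \<in> \<int>" for i j
  proof -
    have "of_nat K = of_nat (K div ?N) * of_nat ?N + (of_nat (K mod ?N) :: rat)"
      by (metis div_mult_mod_eq of_nat_add of_nat_mult)
    then have "of_nat (K mod ?N) * B $ i $ j = of_nat K * B $ i $ j - of_nat (K div ?N) * (of_nat ?N * B $ i $ j)"
      by (simp add: algebra_simps)
    then show ?thesis using assms(2) N by (simp add: Ints_diff Ints_mult)
  qed
  moreover have "K mod ?N < ?N" using N by simp
  moreover have "\<not> ?P (K mod ?N)" if "K mod ?N < ?N"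
    using not_less_Least[of "K mod ?N" ?P] that by (simp only: common_denom_def) blast
  ultimately have "K mod ?N = 0" by (metis gr0I)
  then show "?N dvd K" by auto
qed

text \<open>All denominators are prime to l, so clearing them does not affect divisibility by l. If
  the first entry of a column were divisible by l, so would be the whole first column of A_j,
  against invertibility over Z_(l).\<close>

lemma smoothing_first_columns:
  fixes A :: "'n::{finite,linorder} \<Rightarrow> 'n qmat"
  assumes l: "prime l" and A: "\<And>i. A i \<in> Gamma_l l" and det: "det (first_columns A) \<noteq> 0"
  obtains S where "smoothing l S" "clear_denoms (first_columns A) = of_int_mat S"
proof -
  let ?B = "first_columns A"
  let ?N = "common_denom ?B"
  have entry: "?B $ i $ j \<in> Z_loc l" for i j
    using A[of j] by (auto simp: first_columns_def Gamma_l_def GL_over_def)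
  have "\<exists>b. \<not> int l dvd b \<and> of_int b * ?B $ i $ j \<in> \<int>" for i j
  proof -
    obtain a b where ab: "\<not> int l dvd b" "?B $ i $ j = of_int a / of_int b" using entry[of i j] by (auto simp: Z_loc_def)
    then have "of_int b * ?B $ i $ j = of_int a" by (cases "b = 0") auto
    then show ?thesis using ab(1) by (metis Ints_of_int)
  qed
  then obtain b where b: "\<And>i j. \<not> int l dvd b i j" "\<And>i j. of_int (b i j) * ?B $ i $ j \<in> \<int>" by metis
  \<comment> \<open>A common denominator prime to l; the least one divides it and is therefore prime
    to l as well.\<close>
  define K where "K = nat \<bar>\<Prod>i\<in>UNIV. \<Prod>j\<in>UNIV. b i j\<bar>"
  have prod: "\<not> int l dvd (\<Prod>i\<in>UNIV. \<Prod>j\<in>UNIV. b i j)"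
    using b(1) l by (simp add: prime_dvd_prod_iff)
  have intK: "int K = \<bar>\<Prod>i\<in>UNIV. \<Prod>j\<in>UNIV. b i j\<bar>" unfolding K_def by simp
  have K: "\<not> l dvd K"
  proof
    assume "l dvd K"
    then have "int l dvd int K" by simp
    then show False using prod unfolding intK by simp
  qed
  then have K0: "K > 0" by (cases "K = 0") simp_all
  have KB: "of_nat K * ?B $ i $ j \<in> \<int>" for i j
  proof -
    have "b i j dvd (\<Prod>j\<in>UNIV. b i j)" by (rule dvd_prodI) auto
    also have "\<dots> dvd (\<Prod>i\<in>UNIV. \<Prod>j\<in>UNIV. b i j)" by (rule dvd_prodI) auto
    finally obtain q where q: "(\<Prod>i\<in>UNIV. \<Prod>j\<in>UNIV. b i j) = b i j * q" by blast
    have "rat_of_nat K = of_int \<bar>b i j * q\<bar>" using arg_cong[OF intK[unfolded q], of rat_of_int] by simp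
    then have "rat_of_nat K = of_int (b i j) * of_int q \<or> rat_of_nat K = - (of_int (b i j) * of_int q)"
      by (simp add: abs_if split: if_splits)
    then show ?thesis using Ints_mult[OF b(2)[of i j] Ints_of_int[of q]]
      by (auto simp: ac_simps)
  qed
  note N = common_denom_dvd[OF K0 KB]
  have lN: "\<not> int l dvd int ?N" using N(1) K dvd_trans by auto
  have "\<exists>s. of_int s = of_nat ?N * ?B $ i $ j" for i j using N(3)[of i j] by (metis Ints_cases)
  then obtain s where s: "\<And>i j. of_int (s i j) = of_nat ?N * ?B $ i $ j" by metis
  define S :: "'n zmat" where "S = (\<chi> i j. s i j)"
  have clear: "clear_denoms ?B = of_int_mat S"
    by (simp add: vec_eq_iff clear_denoms_def S_def s)
  have "clear_denoms ?B = mat (of_nat ?N) ** ?B"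
    by (simp add: vec_eq_iff clear_denoms_def matrix_matrix_mult_def mat_def if_distrib[of "\<lambda>x. x * _"] cong: if_cong)
  moreover have "det (mat (of_nat ?N) :: 'n qmat) \<noteq> 0"
    using N(2) by (simp add: det_diagonal mat_def)
  ultimately have det_nz: "det (of_int_mat S :: 'n qmat) \<noteq> 0"
    using det unfolding clear[symmetric] by (simp add: det_mul)
  have "smoothing l S"
  proof
    fix j
    show "\<not> int l dvd S $ first $ j"
    proof
      assume dvd: "int l dvd S $ first $ j"
      obtain C :: "'n qmat" where C: "\<And>i k. C $ i $ k \<in> Z_loc l" "C ** A j = mat 1"
        using A[of j] by (auto simp: Gamma_l_def GL_over_def)
      have small: "padic_abs l (A j $ k $ first) < 1" for k
      proof (cases "k = first")
        case True
        obtain q where q: "S $ first $ j = int l * q" using dvd by blast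
        have "?B $ first $ j = of_int (S $ first $ j) / of_nat ?N" using s[of first j] N(2) by (simp add: S_def field_simps)
        also have "\<dots> = of_nat l * (of_int q / of_int (int ?N))" by (simp add: q)
        finally have "A j $ first $ first = of_nat l * (of_int q / of_int (int ?N))" by (simp add: first_columns_def)
        then show ?thesis using True padic_abs_multiple_less_1[OF l padic_abs_le_1I[OF l lN]] by simp
      next
        case False
        then obtain c where "c \<in> Z_loc l" "A j $ k $ first = of_nat l * c" using A[of j] by (auto simp: Gamma_l_def)
        then show ?thesis using padic_abs_multiple_less_1[OF l] by (simp add: Z_loc_iff[OF l])
      qed
      \<comment> \<open>This sum is the first diagonal entry of C A_j = 1, which cannot have l-adic
        absolute value below 1.\<close>
      have "padic_abs l (\<Sum>k\<in>UNIV. C $ first $ k * A j $ k $ first) < 1"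
      proof (rule padic_abs_sum_less[OF l])
        fix k
        have "padic_abs l (C $ first $ k) * padic_abs l (A j $ k $ first) \<le> 1 * padic_abs l (A j $ k $ first)"
          using C(1)[of first k] by (intro mult_right_mono) (simp_all add: Z_loc_iff[OF l] padic_abs_nonneg[OF l])
        then show "padic_abs l (C $ first $ k * A j $ k $ first) < 1"
          using small[of k] by (simp add: padic_abs_mult[OF l])
      qed simp
      moreover have "(\<Sum>k\<in>UNIV. C $ first $ k * A j $ k $ first) = (C ** A j) $ first $ first"
        by (simp add: matrix_matrix_mult_def)
      ultimately show False using C(2) by (simp add: mat_def padic_abs_1[OF l])
    qed
  next
    fix i j :: 'n assume "i \<noteq> first"
    then obtain c where c: "c \<in> Z_loc l" "?B $ i $ j = of_nat l * c"
      using A[of j] by (auto simp: Gamma_l_def first_columns_def)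
    obtain a d where ad: "\<not> int l dvd d" "c = of_int a / of_int d" using c(1) by (auto simp: Z_loc_def)
    have "rat_of_int (S $ i $ j) = of_nat ?N * (of_nat l * (of_int a / of_int d))" using s[of i j] c ad by (simp add: S_def)
    then have "of_int (S $ i $ j * d) = (of_int (int l * (int ?N * a)) :: rat)" using ad(1) by (cases "d = 0") simp_all
    then have "S $ i $ j * d = int l * (int ?N * a)" by (simp only: of_int_eq_iff)
    then have "int l dvd S $ i $ j * d" by simp
    then show "int l dvd S $ i $ j" using l ad(1) by (simp add: prime_dvd_mult_iff)
  qed (use l det_nz in auto)
  then show ?thesis using clear that by blast
qed

theorem theorem4p2:
  fixes l :: nat
    and A :: "'n::{finite,linorder} \<Rightarrow> 'n qmat"
    and Q :: "('n, 'm::finite) forms"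
    and v :: "'n qvec"
    and P :: "'n qpoly"
  assumes "prime l"
    and "l \<noteq> CARD('p::prime_card)"
    and "\<And>i. A i \<in> Gamma_lp l CARD('p::prime_card)"
    and "Q \<in> linear_forms"
  shows "(of_rat (Psi_l l A P Q v) :: 'p::prime_card padic) =
    padic_integral (X_coset v) (\<lambda>x. qpoly_insert of_rat (\<lambda>j. x $ j) P) (mu_l l A Q v)"
proof (cases "det (first_columns A) = 0")
  case True
  have "clear_denoms (first_columns A) = mat (of_nat (common_denom (first_columns A))) ** first_columns A"
    by (simp add: vec_eq_iff clear_denoms_def matrix_matrix_mult_def mat_def if_distrib[of "\<lambda>x. x * _"] cong: if_cong)
  then have "det (clear_denoms (first_columns A)) = 0" using True by (simp add: det_mul)
  then have Psi: "Psi_l l A P Q v = 0" by (simp add: Psi_l_def Psi_homogeneous_def D_l_def)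
  \<comment> \<open>The zero distribution gives access to the uniqueness of integrals over X_v, here
    for the zero measure.\<close>
  interpret padic_distribution "\<lambda>w. 0" v 1 "TYPE('p)"
    by standard (simp_all add: padic_abs_0[OF prime_card])
  have "has_padic_integral f 0 (X_coset v) (\<lambda>U. 0)" for f :: "('p padic, 'n) vec \<Rightarrow> 'p padic"
    unfolding has_padic_integral_def by (auto intro!: exI[of _ "1 :: real"])
  from padic_integral_unique[OF this] show ?thesis using True by (simp add: Psi mu_l_def)
next
  case False
  have "\<And>i. A i \<in> Gamma_l l" using assms(3) by (simp add: Gamma_lp_def)
  then obtain S where S: "smoothing l S" "clear_denoms (first_columns A) = of_int_mat S"
    using smoothing_first_columns[OF assms(1) _ False] by blast
  interpret smoothing l S by (rule S(1))
  have Psi: "Psi_l l A R Q w = Psi R Q w" for R w by (simp add: Psi_l_def Psi_def S(2) Let_def)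
  have pr: "prime CARD('p)" by (rule prime_card)
  \<comment> \<open>The condition l \<noteq> p gives both the distribution relation for N = p and
    the bound on the denominators.\<close>
  interpret padic_distribution "Psi 1 Q" v "CARD('m)" "TYPE('p)"
  proof
    show "Psi 1 Q (w + of_int_vec z) = Psi 1 Q w" for w z by (rule Psi_1_periodic[OF assms(4) pr])
    show "Psi 1 Q w = (\<Sum>y\<in>residue_vecs CARD('p). Psi 1 Q ((1 / of_nat CARD('p)) *s (w + of_int_vec y)))" for w
      using assms(1,2) pr by (intro Psi_1_distribution[OF assms(4) pr]) (auto intro: primes_coprime prime_gt_0_nat)
    show "padic_abs CARD('p) (of_nat CARD('m) * Psi 1 Q w) \<le> 1" for w
      using assms(2) by (intro Psi_1_integral[OF assms(4) pr]) simp
  qed simp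
  have scaled: "(\<chi> i. (v $ i + of_int (a $ i)) / of_nat CARD('p) ^ k) = scaled CARD('p) k a" for a k
    by (simp add: scaled_def vec_eq_iff add_divide_distrib)
  have "mu_l l A Q v = (THE \<mu>. measure_spec \<mu>)"
    using False unfolding mu_l_def measure_spec_def padic_values_def Psi scaled by simp
  then have \<mu>: "measure_spec (mu_l l A Q v)"
    using theI[of measure_spec] measure_spec_exists measure_spec_unique by metis
  let ?f = "\<lambda>x :: ('p padic, 'n) vec. qpoly_insert of_rat (\<lambda>j. x $ j) P"
  obtain C where C: "\<And>k. padic_abs CARD('p) (Psi P Q v - (\<Sum>a\<in>residue_vecs (CARD('p) ^ k).
      qpoly_eval (\<lambda>j. (v + of_int_vec a) $ j) P * Psi 1 Q ((1 / of_nat CARD('p) ^ k) *s (v + of_int_vec a))))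
      \<le> C / of_nat CARD('p) ^ k"
    using Psi_riemann_sum[OF assms(4) pr, of P v] assms(2) by auto
  have f: "?f (center v a) = of_rat (qpoly_eval (\<lambda>j. (v + of_int_vec a) $ j) P)" for a
    by (simp add: of_rat_vec_def of_rat_add flip: qpoly_insert_of_rat)
  have "padic_norm (of_rat (Psi P Q v) - (\<Sum>a\<in>residue_vecs (CARD('p) ^ k). ?f (center v a) * of_rat (Psi 1 Q (scaled CARD('p) k a))))
      \<le> C * rad TYPE('p) k" for k
    using C[of k] unfolding f scaled_def
    by (simp only: padic_norm_of_rat times_divide_eq_right mult_1_right flip: of_rat_mult of_rat_sum of_rat_diff)
  from measure_spec_has_integral[OF \<mu> lipschitz_qpoly this]
  show ?thesis unfolding Psi by (rule padic_integral_unique[symmetric])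
qed

end
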